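(* Let $\mathfrak g=\mathfrak l\oplus\mathfrak m$ be a reductive decomposition of a Lie algebra $\mathfrak g$, and let $\mathcal G=(\mathfrak g,[\,,\,],\varpi,\varphi)$ be a Lie quasi-bialgebra such that $\varpi_z=0$ for all $z\in\mathfrak l$. Then there is a well-defined embedding (injective map) $$\mathcal M(\mathcal G,\mathfrak l)\longrightarrow\mathcal M_{\mathcal G,\mathfrak l,\mathfrak m}=\{t\in(\wedge^2\mathfrak m)^{\mathfrak l}:\ \varphi^t\equiv0\bmod\mathfrak l\}$$ which sends a class $\mathcal C$ to $l_0$, where $l\in\mathcal C$ is any representative such that $l_0\mathfrak m^\perp=0$ and $l_0\mathfrak l^\perp\subset\mathfrak m$.
   Context: Conventions: vector spaces are finite-dimensional over $\mathbb K=\mathbb R$ or $\mathbb C$; $f^*$ is the transpose of $f$; $\mathcal A(\mathfrak g^*,\mathfrak g)$ is the set of linear maps $t:\mathfrak g^*\to\mathfrak g$ with $t^*=-t$; $\mathrm{ad}^*_x$ is the transpose of $\mathrm{ad}_x$; $A^\perp$ is the annihilator of $A$; $\sum_{\mathrm{cyc}}$ is the sum over cyclic permutations. Lie quasi-bialgebra: a quadruple $\mathcal G=(\mathfrak g,[\,,\,],\varpi,\varphi)$ with $\varpi:\mathfrak g\to\mathcal A(\mathfrak g^*,\mathfrak g)$ linear with $\varpi_{[x,y]}=\mathrm{ad}_x\varpi_y+\varpi_y\mathrm{ad}^*_x-\mathrm{ad}_y\varpi_x-\varpi_x\mathrm{ad}^*_y$ (a $1$-cocycle), $\varphi\in\wedge^3\mathfrak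 g$, such that $\mathfrak d=\mathfrak g\oplus\mathfrak g^*$ with bracket $[x,y]_{\mathfrak d}=[x,y]$, $[x,\xi]_{\mathfrak d}=\varpi_x\xi-\mathrm{ad}^*_x\xi$, $[\xi,\eta]_{\mathfrak d}=\langle\eta,\varpi_\bullet\xi\rangle+\langle\xi\otimes\eta\otimes1,\varphi\rangle$ is a Lie algebra. For $t\in\mathcal A(\mathfrak g^*,\mathfrak g)$: $\langle\xi\otimes\eta\otimes\zeta,\varphi^t\rangle=\langle\xi\otimes\eta\otimes\zeta,\varphi\rangle+\sum_{\mathrm{cyc}(\xi,\eta,\zeta)}\langle\zeta,[t\xi,t\eta]+\varpi_{t\xi}\eta\rangle$. "$\equiv0\bmod\mathfrak l$" means vanishing on $\mathfrak l^\perp\times\mathfrak l^\perp\times\mathfrak l^\perp$. Reductive decomposition: $\mathfrak g=\mathfrak l\oplus\mathfrak m$, $\mathfrak l$ a subalgebra, $[\mathfrak l,\mathfrak m]\subset\mathfrak m$; $i:\mathfrak l\to\mathfrak g$ is the inclusion. $(\wedge^2\mathfrak m)^{\mathfrak l}$ is the set of $t\in\mathcal A(\mathfrak g^*,\mathfrak g)$ with $t\mathfrak m^\perp=0$, $t\mathfrak l^\perp\subset\mathfrak m$ and $\mathrm{ad}_zt+t\,\mathrm{ad}^*_z=0$ for $z\in\mathfrak l$. $\mathbb D$ is the formal neighbourhood of $0\in\mathfrak l^*$ (maps from $\mathbb D$ are formal power series at $0$). A formal dynamical $\ell$-matrix is a formal map $l:\mathbb D\to\mathcal A(\mathfrak g^*,\mathfrak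 g)$ satisfying, formally in $p$, for all $\xi,\eta,\zeta\in\mathfrak g^*$, $z\in\mathfrak l$: $$\sum_{\mathrm{cyc}(\xi,\eta,\zeta)}\big(\langle\zeta,d_pl(i^*\xi)\eta\rangle-\langle\zeta,[l_p\xi,l_p\eta]\rangle-\langle\zeta,\varpi_{l_p\xi}\eta\rangle\big)=\langle\xi\otimes\eta\otimes\zeta,\varphi\rangle,\qquad d_pl(\mathrm{ad}^*_zp)+\varpi_{iz}+\mathrm{ad}_{iz}l_p+l_p\mathrm{ad}^*_{iz}=0.$$ The set of these is $\mathrm{Dynl}(\mathbb D,\mathcal G)$. Gauge group: let $G$ be a Lie group with Lie algebra $\mathfrak g$. $\mathrm{Map}_0(\mathbb D,G)^{\mathfrak l}$ is the group (pointwise product) of formal maps $\sigma:\mathbb D\to G$ with $\sigma_0=1$ that are $\mathfrak l$-equivariant; writing $\sigma=e^{\Sigma}$ with $\Sigma:\mathbb D\to\mathfrak g$ formal, $\Sigma_0=0$, equivariance means $d_p\Sigma(\mathrm{ad}^*_zp)=-[z,\Sigma_p]$ for $z\in\mathfrak l$. It acts on $\mathrm{Dynl}(\mathbb D,\mathcal G)$ by $l^\sigma_p=\mathrm{Ad}_{\sigma_p}l_p\mathrm{Ad}^*_{\sigma_p}+\theta^\sigma_p+\pi_{\sigma_p}$, where $\theta^\sigma_p=S_pi^*\mathrm{Ad}^*_{\sigma_p}-iS_p^*$ with $S_p=\frac{e^{\mathrm{ad}_{\Sigma_p}}-1}{\mathrm{ad}_{\Sigma_p}}\circ d_p\Sigma:\mathfrak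 l^*\to\mathfrak g$ (the right-translated differential of $\sigma$; $S_p^*$ takes values in $\mathfrak l$), and $\pi$ is the group $1$-cocycle integrating $\varpi$, i.e. $\pi_{e^x}=\int_0^1\mathrm{Ad}_{e^{\tau x}}\varpi_x\mathrm{Ad}^*_{e^{\tau x}}\,d\tau$. The moduli space is the orbit space $\mathcal M(\mathcal G,\mathfrak l)=\mathrm{Dynl}(\mathbb D,\mathcal G)/\mathrm{Map}_0(\mathbb D,G)^{\mathfrak l}$. *)

theory Defs
  imports "HOL-Analysis.Analysis" "HOL-Library.Function_Algebras" "HOL-Library.Multiset"
begin

text \<open>
  The ground field is a type of sort \<open>{real_normed_field, banach}\<close>. Up to isomorphism (Gelfand-Mazur)
  the only such types are the real and the complex numbers. The Lie algebra \<open>\<gg>\<close> is a whole type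
  \<open>'g\<close> with scalar multiplication \<open>sc\<close> and bracket \<open>br\<close>. Addition of functions is pointwise.
\<close>

section \<open>Linear algebra\<close>

definition dual :: "('k::field \<Rightarrow> 'g::ab_group_add \<Rightarrow> 'g) \<Rightarrow> ('g \<Rightarrow> 'k) set" where
  "dual sc = {\<xi>. Vector_Spaces.linear sc (*) \<xi>}"

definition fun_scale :: "('k \<Rightarrow> 'v \<Rightarrow> 'v) \<Rightarrow> 'k \<Rightarrow> ('a \<Rightarrow> 'v) \<Rightarrow> 'a \<Rightarrow> 'v" where
  "fun_scale sc c f = (\<lambda>x. sc c (f x))"

definition linear_on ::
  "'v::ab_group_add set \<Rightarrow> ('k \<Rightarrow> 'v \<Rightarrow> 'v) \<Rightarrow> ('k \<Rightarrow> 'w::ab_group_add \<Rightarrow> 'w) \<Rightarrow> ('v \<Rightarrow> 'w) \<Rightarrow> bool" where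
  "linear_on V s1 s2 f \<longleftrightarrow>
     (\<forall>x\<in>V. \<forall>y\<in>V. f (x + y) = f x + f y) \<and> (\<forall>c. \<forall>x\<in>V. f (s1 c x) = s2 c (f x))"

definition annihilator :: "('k::field \<Rightarrow> 'g::ab_group_add \<Rightarrow> 'g) \<Rightarrow> 'g set \<Rightarrow> ('g \<Rightarrow> 'k) set" where
  "annihilator sc A = {\<xi> \<in> dual sc. \<forall>x\<in>A. \<xi> x = 0}"

text \<open>
  The space \<open>\<A>(\<gg>\<^sup>*, \<gg>)\<close>. Functions of type \<open>('g \<Rightarrow> 'k) \<Rightarrow> 'g\<close> are also defined off \<open>\<gg>\<^sup>*\<close>; they are
  required to vanish there, so that equality of such functions is equality of maps on \<open>\<gg>\<^sup>*\<close>.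
\<close>

definition skew_maps ::
  "('k::field \<Rightarrow> 'g::ab_group_add \<Rightarrow> 'g) \<Rightarrow> (('g \<Rightarrow> 'k) \<Rightarrow> 'g) set" where
  "skew_maps sc =
     {t. linear_on (dual sc) (fun_scale (*)) sc t \<and>
         (\<forall>\<xi>\<in>dual sc. \<forall>\<eta>\<in>dual sc. \<xi> (t \<eta>) = - \<eta> (t \<xi>)) \<and>
         (\<forall>\<xi>. \<xi> \<notin> dual sc \<longrightarrow> t \<xi> = 0)}"

text \<open>
  An element \<open>\<phi>\<close> of \<open>\<wedge>\<^sup>3\<gg>\<close> is encoded by the map \<open>(\<xi>, \<eta>) \<mapsto> \<langle>\<xi> \<otimes> \<eta> \<otimes> 1, \<phi>\<rangle>\<close> with values in \<open>\<gg>\<close>,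
  so that \<open>\<langle>\<xi> \<otimes> \<eta> \<otimes> \<zeta>, \<phi>\<rangle> = \<zeta> (\<phi> \<xi> \<eta>)\<close>.
\<close>

definition trivector ::
  "('k::field \<Rightarrow> 'g::ab_group_add \<Rightarrow> 'g) \<Rightarrow> (('g \<Rightarrow> 'k) \<Rightarrow> ('g \<Rightarrow> 'k) \<Rightarrow> 'g) \<Rightarrow> bool" where
  "trivector sc \<phi> \<longleftrightarrow>
     (\<forall>\<xi>\<in>dual sc. linear_on (dual sc) (fun_scale (*)) sc (\<phi> \<xi>)) \<and>
     (\<forall>\<eta>\<in>dual sc. linear_on (dual sc) (fun_scale (*)) sc (\<lambda>\<xi>. \<phi> \<xi> \<eta>)) \<and>
     (\<forall>\<xi>\<in>dual sc. \<forall>\<eta>\<in>dual sc. \<forall>\<zeta>\<in>dual sc.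
        \<zeta> (\<phi> \<xi> \<eta>) = - \<zeta> (\<phi> \<eta> \<xi>) \<and> \<zeta> (\<phi> \<xi> \<eta>) = - \<eta> (\<phi> \<xi> \<zeta>))"

definition cyc :: "('a \<Rightarrow> 'a \<Rightarrow> 'a \<Rightarrow> 'b::ab_group_add) \<Rightarrow> 'a \<Rightarrow> 'a \<Rightarrow> 'a \<Rightarrow> 'b" where
  "cyc F \<xi> \<eta> \<zeta> = F \<xi> \<eta> \<zeta> + F \<eta> \<zeta> \<xi> + F \<zeta> \<xi> \<eta>"


section \<open>Lie algebras and Lie quasi-bialgebras\<close>

definition lie_algebra_on ::
  "('k::field \<Rightarrow> 'v::ab_group_add \<Rightarrow> 'v) \<Rightarrow> 'v set \<Rightarrow> ('v \<Rightarrow> 'v \<Rightarrow> 'v) \<Rightarrow> bool" where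
  "lie_algebra_on sc V br \<longleftrightarrow>
     vector_space sc \<and> module.subspace sc V \<and>
     (\<forall>x\<in>V. \<forall>y\<in>V. br x y \<in> V) \<and>
     (\<forall>x\<in>V. linear_on V sc sc (br x)) \<and>
     (\<forall>y\<in>V. linear_on V sc sc (\<lambda>x. br x y)) \<and>
     (\<forall>x\<in>V. br x x = 0) \<and>
     (\<forall>x\<in>V. \<forall>y\<in>V. \<forall>z\<in>V. br x (br y z) + br y (br z x) + br z (br x y) = 0)"

definition ad_star :: "('g \<Rightarrow> 'g \<Rightarrow> 'g) \<Rightarrow> 'g \<Rightarrow> ('g \<Rightarrow> 'k) \<Rightarrow> 'g \<Rightarrow> 'k" where
  "ad_star br x \<xi> = \<xi> \<circ> br x"

definition double_scale ::
  "('k::field \<Rightarrow> 'g \<Rightarrow> 'g) \<Rightarrow> 'k \<Rightarrow> 'g \<times> ('g \<Rightarrow> 'k) \<Rightarrow> 'g \<times> ('g \<Rightarrow> 'k)" where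
  "double_scale sc c = map_prod (sc c) (fun_scale (*) c)"

definition double_bracket ::
  "('g::ab_group_add \<Rightarrow> 'g \<Rightarrow> 'g) \<Rightarrow> ('g \<Rightarrow> ('g \<Rightarrow> 'k::field) \<Rightarrow> 'g) \<Rightarrow>
   (('g \<Rightarrow> 'k) \<Rightarrow> ('g \<Rightarrow> 'k) \<Rightarrow> 'g) \<Rightarrow>
   'g \<times> ('g \<Rightarrow> 'k) \<Rightarrow> 'g \<times> ('g \<Rightarrow> 'k) \<Rightarrow> 'g \<times> ('g \<Rightarrow> 'k)" where
  "double_bracket br \<omega> \<phi> = (\<lambda>(x, \<xi>) (y, \<eta>).
     (br x y + \<omega> x \<eta> - \<omega> y \<xi> + \<phi> \<xi> \<eta>,
      ad_star br y \<xi> - ad_star br x \<eta> + (\<lambda>z. \<eta> (\<omega> z \<xi>))))"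

definition lie_quasi_bialgebra ::
  "('k::field \<Rightarrow> 'g::ab_group_add \<Rightarrow> 'g) \<Rightarrow> ('g \<Rightarrow> 'g \<Rightarrow> 'g) \<Rightarrow> ('g \<Rightarrow> ('g \<Rightarrow> 'k) \<Rightarrow> 'g) \<Rightarrow>
   (('g \<Rightarrow> 'k) \<Rightarrow> ('g \<Rightarrow> 'k) \<Rightarrow> 'g) \<Rightarrow> bool" where
  "lie_quasi_bialgebra sc br \<omega> \<phi> \<longleftrightarrow>
     (\<exists>Basis. finite_dimensional_vector_space sc Basis) \<and>
     lie_algebra_on sc UNIV br \<and>
     (\<forall>x. \<omega> x \<in> skew_maps sc) \<and>
     linear_on UNIV sc (fun_scale sc) \<omega> \<and>
     (\<forall>x y. \<forall>\<xi>\<in>dual sc.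
        \<omega> (br x y) \<xi> = br x (\<omega> y \<xi>) + \<omega> y (ad_star br x \<xi>) - br y (\<omega> x \<xi>) - \<omega> x (ad_star br y \<xi>)) \<and>
     trivector sc \<phi> \<and>
     lie_algebra_on (double_scale sc) (UNIV \<times> dual sc) (double_bracket br \<omega> \<phi>)"

text \<open>The trilinear form \<open>(\<xi>, \<eta>, \<zeta>) \<mapsto> \<langle>\<xi> \<otimes> \<eta> \<otimes> \<zeta>, \<phi>\<^sup>t\<rangle>\<close>.\<close>

definition twist_form ::
  "('g::ab_group_add \<Rightarrow> 'g \<Rightarrow> 'g) \<Rightarrow> ('g \<Rightarrow> ('g \<Rightarrow> 'k::field) \<Rightarrow> 'g) \<Rightarrow>
   (('g \<Rightarrow> 'k) \<Rightarrow> ('g \<Rightarrow> 'k) \<Rightarrow> 'g) \<Rightarrow> (('g \<Rightarrow> 'k) \<Rightarrow> 'g) \<Rightarrow>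
   ('g \<Rightarrow> 'k) \<Rightarrow> ('g \<Rightarrow> 'k) \<Rightarrow> ('g \<Rightarrow> 'k) \<Rightarrow> 'k" where
  "twist_form br \<omega> \<phi> t \<xi> \<eta> \<zeta> =
     \<zeta> (\<phi> \<xi> \<eta>) + cyc (\<lambda>\<xi> \<eta> \<zeta>. \<zeta> (br (t \<xi>) (t \<eta>) + \<omega> (t \<xi>) \<eta>)) \<xi> \<eta> \<zeta>"

definition reductive_decomposition ::
  "('k::field \<Rightarrow> 'g::ab_group_add \<Rightarrow> 'g) \<Rightarrow> ('g \<Rightarrow> 'g \<Rightarrow> 'g) \<Rightarrow> 'g set \<Rightarrow> 'g set \<Rightarrow> bool" where
  "reductive_decomposition sc br \<ll> \<mm> \<longleftrightarrow>
     module.subspace sc \<ll> \<and> module.subspace sc \<mm> \<and>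
     \<ll> \<inter> \<mm> = {0} \<and> (\<forall>x. \<exists>a\<in>\<ll>. \<exists>b\<in>\<mm>. x = a + b) \<and>
     (\<forall>x\<in>\<ll>. \<forall>y\<in>\<ll>. br x y \<in> \<ll>) \<and> (\<forall>x\<in>\<ll>. \<forall>y\<in>\<mm>. br x y \<in> \<mm>)"

definition maps_into_wedge2 ::
  "('k::field \<Rightarrow> 'g::ab_group_add \<Rightarrow> 'g) \<Rightarrow> 'g set \<Rightarrow> 'g set \<Rightarrow> (('g \<Rightarrow> 'k) \<Rightarrow> 'g) \<Rightarrow> bool" where
  "maps_into_wedge2 sc \<ll> \<mm> t \<longleftrightarrow>
     (\<forall>\<xi>\<in>annihilator sc \<mm>. t \<xi> = 0) \<and> (\<forall>\<xi>\<in>annihilator sc \<ll>. t \<xi> \<in> \<mm>)"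

definition invariant_wedge2 ::
  "('k::field \<Rightarrow> 'g::ab_group_add \<Rightarrow> 'g) \<Rightarrow> ('g \<Rightarrow> 'g \<Rightarrow> 'g) \<Rightarrow> 'g set \<Rightarrow> 'g set \<Rightarrow>
   (('g \<Rightarrow> 'k) \<Rightarrow> 'g) set" where
  "invariant_wedge2 sc br \<ll> \<mm> =
     {t \<in> skew_maps sc. maps_into_wedge2 sc \<ll> \<mm> t \<and>
        (\<forall>z\<in>\<ll>. \<forall>\<xi>\<in>dual sc. br z (t \<xi>) + t (ad_star br z \<xi>) = 0)}"

text \<open>The set \<open>\<M>\<^bsub>\<G>,\<ll>,\<mm>\<^esub>\<close>.\<close>

definition reduced_moduli ::
  "('k::field \<Rightarrow> 'g::ab_group_add \<Rightarrow> 'g) \<Rightarrow> ('g \<Rightarrow> 'g \<Rightarrow> 'g) \<Rightarrow> ('g \<Rightarrow> ('g \<Rightarrow> 'k) \<Rightarrow> 'g) \<Rightarrow>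
   (('g \<Rightarrow> 'k) \<Rightarrow> ('g \<Rightarrow> 'k) \<Rightarrow> 'g) \<Rightarrow> 'g set \<Rightarrow> 'g set \<Rightarrow> (('g \<Rightarrow> 'k) \<Rightarrow> 'g) set" where
  "reduced_moduli sc br \<omega> \<phi> \<ll> \<mm> =
     {t \<in> invariant_wedge2 sc br \<ll> \<mm>.
        \<forall>\<xi>\<in>annihilator sc \<ll>. \<forall>\<eta>\<in>annihilator sc \<ll>. \<forall>\<zeta>\<in>annihilator sc \<ll>.
          twist_form br \<omega> \<phi> t \<xi> \<eta> \<zeta> = 0}"


section \<open>Formal maps on the formal neighbourhood of 0 in the dual of a subalgebra\<close>

text \<open>
  Let \<open>B\<close> be a basis of \<open>\<ll>\<close>. Its elements are linear coordinates \<open>p \<mapsto> p(b)\<close> on \<open>\<ll>\<^sup>*\<close>. A formal map from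
  the formal neighbourhood of \<open>0\<close> in \<open>\<ll>\<^sup>*\<close> is a formal power series in these coordinates: a function
  \<open>f\<close> on multisets, where \<open>f \<alpha>\<close> is the coefficient of the monomial \<open>\<Prod>b\<in>#\<alpha>. p(b)\<close> and
  only multisets over \<open>B\<close> occur. The value at \<open>p = 0\<close> is \<open>f {#}\<close>.
\<close>

type_synonym ('g, 'v) formal = "'g multiset \<Rightarrow> 'v"

definition formal_maps :: "'g set \<Rightarrow> 'v::zero set \<Rightarrow> ('g, 'v) formal set" where
  "formal_maps B V = {f. (\<forall>\<alpha>. f \<alpha> \<in> V) \<and> (\<forall>\<alpha>. \<not> set_mset \<alpha> \<subseteq> B \<longrightarrow> f \<alpha> = 0)}"

definition fconst :: "'v::zero \<Rightarrow> ('g, 'v) formal" where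
  "fconst v = (\<lambda>\<alpha>. if \<alpha> = {#} then v else 0)"

text \<open>Pointwise product of formal maps along a bilinear map (Cauchy product).\<close>

definition fprod ::
  "('u \<Rightarrow> 'v \<Rightarrow> 'w::comm_monoid_add) \<Rightarrow> ('g, 'u) formal \<Rightarrow> ('g, 'v) formal \<Rightarrow> ('g, 'w) formal" where
  "fprod bil f h = (\<lambda>\<alpha>. \<Sum>\<beta> | \<beta> \<subseteq># \<alpha>. bil (f \<beta>) (h (\<alpha> - \<beta>)))"

text \<open>For \<open>v \<in> \<ll>\<close>, the formal function \<open>p \<mapsto> p(v)\<close>.\<close>

definition feval ::
  "('k::field \<Rightarrow> 'g::ab_group_add \<Rightarrow> 'g) \<Rightarrow> 'g set \<Rightarrow> 'g \<Rightarrow> ('g, 'k) formal" where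
  "feval sc B v = (\<lambda>\<alpha>. \<Sum>b\<in>B. if \<alpha> = {#b#} then module.representation sc B v b else 0)"

definition fpartial ::
  "('k::field \<Rightarrow> 'g \<Rightarrow> 'g) \<Rightarrow> 'g \<Rightarrow> ('g, 'g) formal \<Rightarrow> ('g, 'g) formal" where
  "fpartial sc b f = (\<lambda>\<alpha>. sc (of_nat (Suc (count \<alpha> b))) (f (add_mset b \<alpha>)))"

text \<open>
  A formal map \<open>X\<close> with values in \<open>\<ll>\<^sup>*\<close> is given by its coordinates \<open>X b = (p \<mapsto> X\<^sub>p(b))\<close> for
  \<open>b \<in> B\<close>; the following is \<open>p \<mapsto> d\<^sub>pf(X\<^sub>p)\<close>.
\<close>

definition fdiff ::
  "('k::field \<Rightarrow> 'g::ab_group_add \<Rightarrow> 'g) \<Rightarrow> 'g set \<Rightarrow> ('g, 'g) formal \<Rightarrow>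
   ('g \<Rightarrow> ('g, 'k) formal) \<Rightarrow> ('g, 'g) formal" where
  "fdiff sc B f X = (\<lambda>\<alpha>. \<Sum>b\<in>B. fprod sc (X b) (fpartial sc b f) \<alpha>)"

text \<open>The constant formal map \<open>i\<^sup>*\<xi>\<close> and the linear one \<open>p \<mapsto> ad\<^sup>*\<^sub>zp\<close>, for \<open>z \<in> \<ll>\<close>.\<close>

definition istar_field :: "('g \<Rightarrow> 'k::zero) \<Rightarrow> 'g \<Rightarrow> ('g, 'k) formal" where
  "istar_field \<xi> = (\<lambda>b. fconst (\<xi> b))"

definition coad_field ::
  "('k::field \<Rightarrow> 'g::ab_group_add \<Rightarrow> 'g) \<Rightarrow> ('g \<Rightarrow> 'g \<Rightarrow> 'g) \<Rightarrow> 'g set \<Rightarrow> 'g \<Rightarrow>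
   'g \<Rightarrow> ('g, 'k) formal" where
  "coad_field sc br B z = (\<lambda>b. feval sc B (br z b))"


section \<open>Formal dynamical l-matrices\<close>

definition Dynl ::
  "('k::field \<Rightarrow> 'g::ab_group_add \<Rightarrow> 'g) \<Rightarrow> ('g \<Rightarrow> 'g \<Rightarrow> 'g) \<Rightarrow> ('g \<Rightarrow> ('g \<Rightarrow> 'k) \<Rightarrow> 'g) \<Rightarrow>
   (('g \<Rightarrow> 'k) \<Rightarrow> ('g \<Rightarrow> 'k) \<Rightarrow> 'g) \<Rightarrow> 'g set \<Rightarrow> 'g set \<Rightarrow> ('g, ('g \<Rightarrow> 'k) \<Rightarrow> 'g) formal set" where
  "Dynl sc br \<omega> \<phi> \<ll> B =
     {l \<in> formal_maps B (skew_maps sc).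
        (\<forall>\<xi>\<in>dual sc. \<forall>\<eta>\<in>dual sc. \<forall>\<zeta>\<in>dual sc. \<forall>\<alpha>.
           cyc (\<lambda>\<xi> \<eta> \<zeta>. \<zeta> (fdiff sc B (\<lambda>\<beta>. l \<beta> \<eta>) (istar_field \<xi>) \<alpha>)
                        - \<zeta> (fprod br (\<lambda>\<beta>. l \<beta> \<xi>) (\<lambda>\<beta>. l \<beta> \<eta>) \<alpha>)
                        - \<zeta> (\<omega> (l \<alpha> \<xi>) \<eta>)) \<xi> \<eta> \<zeta>
           = fconst (\<zeta> (\<phi> \<xi> \<eta>)) \<alpha>) \<and>
        (\<forall>z\<in>\<ll>. \<forall>\<xi>\<in>dual sc. \<forall>\<alpha>.
           fdiff sc B (\<lambda>\<beta>. l \<beta> \<xi>) (coad_field sc br B z) \<alpha> + fconst (\<omega> z \<xi>) \<alpha>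
             + br z (l \<alpha> \<xi>) + l \<alpha> (ad_star br z \<xi>) = 0)}"


section \<open>Gauge transformations\<close>

text \<open>
  A formal map \<open>\<sigma>\<close> into a Lie group with Lie algebra \<open>\<gg>\<close> and with \<open>\<sigma>\<^sub>0 = 1\<close> is represented by its
  logarithm: the unique formal map \<open>\<Sigma>\<close> into \<open>\<gg>\<close> with \<open>\<Sigma>\<^sub>0 = 0\<close> and \<open>\<sigma> = e\<^sup>\<Sigma>\<close>.
\<close>

definition gauge_group ::
  "('k::field \<Rightarrow> 'g::ab_group_add \<Rightarrow> 'g) \<Rightarrow> ('g \<Rightarrow> 'g \<Rightarrow> 'g) \<Rightarrow> 'g set \<Rightarrow> 'g set \<Rightarrow> ('g, 'g) formal set" where
  "gauge_group sc br \<ll> B =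
     {\<Sigma> \<in> formal_maps B UNIV. \<Sigma> {#} = 0 \<and>
        (\<forall>z\<in>\<ll>. \<forall>\<alpha>. fdiff sc B \<Sigma> (coad_field sc br B z) \<alpha> = - br z (\<Sigma> \<alpha>))}"

text \<open>
  The formal map \<open>\<Sum>n. c\<^sub>n (ad\<^sub>\<Sigma>)\<^sup>n v\<close>, for \<open>\<Sigma>\<^sub>0 = 0\<close>. Each application of \<open>ad\<^sub>\<Sigma>\<close> raises the order
  of vanishing at \<open>0\<close>, so the terms with \<open>n > size \<alpha>\<close> do not contribute to the coefficient at \<open>\<alpha>\<close>.
\<close>

definition ad_series ::
  "('k \<Rightarrow> 'g::ab_group_add \<Rightarrow> 'g) \<Rightarrow> ('g \<Rightarrow> 'g \<Rightarrow> 'g) \<Rightarrow> (nat \<Rightarrow> 'k) \<Rightarrow>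
   ('g, 'g) formal \<Rightarrow> ('g, 'g) formal \<Rightarrow> ('g, 'g) formal" where
  "ad_series sc br c \<Sigma> v = (\<lambda>\<alpha>. \<Sum>n\<le>size \<alpha>. sc (c n) ((fprod br \<Sigma> ^^ n) v \<alpha>))"

text \<open>\<open>Ad\<^sub>\<sigma> v\<close> for a formal map \<open>v\<close> into \<open>\<gg>\<close>, and \<open>Ad\<^sup>*\<^sub>\<sigma> \<xi>\<close> for a constant \<open>\<xi>\<close>.\<close>

definition Ad ::
  "('k::field_char_0 \<Rightarrow> 'g::ab_group_add \<Rightarrow> 'g) \<Rightarrow> ('g \<Rightarrow> 'g \<Rightarrow> 'g) \<Rightarrow>
   ('g, 'g) formal \<Rightarrow> ('g, 'g) formal \<Rightarrow> ('g, 'g) formal" where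
  "Ad sc br = ad_series sc br (\<lambda>n. 1 / fact n)"

definition Ad_star ::
  "('k::field_char_0 \<Rightarrow> 'g::ab_group_add \<Rightarrow> 'g) \<Rightarrow> ('g \<Rightarrow> 'g \<Rightarrow> 'g) \<Rightarrow>
   ('g, 'g) formal \<Rightarrow> ('g \<Rightarrow> 'k) \<Rightarrow> ('g, 'g \<Rightarrow> 'k) formal" where
  "Ad_star sc br \<Sigma> \<xi> = (\<lambda>\<alpha> x. \<xi> (Ad sc br \<Sigma> (fconst x) \<alpha>))"

text \<open>The value at \<open>\<xi>\<close> of \<open>Ad\<^sub>\<sigma> t Ad\<^sup>*\<^sub>\<sigma>\<close>, for a formal map \<open>t\<close> into \<open>\<A>(\<gg>\<^sup>*, \<gg>)\<close>.\<close>

definition Ad_conj ::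
  "('k::field_char_0 \<Rightarrow> 'g::ab_group_add \<Rightarrow> 'g) \<Rightarrow> ('g \<Rightarrow> 'g \<Rightarrow> 'g) \<Rightarrow>
   ('g, 'g) formal \<Rightarrow> ('g, ('g \<Rightarrow> 'k) \<Rightarrow> 'g) formal \<Rightarrow> ('g \<Rightarrow> 'k) \<Rightarrow> ('g, 'g) formal" where
  "Ad_conj sc br \<Sigma> t \<xi> = Ad sc br \<Sigma> (fprod (\<lambda>s \<eta>. s \<eta>) t (Ad_star sc br \<Sigma> \<xi>))"

text \<open>
  \<open>S w\<close> for a formal map \<open>w\<close> into \<open>\<ll>\<^sup>*\<close>, where \<open>S = ((e\<^sup>x - 1) / x)(ad\<^sub>\<Sigma>) \<circ> d\<Sigma>\<close>; and
  \<open>S\<^sup>*\<xi> = \<Sum>b\<in>B. \<langle>\<xi>, S b\<^sup>*\<rangle> b\<close>, where the \<open>b\<^sup>*\<close> form the basis of \<open>\<ll>\<^sup>*\<close> dual to \<open>B\<close>.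
\<close>

definition S_map ::
  "('k::field_char_0 \<Rightarrow> 'g::ab_group_add \<Rightarrow> 'g) \<Rightarrow> ('g \<Rightarrow> 'g \<Rightarrow> 'g) \<Rightarrow> 'g set \<Rightarrow>
   ('g, 'g) formal \<Rightarrow> ('g \<Rightarrow> ('g, 'k) formal) \<Rightarrow> ('g, 'g) formal" where
  "S_map sc br B \<Sigma> w = ad_series sc br (\<lambda>n. 1 / fact (Suc n)) \<Sigma> (fdiff sc B \<Sigma> w)"

definition S_star ::
  "('k::field_char_0 \<Rightarrow> 'g::ab_group_add \<Rightarrow> 'g) \<Rightarrow> ('g \<Rightarrow> 'g \<Rightarrow> 'g) \<Rightarrow> 'g set \<Rightarrow>
   ('g, 'g) formal \<Rightarrow> ('g \<Rightarrow> 'k) \<Rightarrow> ('g, 'g) formal" where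
  "S_star sc br B \<Sigma> \<xi> =
     (\<lambda>\<alpha>. \<Sum>b\<in>B. sc (\<xi> (S_map sc br B \<Sigma> (\<lambda>c. fconst (if c = b then 1 else 0)) \<alpha>)) b)"

definition theta ::
  "('k::field_char_0 \<Rightarrow> 'g::ab_group_add \<Rightarrow> 'g) \<Rightarrow> ('g \<Rightarrow> 'g \<Rightarrow> 'g) \<Rightarrow> 'g set \<Rightarrow>
   ('g, 'g) formal \<Rightarrow> ('g \<Rightarrow> 'k) \<Rightarrow> ('g, 'g) formal" where
  "theta sc br B \<Sigma> \<xi> =
     (\<lambda>\<alpha>. S_map sc br B \<Sigma> (\<lambda>b \<beta>. Ad_star sc br \<Sigma> \<xi> \<beta> b) \<alpha> - S_star sc br B \<Sigma> \<xi> \<alpha>)"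

text \<open>The integral over \<open>[0, 1]\<close> of a curve in \<open>\<gg>\<close>, characterised by its pairings with \<open>\<gg>\<^sup>*\<close>.\<close>

definition integral01 ::
  "('k::real_normed_field \<Rightarrow> 'g::ab_group_add \<Rightarrow> 'g) \<Rightarrow> (real \<Rightarrow> 'g) \<Rightarrow> 'g" where
  "integral01 sc f = (THE v. \<forall>\<zeta>\<in>dual sc. ((\<lambda>\<tau>. \<zeta> (f \<tau>)) has_integral \<zeta> v) {0..1})"

definition group_cocycle ::
  "('k::real_normed_field \<Rightarrow> 'g::ab_group_add \<Rightarrow> 'g) \<Rightarrow> ('g \<Rightarrow> 'g \<Rightarrow> 'g) \<Rightarrow>
   ('g \<Rightarrow> ('g \<Rightarrow> 'k) \<Rightarrow> 'g) \<Rightarrow> ('g, 'g) formal \<Rightarrow> ('g \<Rightarrow> 'k) \<Rightarrow> ('g, 'g) formal" where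
  "group_cocycle sc br \<omega> \<Sigma> \<xi> =
     (\<lambda>\<alpha>. integral01 sc (\<lambda>\<tau>. Ad_conj sc br (\<lambda>\<beta>. sc (of_real \<tau>) (\<Sigma> \<beta>)) (\<lambda>\<beta>. \<omega> (\<Sigma> \<beta>)) \<xi> \<alpha>))"

definition gauge_act ::
  "('k::real_normed_field \<Rightarrow> 'g::ab_group_add \<Rightarrow> 'g) \<Rightarrow> ('g \<Rightarrow> 'g \<Rightarrow> 'g) \<Rightarrow>
   ('g \<Rightarrow> ('g \<Rightarrow> 'k) \<Rightarrow> 'g) \<Rightarrow> 'g set \<Rightarrow> ('g, 'g) formal \<Rightarrow>
   ('g, ('g \<Rightarrow> 'k) \<Rightarrow> 'g) formal \<Rightarrow> ('g, ('g \<Rightarrow> 'k) \<Rightarrow> 'g) formal" where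
  "gauge_act sc br \<omega> B \<Sigma> l =
     (\<lambda>\<alpha> \<xi>. if \<xi> \<in> dual sc
            then Ad_conj sc br \<Sigma> l \<xi> \<alpha> + theta sc br B \<Sigma> \<xi> \<alpha> + group_cocycle sc br \<omega> \<Sigma> \<xi> \<alpha>
            else 0)"

definition moduli_space ::
  "('k::real_normed_field \<Rightarrow> 'g::ab_group_add \<Rightarrow> 'g) \<Rightarrow> ('g \<Rightarrow> 'g \<Rightarrow> 'g) \<Rightarrow>
   ('g \<Rightarrow> ('g \<Rightarrow> 'k) \<Rightarrow> 'g) \<Rightarrow> (('g \<Rightarrow> 'k) \<Rightarrow> ('g \<Rightarrow> 'k) \<Rightarrow> 'g) \<Rightarrow> 'g set \<Rightarrow> 'g set \<Rightarrow>
   ('g, ('g \<Rightarrow> 'k) \<Rightarrow> 'g) formal set set" where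
  "moduli_space sc br \<omega> \<phi> \<ll> B =
     (\<lambda>l. {gauge_act sc br \<omega> B \<Sigma> l | \<Sigma>. \<Sigma> \<in> gauge_group sc br \<ll> B}) ` Dynl sc br \<omega> \<phi> \<ll> B"

end

theory Submission
  imports Defs
begin

text \<open>
  At \<open>p = 0\<close> a gauge transformation \<open>\<sigma> = e\<^sup>\<Sigma>\<close> changes \<open>l\<close> by \<open>d\<Sigma> i\<^sup>* - i d\<Sigma>\<^sup>*\<close>, which has no component in
  \<open>\<wedge>\<^sup>2\<mm>\<close>; so the component \<open>t\<close> of \<open>l\<^sub>0\<close> in \<open>\<wedge>\<^sup>2\<mm>\<close> is a gauge invariant. Conversely, if \<open>l\<close> and \<open>l'\<close> have the same
  invariant and agree below degree \<open>n\<close>, then their difference in degree \<open>n\<close> is closed and \<open>\<ll>\<close>-invariant, and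
  a Poincare homotopy writes it as \<open>d\<Gamma> i\<^sup>* - i d\<Gamma>\<^sup>*\<close> with \<open>\<Gamma>\<close> homogeneous of degree \<open>n + 1\<close>. Adding these
  \<open>\<Gamma>\<close> to \<open>\<Sigma>\<close> degree by degree yields a single gauge transformation from \<open>l\<close> to \<open>l'\<close>. Hence orbits are the level
  sets of the invariant, and the group law of the gauge group (the Baker-Campbell-Hausdorff series)
  is never needed.

  The induction requires that gauge transformations preserve dynamical \<open>\<ell>\<close>-matrices. For equivariant \<open>\<Sigma>\<close>
  the action of \<open>e\<^sup>\<Sigma>\<close> is the time-one flow of the affine map
  \<open>l \<mapsto> ad\<^sub>\<Sigma> l + l ad\<^sup>*\<^sub>\<Sigma> + d\<Sigma> i\<^sup>* - i d\<Sigma>\<^sup>* + \<omega>\<^sub>\<Sigma>\<close>, and along this flow the defect of the dynamical equation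
  satisfies a homogeneous linear differential equation.
\<close>

section \<open>Cauchy products\<close>

text \<open>The action is recognised as a flow by merging its left and right factors. With
  \<open>L = Lop S\<close>, \<open>R = Rop S\<close> and \<open>T = L + R\<close>, conjugation is
  e^L e^R = e^T. In \<open>theta\<close> the two halves carry unequal factors, (e^L - 1)/L e^R on
  \<open>vop S\<close> and (e^R - 1)/R on \<open>qop S\<close>; they merge into (e^T - 1)/T only
  because equivariance gives R(vop) = - L(qop). Integrating \<tau>^n gives the cocycle the same
  factor. Hence \<sigma> acts by e^T l + (e^T - 1)/T u. Since \<Sigma> vanishes at 0, T raises the
  degree: all sums are finite, time is a formal variable, and the differential equation for the
  defect is a recursion on Taylor coefficients. Its homogeneity has three sources: the Jacobi
  identity of \<gg> for the quadratic part, the cocycle identity and skewness for the linear part,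
  and the Jacobi identity of the double for the constant part. Throughout, equivariance trades
  brackets with \<ll> for derivatives. The difference is closed because the equation in degree n - 1
  sees degree n only through derivatives. In degree 0 this says nothing, and there the invariant
  supplies the missing information.\<close>

definition conv :: "('a multiset \<Rightarrow> 'a multiset \<Rightarrow> 'w::comm_monoid_add) \<Rightarrow> 'a multiset \<Rightarrow> 'w" where
  "conv h \<alpha> = (\<Sum>\<mu> | \<mu> \<subseteq># \<alpha>. h \<mu> (\<alpha> - \<mu>))"

lemma finite_submultisets: "finite {\<mu>. \<mu> \<subseteq># (\<alpha>::'a multiset)}"
proof (induction \<alpha>)
  case (add x \<alpha>)
  have "{\<mu>. \<mu> \<subseteq># add_mset x \<alpha>} \<subseteq> {\<mu>. \<mu> \<subseteq># \<alpha>} \<union> add_mset x ` {\<mu>. \<mu> \<subseteq># \<alpha>}"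
  proof
    fix \<mu> assume "\<mu> \<in> {\<mu>. \<mu> \<subseteq># add_mset x \<alpha>}"
    then have b: "\<mu> \<subseteq># add_mset x \<alpha>" by simp
    show "\<mu> \<in> {\<mu>. \<mu> \<subseteq># \<alpha>} \<union> add_mset x ` {\<mu>. \<mu> \<subseteq># \<alpha>}"
    proof (cases "x \<in># \<mu>")
      case True
      then obtain \<nu> where "\<mu> = add_mset x \<nu>" by (metis insert_DiffM)
      with b show ?thesis by auto
    next
      case False
      with b have "\<mu> \<subseteq># \<alpha>" by (metis add_mset_remove_trivial diff_single_trivial subset_eq_diff_conv union_single_eq_diff add_mset_add_single)
      then show ?thesis by simp
    qed
  qed
  with add show ?case by (meson finite_UnI finite_imageI finite_subset)
qed simp

text \<open>Ordered splittings treat both halves alike and nest well, so commutativity and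
  associativity become reindexings of sums. The summand is an arbitrary function of the two halves,
  which covers brackets, evaluations and scalings at once.\<close>

lemma conv_pairs: "conv h \<alpha> = (\<Sum>(\<mu>, \<nu>) | \<mu> + \<nu> = \<alpha>. h \<mu> \<nu>)"
  unfolding conv_def
  by (rule sum.reindex_bij_witness[of _ fst "\<lambda>\<mu>. (\<mu>, \<alpha> - \<mu>)"]) auto

lemma finite_splits: "finite {(\<mu>, \<nu>). \<mu> + \<nu> = (\<alpha>::'a multiset)}"
proof -
  have "{(\<mu>, \<nu>). \<mu> + \<nu> = \<alpha>} = (\<lambda>\<mu>. (\<mu>, \<alpha> - \<mu>)) ` {\<mu>. \<mu> \<subseteq># \<alpha>}"
    by (auto simp: image_iff)
  then show ?thesis by (simp only:) (rule finite_imageI finite_submultisets)+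
qed

abbreviation convr :: "('a multiset \<Rightarrow> 'a multiset \<Rightarrow> 'a multiset \<Rightarrow> 'w::comm_monoid_add) \<Rightarrow> 'a multiset \<Rightarrow> 'w" where
  "convr h \<alpha> \<equiv> conv (\<lambda>\<mu> \<nu>. conv (h \<mu>) \<nu>) \<alpha>"

abbreviation convl :: "('a multiset \<Rightarrow> 'a multiset \<Rightarrow> 'a multiset \<Rightarrow> 'w::comm_monoid_add) \<Rightarrow> 'a multiset \<Rightarrow> 'w" where
  "convl h \<alpha> \<equiv> conv (\<lambda>\<mu> \<nu>. conv (\<lambda>\<rho> \<tau>. h \<rho> \<tau> \<nu>) \<mu>) \<alpha>"

text \<open>The product with the coordinate \<open>p \<mapsto> p(b)\<close>.\<close>

abbreviation cmul :: "'a \<Rightarrow> ('a multiset \<Rightarrow> 'w::comm_monoid_add) \<Rightarrow> 'a multiset \<Rightarrow> 'w" where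
  "cmul b h \<alpha> \<equiv> conv (\<lambda>\<mu> \<nu>. if \<mu> = {#b#} then h \<nu> else 0) \<alpha>"

lemma conv_cong:
  assumes "\<And>\<mu> \<nu>. \<mu> + \<nu> = \<alpha> \<Longrightarrow> h \<mu> \<nu> = h' \<mu> \<nu>"
  shows "conv h \<alpha> = conv h' \<alpha>"
  unfolding conv_pairs by (rule sum.cong) (auto simp: assms)

lemma conv_zero [simp]: "conv (\<lambda>\<mu> \<nu>. 0) \<alpha> = 0"
  by (simp add: conv_def)

lemma conv_eq_0: 
  assumes "\<And>\<mu> \<nu>. \<mu> + \<nu> = \<alpha> \<Longrightarrow> h \<mu> \<nu> = 0"
  shows "conv h \<alpha> = 0"
  using conv_cong[of \<alpha> h "\<lambda>\<mu> \<nu>. 0"] assms by simp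

lemma conv_add: "conv (\<lambda>\<mu> \<nu>. h \<mu> \<nu> + h' \<mu> \<nu>) \<alpha> = conv h \<alpha> + conv h' \<alpha>"
  by (simp add: conv_def sum.distrib)

lemma conv_minus: "conv (\<lambda>\<mu> \<nu>. - h \<mu> \<nu> :: 'w::ab_group_add) \<alpha> = - conv h \<alpha>"
  by (simp add: conv_def sum_negf)

lemma conv_diff: "conv (\<lambda>\<mu> \<nu>. h \<mu> \<nu> - h' \<mu> \<nu> :: 'w::ab_group_add) \<alpha> = conv h \<alpha> - conv h' \<alpha>"
  by (simp add: conv_def sum_subtractf)

lemma conv_sum: "conv (\<lambda>\<mu> \<nu>. \<Sum>i\<in>I. h i \<mu> \<nu>) \<alpha> = (\<Sum>i\<in>I. conv (h i) \<alpha>)"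
  unfolding conv_def by (rule sum.swap)

lemma sum_apply: "sum f A x = (\<Sum>a\<in>A. f a x)"
  by (induction A rule: infinite_finite_induct) auto

lemma conv_apply: "conv h \<alpha> x = conv (\<lambda>\<mu> \<nu>. h \<mu> \<nu> x) \<alpha>"
  by (simp add: conv_def sum_apply)

lemma sum_hom_on:
  assumes "f 0 = 0" "\<And>x y. x \<in> V \<Longrightarrow> y \<in> V \<Longrightarrow> f (x + y) = f x + f y"
    and "0 \<in> V" "\<And>x y. x \<in> V \<Longrightarrow> y \<in> V \<Longrightarrow> x + y \<in> V" "\<And>a. a \<in> A \<Longrightarrow> g a \<in> V"
  shows "f (sum g A) = (\<Sum>a\<in>A. f (g a))"
proof -
  have "sum g A \<in> V \<and> f (sum g A) = (\<Sum>a\<in>A. f (g a))"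
    using assms(5) by (induction A rule: infinite_finite_induct) (auto simp: assms(1-4))
  then show ?thesis ..
qed

lemma conv_hom_on:
  assumes "f 0 = 0" "\<And>x y. x \<in> V \<Longrightarrow> y \<in> V \<Longrightarrow> f (x + y) = f x + f y"
    and "0 \<in> V" "\<And>x y. x \<in> V \<Longrightarrow> y \<in> V \<Longrightarrow> x + y \<in> V" "\<And>\<mu> \<nu>. h \<mu> \<nu> \<in> V"
  shows "f (conv h \<alpha>) = conv (\<lambda>\<mu> \<nu>. f (h \<mu> \<nu>)) \<alpha>"
  unfolding conv_def by (rule sum_hom_on[where V = V]) (use assms in auto)

lemma conv_hom:
  assumes "f 0 = 0" "\<And>x y. f (x + y) = f x + f y"
  shows "f (conv h \<alpha>) = conv (\<lambda>\<mu> \<nu>. f (h \<mu> \<nu>)) \<alpha>"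
  by (rule conv_hom_on[where V = UNIV]) (simp_all add: assms)

lemma sum_in_closed:
  assumes "0 \<in> V" "\<And>x y. x \<in> V \<Longrightarrow> y \<in> V \<Longrightarrow> x + y \<in> V" "\<And>a. a \<in> A \<Longrightarrow> g a \<in> V"
  shows "sum g A \<in> V"
  using assms(3) by (induction A rule: infinite_finite_induct) (auto simp: assms(1,2))

lemma conv_in:
  assumes "0 \<in> V" "\<And>x y. x \<in> V \<Longrightarrow> y \<in> V \<Longrightarrow> x + y \<in> V" "\<And>\<mu> \<nu>. h \<mu> \<nu> \<in> V"
  shows "conv h \<alpha> \<in> V"
  unfolding conv_def by (rule sum_in_closed) (use assms in auto)

lemma conv_commute: "conv h \<alpha> = conv (\<lambda>\<mu> \<nu>. h \<nu> \<mu>) \<alpha>"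
  unfolding conv_pairs
  by (rule sum.reindex_bij_witness[of _ prod.swap prod.swap]) (auto simp: add.commute)

lemma conv_assoc:
  "convr h \<alpha> = convl h \<alpha>"
proof -
  have "convr h \<alpha>
      = (\<Sum>(p, q)\<in>Sigma {(\<mu>, \<nu>). \<mu> + \<nu> = \<alpha>} (\<lambda>p. {(\<rho>, \<tau>). \<rho> + \<tau> = snd p}). h (fst p) (fst q) (snd q))"
    unfolding conv_pairs
    by (subst sum.Sigma[symmetric]) (auto simp: finite_splits split_beta intro!: sum.cong)
  also have "\<dots> = (\<Sum>(p, q)\<in>Sigma {(\<mu>, \<nu>). \<mu> + \<nu> = \<alpha>} (\<lambda>p. {(\<rho>, \<tau>). \<rho> + \<tau> = fst p}). h (fst q) (snd q) (snd p))"
    by (rule sum.reindex_bij_witness[of _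
          "\<lambda>((\<mu>, \<nu>), (\<rho>, \<tau>)). ((\<rho>, \<tau> + \<nu>), (\<tau>, \<nu>))" "\<lambda>((\<mu>, \<nu>), (\<rho>, \<tau>)). ((\<mu> + \<rho>, \<tau>), (\<mu>, \<rho>))"])
      (auto simp: add.assoc)
  also have "\<dots> = convl h \<alpha>"
    unfolding conv_pairs
    by (subst sum.Sigma[symmetric]) (auto simp: finite_splits split_beta intro!: sum.cong)
  finally show ?thesis .
qed

lemma conv_left_commute:
  "convr h \<alpha> = convr (\<lambda>\<mu> \<rho> \<tau>. h \<rho> \<mu> \<tau>) \<alpha>"
  unfolding conv_assoc by (subst (2) conv_commute) simp

lemma conv_const_left: "conv (\<lambda>\<mu> \<nu>. if \<mu> = {#} then h \<nu> else 0) \<alpha> = h \<alpha>"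
proof -
  have "conv (\<lambda>\<mu> \<nu>. if \<mu> = {#} then h \<nu> else 0) \<alpha> = (\<Sum>\<mu> | \<mu> \<subseteq># \<alpha>. if \<mu> = {#} then h \<alpha> else 0)"
    unfolding conv_def by (rule sum.cong) auto
  also have "\<dots> = h \<alpha>" using finite_submultisets by (subst sum.delta) auto
  finally show ?thesis .
qed

lemma conv_const_right: "conv (\<lambda>\<mu> \<nu>. if \<nu> = {#} then h \<mu> else 0) \<alpha> = h \<alpha>"
  by (subst conv_commute) (rule conv_const_left)

lemma conv_empty [simp]: "conv h {#} = h {#} {#}"
  by (simp add: conv_def)

lemma conv_single:
  "cmul b h \<alpha> = (if b \<in># \<alpha> then h (\<alpha> - {#b#}) else 0)"
proof -
  have "cmul b h \<alpha> = (\<Sum>\<mu> | \<mu> \<subseteq># \<alpha>. if \<mu> = {#b#} then h (\<alpha> - {#b#}) else 0)"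
    unfolding conv_def by (rule sum.cong) auto
  also have "\<dots> = (if b \<in># \<alpha> then h (\<alpha> - {#b#}) else 0)"
    using finite_submultisets by (subst sum.delta) auto
  finally show ?thesis .
qed

text \<open>The assumption on \<open>H 0\<close> kills the splittings without \<open>b\<close> in
  the left half; the others are reindexed by taking out one \<open>b\<close>. Applied to each half
  in turn, this yields the Leibniz rule \<open>sc_Leibniz\<close>.\<close>

lemma conv_count_left:
  fixes h :: "'a multiset \<Rightarrow> 'a multiset \<Rightarrow> 'w::comm_monoid_add"
  assumes "\<And>\<mu> \<nu>. H 0 \<mu> \<nu> = 0"
  shows "conv (\<lambda>\<mu> \<nu>. H (count \<mu> b) \<mu> \<nu>) (add_mset b \<alpha>)
       = conv (\<lambda>\<mu> \<nu>. H (Suc (count \<mu> b)) (add_mset b \<mu>) \<nu>) \<alpha>"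
proof -
  have "conv (\<lambda>\<mu> \<nu>. H (count \<mu> b) \<mu> \<nu>) (add_mset b \<alpha>)
      = (\<Sum>(\<mu>, \<nu>) | \<mu> + \<nu> = add_mset b \<alpha> \<and> b \<in># \<mu>. H (count \<mu> b) \<mu> \<nu>)"
    unfolding conv_pairs
    by (rule sum.mono_neutral_right)
      (auto simp: finite_splits assms intro: ccontr simp flip: count_greater_zero_iff)
  also have "\<dots> = conv (\<lambda>\<mu> \<nu>. H (Suc (count \<mu> b)) (add_mset b \<mu>) \<nu>) \<alpha>"
    unfolding conv_pairs
    by (rule sum.reindex_bij_witness[of _ "\<lambda>(\<mu>, \<nu>). (add_mset b \<mu>, \<nu>)" "\<lambda>(\<mu>, \<nu>). (\<mu> - {#b#}, \<nu>)"])
      (auto simp: multi_member_split simp flip: union_mset_add_mset_left)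
  finally show ?thesis .
qed

section \<open>Lie quasi-bialgebras with a reductive decomposition\<close>

type_synonym ('g, 'k) hom_formal = "('g, ('g \<Rightarrow> 'k) \<Rightarrow> 'g) formal"

type_synonym ('g, 'k) trilinear = "('g \<Rightarrow> 'k) \<Rightarrow> ('g \<Rightarrow> 'k) \<Rightarrow> ('g \<Rightarrow> 'k) \<Rightarrow> 'k"

locale reductive_lqb = vector_space sc
  for sc :: "'k::real_normed_field \<Rightarrow> 'g::ab_group_add \<Rightarrow> 'g" +
  fixes br :: "'g \<Rightarrow> 'g \<Rightarrow> 'g"
    and \<omega> :: "'g \<Rightarrow> ('g \<Rightarrow> 'k) \<Rightarrow> 'g"
    and \<phi> :: "('g \<Rightarrow> 'k) \<Rightarrow> ('g \<Rightarrow> 'k) \<Rightarrow> 'g"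
    and \<ll> \<mm> B :: "'g set"
  assumes lqb: "lie_quasi_bialgebra sc br \<omega> \<phi>"
    and red: "reductive_decomposition sc br \<ll> \<mm>"
    and \<omega>_\<ll>: "\<And>z. z \<in> \<ll> \<Longrightarrow> \<omega> z = 0"
    and indep: "\<not> dependent B" and span_B: "span B = \<ll>"
begin

abbreviation D :: "('g \<Rightarrow> 'k) set" where "D \<equiv> dual sc"
abbreviation coord :: "'g \<Rightarrow> ('g, 'k) formal" where "coord \<equiv> feval sc B"
abbreviation pd :: "'g \<Rightarrow> ('g, 'g) formal \<Rightarrow> ('g, 'g) formal" where "pd \<equiv> fpartial sc"
abbreviation SK :: "(('g \<Rightarrow> 'k) \<Rightarrow> 'g) set" where "SK \<equiv> skew_maps sc"
abbreviation fs :: "'k \<Rightarrow> ('g \<Rightarrow> 'k) \<Rightarrow> 'g \<Rightarrow> 'k" where "fs \<equiv> fun_scale (*)"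

lemma lie: "lie_algebra_on sc UNIV br"
  using lqb by (simp add: lie_quasi_bialgebra_def)

lemma br_add_right: "br x (y + z) = br x y + br x z"
  and br_scale_right: "br x (sc c y) = sc c (br x y)"
  and br_add_left: "br (x + y) z = br x z + br y z"
  and br_scale_left: "br (sc c x) z = sc c (br x z)"
  and br_self [simp]: "br x x = 0"
  and jacobi: "br x (br y z) + br y (br z x) + br z (br x y) = 0"
  using lie by (auto simp: lie_algebra_on_def linear_on_def)

sublocale br_right: Modules.additive "br x" for x
  by unfold_locales (rule br_add_right)

sublocale br_left: Modules.additive "\<lambda>x. br x y" for y
  by unfold_locales (rule br_add_left)

lemma br_anti: "br x y = - br y x"
proof -
  have "br (x + y) (x + y) = 0" by simp
  then show ?thesis unfolding br_add_left br_add_right by (simp add: eq_neg_iff_add_eq_0 add.commute)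
qed

lemma jacobi': "br (br x y) z = br x (br y z) - br y (br x z)"
  using jacobi[of x y z] br_anti[of z "br x y"] br_anti[of z x]
  by (simp add: br_right.minus algebra_simps)

lemma dual_iff: "\<xi> \<in> D \<longleftrightarrow> (\<forall>x y. \<xi> (x + y) = \<xi> x + \<xi> y) \<and> (\<forall>c x. \<xi> (sc c x) = c * \<xi> x)"
proof -
  have "vector_space ((*) :: 'k \<Rightarrow> _)" by unfold_locales (auto simp: algebra_simps)
  then show ?thesis
    using vector_space_axioms by (auto simp: dual_def Vector_Spaces.linear_iff)
qed

lemma dual_add: "\<xi> \<in> D \<Longrightarrow> \<xi> (x + y) = \<xi> x + \<xi> y"
  and dual_scale: "\<xi> \<in> D \<Longrightarrow> \<xi> (sc c x) = c * \<xi> x"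
  by (auto simp: dual_iff)

lemma dual_additive: "\<xi> \<in> D \<Longrightarrow> Modules.additive \<xi>"
  by (simp add: Modules.additive_def dual_add)

lemma dual_zero: "\<xi> \<in> D \<Longrightarrow> \<xi> 0 = 0"
  and dual_minus: "\<xi> \<in> D \<Longrightarrow> \<xi> (- x) = - \<xi> x"
  and dual_diff: "\<xi> \<in> D \<Longrightarrow> \<xi> (x - y) = \<xi> x - \<xi> y"
  and dual_sum: "\<xi> \<in> D \<Longrightarrow> \<xi> (sum f A) = (\<Sum>a\<in>A. \<xi> (f a))"
  using additive.zero additive.minus additive.diff additive.sum dual_additive by fastforce+

lemmas dual_simps = dual_add dual_scale dual_zero dual_minus dual_diff dual_sum

lemma dual_conv: "\<xi> \<in> D \<Longrightarrow> \<xi> (conv h \<alpha>) = conv (\<lambda>\<mu> \<nu>. \<xi> (h \<mu> \<nu>)) \<alpha>"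
  by (rule conv_hom) (simp_all add: dual_simps)

lemma zero_dual [simp]: "0 \<in> D" "(\<lambda>x. 0) \<in> D"
  by (simp_all add: dual_iff)

lemma dual_closed [intro]:
  assumes "\<xi> \<in> D" 
  shows "\<xi> \<circ> br x \<in> D" "fs c \<xi> \<in> D" "- \<xi> \<in> D"
  using assms by (auto simp: dual_iff fun_scale_def br_add_right br_scale_right algebra_simps)

lemma dual_add_closed [intro]: "\<xi> \<in> D \<Longrightarrow> \<eta> \<in> D \<Longrightarrow> \<xi> + \<eta> \<in> D"
  by (auto simp: dual_iff algebra_simps)

lemma dual_sum_closed [intro]: "(\<And>i. i \<in> I \<Longrightarrow> f i \<in> D) \<Longrightarrow> sum f I \<in> D"
  by (rule sum_in_closed) auto

lemma dual_conv_closed [intro]: "(\<And>\<mu> \<nu>. h \<mu> \<nu> \<in> D) \<Longrightarrow> conv h \<alpha> \<in> D"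
  by (rule conv_in) auto

lemma comp_br_add: "\<xi> \<in> D \<Longrightarrow> \<xi> \<circ> br (x + y) = (\<xi> \<circ> br x) + (\<xi> \<circ> br y)"
  and comp_br_scale: "\<xi> \<in> D \<Longrightarrow> \<xi> \<circ> br (sc c x) = fs c (\<xi> \<circ> br x)"
  and comp_br_zero: "\<xi> \<in> D \<Longrightarrow> \<xi> \<circ> br 0 = 0"
  and comp_br_minus: "\<xi> \<in> D \<Longrightarrow> \<xi> \<circ> br (- x) = - (\<xi> \<circ> br x)"
  by (auto simp: fun_eq_iff dual_simps br_add_left br_scale_left br_left.zero br_left.minus fun_scale_def)

lemma comp_br_br: "\<xi> \<in> D \<Longrightarrow> \<xi> \<circ> br (br x y) = (\<xi> \<circ> br x \<circ> br y) - (\<xi> \<circ> br y \<circ> br x)"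
  by (auto simp: fun_eq_iff jacobi' dual_simps)

lemma add_comp: "((\<xi> :: 'g \<Rightarrow> 'k) + \<eta>) \<circ> f = (\<xi> \<circ> f) + (\<eta> \<circ> f)"
  and fs_comp: "fs c \<xi> \<circ> f = fs c (\<xi> \<circ> f)"
  and zero_comp [simp]: "(0 :: 'g \<Rightarrow> 'k) \<circ> f = 0"
  by (auto simp: fun_eq_iff fun_scale_def)

lemma skew_add: "t \<in> SK \<Longrightarrow> \<xi> \<in> D \<Longrightarrow> \<eta> \<in> D \<Longrightarrow> t (\<xi> + \<eta>) = t \<xi> + t \<eta>"
  and skew_scale: "t \<in> SK \<Longrightarrow> \<xi> \<in> D \<Longrightarrow> t (fs c \<xi>) = sc c (t \<xi>)"
  and skew_off: "t \<in> SK \<Longrightarrow> \<xi> \<notin> D \<Longrightarrow> t \<xi> = 0"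
  and skew_skew: "t \<in> SK \<Longrightarrow> \<xi> \<in> D \<Longrightarrow> \<eta> \<in> D \<Longrightarrow> \<xi> (t \<eta>) = - \<eta> (t \<xi>)"
  by (auto simp: skew_maps_def linear_on_def)

lemma skewI:
  assumes "\<And>\<xi> \<eta>. \<xi> \<in> D \<Longrightarrow> \<eta> \<in> D \<Longrightarrow> t (\<xi> + \<eta>) = t \<xi> + t \<eta>"
    and "\<And>c \<xi>. \<xi> \<in> D \<Longrightarrow> t (fs c \<xi>) = sc c (t \<xi>)"
    and "\<And>\<xi> \<eta>. \<xi> \<in> D \<Longrightarrow> \<eta> \<in> D \<Longrightarrow> \<xi> (t \<eta>) = - \<eta> (t \<xi>)"
    and "\<And>\<xi>. \<xi> \<notin> D \<Longrightarrow> t \<xi> = 0"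
  shows "t \<in> SK"
  using assms by (auto simp: skew_maps_def linear_on_def)

lemma skew_zero: "t \<in> SK \<Longrightarrow> t 0 = 0"
  using skew_add[of t 0 0] by simp

lemma skew_sum: "t \<in> SK \<Longrightarrow> (\<And>i. i \<in> I \<Longrightarrow> f i \<in> D) \<Longrightarrow> t (sum f I) = (\<Sum>i\<in>I. t (f i))"
  by (rule sum_hom_on[where V = D and f = t]) (auto simp: skew_zero skew_add)

lemma zero_skew [simp]: "0 \<in> SK" "(\<lambda>\<xi>. 0) \<in> SK"
  by (auto intro!: skewI simp: dual_zero)

lemma skew_add_closed:
  assumes "t \<in> SK" "s \<in> SK"
  shows "t + s \<in> SK"
proof (rule skewI)
  show "\<xi> ((t + s) \<eta>) = - \<eta> ((t + s) \<xi>)" if "\<xi> \<in> D" "\<eta> \<in> D" for \<xi> \<eta>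
    using skew_skew[OF assms(1) that] skew_skew[OF assms(2) that] that by (simp add: dual_simps)
qed (use assms in \<open>simp_all add: skew_add skew_scale scale_right_distrib skew_off\<close>)

lemma skew_scale_closed:
  assumes "t \<in> SK"
  shows "fun_scale sc c t \<in> SK"
proof (rule skewI)
  show "\<xi> (fun_scale sc c t \<eta>) = - \<eta> (fun_scale sc c t \<xi>)" if "\<xi> \<in> D" "\<eta> \<in> D" for \<xi> \<eta>
    using skew_skew[OF assms that] that by (simp add: dual_simps fun_scale_def)
qed (use assms in \<open>simp_all add: fun_scale_def[of sc] skew_add skew_scale scale_right_distrib skew_off mult.commute\<close>)

lemma skew_sum_closed: "(\<And>i. i \<in> I \<Longrightarrow> f i \<in> SK) \<Longrightarrow> sum f I \<in> SK"
  by (rule sum_in_closed) (auto intro: skew_add_closed)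

lemma skew_conv_closed: "(\<And>\<mu> \<nu>. h \<mu> \<nu> \<in> SK) \<Longrightarrow> conv h \<alpha> \<in> SK"
  by (rule conv_in) (auto intro: skew_add_closed)

text \<open>The coordinate functionals of a basis separate points. This allows identities in \<gg>
  to be tested by pairing, and it makes the weakly defined integral unique.\<close>

lemma dual_separates:
  assumes "\<And>\<zeta>. \<zeta> \<in> D \<Longrightarrow> \<zeta> x = \<zeta> y"
  shows "x = y"
proof -
  define Bs where "Bs = extend_basis {}"
  have Bs: "independent Bs" "span Bs = UNIV"
    unfolding Bs_def by (rule independent_extend_basis span_extend_basis independent_empty)+
  have rep: "representation Bs x = representation Bs y"
    by (intro ext assms[of "\<lambda>v. representation Bs v b" for b]) (simp add: dual_def linear_representation[OF Bs])
  have "v = (\<Sum>b | representation Bs v b \<noteq> 0. sc (representation Bs v b) b)" for v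
    using sum_nonzero_representation_eq[of Bs v] Bs by simp
  from trans[OF this[of x, unfolded rep] this[of y, symmetric]] show ?thesis .
qed

lemma \<omega>_skew: "\<omega> x \<in> SK"
  and \<omega>_add: "\<omega> (x + y) \<xi> = \<omega> x \<xi> + \<omega> y \<xi>"
  and \<omega>_scale: "\<omega> (sc c x) \<xi> = sc c (\<omega> x \<xi>)"
  using lqb by (auto simp: lie_quasi_bialgebra_def linear_on_def fun_scale_def fun_eq_iff)

lemma \<omega>_cocycle: "\<xi> \<in> D \<Longrightarrow>
    \<omega> (br x y) \<xi> = br x (\<omega> y \<xi>) + \<omega> y (\<xi> \<circ> br x) - br y (\<omega> x \<xi>) - \<omega> x (\<xi> \<circ> br y)"
  using lqb by (auto simp: lie_quasi_bialgebra_def ad_star_def)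

lemma \<omega>_zero: "\<omega> 0 \<xi> = 0"
  using \<omega>_scale[of 0 0] by simp

lemma \<omega>_minus: "\<omega> (- x) \<xi> = - \<omega> x \<xi>"
  using \<omega>_add[of x "- x"] \<omega>_zero by (simp add: add_eq_0_iff)

lemma \<omega>_diff: "\<omega> (x - y) \<xi> = \<omega> x \<xi> - \<omega> y \<xi>"
  using \<omega>_add[of x "- y"] \<omega>_minus by simp

lemma \<omega>_sum: "\<omega> (sum f A) \<xi> = (\<Sum>a\<in>A. \<omega> (f a) \<xi>)"
  by (rule sum_hom_on[where V = UNIV]) (auto simp: \<omega>_add \<omega>_zero)

lemma \<omega>_conv: "\<omega> (conv h \<alpha>) \<xi> = conv (\<lambda>\<mu> \<nu>. \<omega> (h \<mu> \<nu>) \<xi>) \<alpha>"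
  by (rule conv_hom) (auto simp: \<omega>_add \<omega>_zero)

text \<open>The component in \<open>\<gg>\<close> of the Jacobi identity of the double at \<open>(x, \<xi>, \<eta>)\<close>.\<close>

lemma \<phi>_ad:
  assumes "\<xi> \<in> D" "\<eta> \<in> D" "\<zeta> \<in> D"
  shows "cyc (\<lambda>\<xi> \<eta> \<zeta>. \<zeta> (\<omega> (\<omega> x \<xi>) \<eta>)) \<xi> \<eta> \<zeta>
       = \<zeta> (\<phi> (\<xi> \<circ> br x) \<eta>) + \<zeta> (\<phi> \<xi> (\<eta> \<circ> br x)) + (\<zeta> \<circ> br x) (\<phi> \<xi> \<eta>)"
proof -
  have tri: "trivector sc \<phi>"
    using lqb by (simp add: lie_quasi_bialgebra_def)
  have lied: "lie_algebra_on (double_scale sc) (UNIV \<times> D) (double_bracket br \<omega> \<phi>)"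
    using lqb by (simp add: lie_quasi_bialgebra_def)
  have j: "double_bracket br \<omega> \<phi> X (double_bracket br \<omega> \<phi> Y Z)
      + double_bracket br \<omega> \<phi> Y (double_bracket br \<omega> \<phi> Z X)
      + double_bracket br \<omega> \<phi> Z (double_bracket br \<omega> \<phi> X Y) = 0"
    if "X \<in> UNIV \<times> D" "Y \<in> UNIV \<times> D" "Z \<in> UNIV \<times> D" for X Y Z
    using lied that unfolding lie_algebra_on_def by blast
  have \<theta>: "(\<lambda>z. \<eta> (\<omega> z \<xi>)) \<in> D" 
    unfolding dual_iff using assms by (simp add: \<omega>_add \<omega>_scale dual_add dual_scale)
  have phi0: "\<phi> 0 \<kappa> = 0" "\<phi> \<kappa> 0 = 0" if "\<kappa> \<in> D" for \<kappa>
  proof -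
    have "\<phi> (0 + 0) \<kappa> = \<phi> 0 \<kappa> + \<phi> 0 \<kappa>" "\<phi> \<kappa> (0 + 0) = \<phi> \<kappa> 0 + \<phi> \<kappa> 0"
      using tri that zero_dual(1) unfolding trivector_def linear_on_def by blast+
    then show "\<phi> 0 \<kappa> = 0" "\<phi> \<kappa> 0 = 0" by simp_all
  qed
  have phim: "\<phi> \<kappa> (- \<psi>) = - \<phi> \<kappa> \<psi>" if "\<kappa> \<in> D" "\<psi> \<in> D" for \<kappa> \<psi>
  proof -
    have "\<phi> \<kappa> (\<psi> + - \<psi>) = \<phi> \<kappa> \<psi> + \<phi> \<kappa> (- \<psi>)"
      using tri that dual_closed(3) unfolding trivector_def linear_on_def by blast
    then show ?thesis using phi0 that by (simp add: add_eq_0_iff)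
  qed
  have phia: "\<zeta> (\<phi> \<kappa> \<psi>) = - \<zeta> (\<phi> \<psi> \<kappa>)" if "\<kappa> \<in> D" "\<psi> \<in> D" for \<kappa> \<psi>
    using tri that assms unfolding trivector_def by blast
  have j0: "br x (\<phi> \<xi> \<eta>) + \<omega> x (\<lambda>z. \<eta> (\<omega> z \<xi>)) + (\<omega> (\<omega> x \<eta>) \<xi> + \<phi> \<xi> (\<eta> \<circ> br x))
      + (- \<omega> (\<omega> x \<xi>) \<eta> + \<phi> \<eta> (- (\<xi> \<circ> br x))) = 0"
    using arg_cong[OF j[of "(x, 0)" "(0, \<xi>)" "(0, \<eta>)"], of fst] assms \<theta> phi0 dual_closed
    by (simp add: double_bracket_def ad_star_def \<omega>_zero skew_zero \<omega>_skew br_right.zero br_left.zero \<omega>_minus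
        comp_br_zero dual_zero add_ac zero_fun_def[symmetric])
  have "\<zeta> (br x (\<phi> \<xi> \<eta>)) + \<zeta> (\<omega> x (\<lambda>z. \<eta> (\<omega> z \<xi>))) + (\<zeta> (\<omega> (\<omega> x \<eta>) \<xi>) + \<zeta> (\<phi> \<xi> (\<eta> \<circ> br x)))
      + (- \<zeta> (\<omega> (\<omega> x \<xi>) \<eta>) + \<zeta> (\<phi> (\<xi> \<circ> br x) \<eta>)) = 0"
    using arg_cong[OF j0, of \<zeta>] assms phim[OF assms(2) dual_closed(1)[OF assms(1)]]
      phia[OF assms(2) dual_closed(1)[OF assms(1)]]
    by (simp add: dual_simps)
  \<comment> \<open>Skewness of the values of \<open>\<omega>\<close> moves \<open>\<zeta>\<close>
    inside; together with the next equation this turns the three iterated \<open>\<omega>\<close>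
    terms into minus the cyclic sum.\<close>
  moreover have "\<zeta> (\<omega> x (\<lambda>z. \<eta> (\<omega> z \<xi>))) = - \<eta> (\<omega> (\<omega> x \<zeta>) \<xi>)"
    using skew_skew[OF \<omega>_skew assms(3) \<theta>] by simp
  moreover have "\<zeta> (\<omega> (\<omega> x \<eta>) \<xi>) = - \<xi> (\<omega> (\<omega> x \<eta>) \<zeta>)"
    using skew_skew[OF \<omega>_skew] assms by blast
  ultimately show ?thesis unfolding cyc_def by (simp add: algebra_simps) 
qed

section \<open>Projections onto the two summands and the basis dual to \<open>B\<close>\<close>

lemma sub_\<ll>: "subspace \<ll>" and sub_\<mm>: "subspace \<mm>"
  and \<ll>_\<mm>: "\<ll> \<inter> \<mm> = {0}" and decomp: "\<exists>a\<in>\<ll>. \<exists>b\<in>\<mm>. x = a + b"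
  and br_\<ll>: "y \<in> \<ll> \<Longrightarrow> z \<in> \<ll> \<Longrightarrow> br y z \<in> \<ll>" and br_\<mm>: "y \<in> \<ll> \<Longrightarrow> z \<in> \<mm> \<Longrightarrow> br y z \<in> \<mm>"
  using red unfolding reductive_decomposition_def by blast+

lemma B_\<ll>: "b \<in> B \<Longrightarrow> b \<in> \<ll>"
  unfolding span_B[symmetric] by (rule span_base)

lemma finite_B [simp]: "finite B"
proof -
  obtain Bs where "finite_dimensional_vector_space sc Bs"
    using lqb unfolding lie_quasi_bialgebra_def by blast
  then interpret finite_dimensional_vector_space sc Bs .
  show ?thesis using indep by (rule finiteI_independent)
qed

definition Q :: "'g \<Rightarrow> 'g" where "Q x = (THE a. a \<in> \<ll> \<and> x - a \<in> \<mm>)"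
definition P :: "'g \<Rightarrow> 'g" where "P x = x - Q x"

lemma Q_unique:
  assumes "a \<in> \<ll>" "x - a \<in> \<mm>" shows "Q x = a"
  unfolding Q_def
proof (rule the_equality)
  fix a' assume a': "a' \<in> \<ll> \<and> x - a' \<in> \<mm>"
  have "a' - a \<in> \<ll>" using subspace_diff[OF sub_\<ll> conjunct1[OF a'] assms(1)] .
  moreover have "a' - a = (x - a) - (x - a')" by simp
  then have "a' - a \<in> \<mm>" using subspace_diff[OF sub_\<mm> assms(2) conjunct2[OF a']] by (simp only:)
  ultimately have "a' - a \<in> {0}" unfolding \<ll>_\<mm>[symmetric] by (rule IntI)
  then show "a' = a" by simp
qed (use assms in auto)

lemma Q_\<ll>: "Q x \<in> \<ll>" and P_\<mm>: "P x \<in> \<mm>"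
proof -
  obtain a b where "a \<in> \<ll>" "b \<in> \<mm>" "x = a + b" using decomp by blast
  moreover from this have "Q x = a" by (intro Q_unique) auto
  ultimately show "Q x \<in> \<ll>" "P x \<in> \<mm>" by (auto simp: P_def)
qed

lemma Q_add: "Q (x + y) = Q x + Q y"
  using Q_\<ll>[of x] Q_\<ll>[of y] P_\<mm>[of x] P_\<mm>[of y] sub_\<ll> sub_\<mm>
  by (intro Q_unique subspace_add) (auto simp: P_def add_diff_add subspace_add)

lemma Q_scale: "Q (sc c x) = sc c (Q x)"
  using Q_\<ll>[of x] P_\<mm>[of x] sub_\<ll> sub_\<mm>
  by (intro Q_unique) (auto simp: P_def subspace_scale simp flip: scale_right_diff_distrib)

lemma Q_id: "x \<in> \<ll> \<Longrightarrow> Q x = x"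
  using sub_\<mm> by (intro Q_unique) (auto simp: subspace_0)

lemma Q_\<mm>: "x \<in> \<mm> \<Longrightarrow> Q x = 0"
  using sub_\<ll> by (intro Q_unique) (auto simp: subspace_0)

lemma P_id: "x \<in> \<mm> \<Longrightarrow> P x = x" and P_\<ll>: "x \<in> \<ll> \<Longrightarrow> P x = 0"
  by (auto simp: P_def Q_id Q_\<mm>)

sublocale Q: Modules.additive Q by unfold_locales (rule Q_add)

lemma P_add: "P (x + y) = P x + P y" and P_scale: "P (sc c x) = sc c (P x)"
  by (auto simp: P_def Q_add Q_scale scale_right_diff_distrib)

sublocale P: Modules.additive P by unfold_locales (rule P_add)

text \<open>Reductivity: both summands are stable under \<open>\<ll>\<close>, so both projections
  commute with its adjoint action.\<close>

lemma Q_br: "z \<in> \<ll> \<Longrightarrow> Q (br z x) = br z (Q x)"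
  using br_\<ll>[OF _ Q_\<ll>] br_\<mm>[OF _ P_\<mm>, of z x]
  by (intro Q_unique) (auto simp: P_def br_right.diff)

lemma P_br: "z \<in> \<ll> \<Longrightarrow> P (br z x) = br z (P x)"
  by (simp add: P_def Q_br br_right.diff)

lemma comp_P_Q_dual: "\<xi> \<in> D \<Longrightarrow> \<xi> \<circ> P \<in> D" "\<xi> \<in> D \<Longrightarrow> \<xi> \<circ> Q \<in> D"
  by (auto simp: dual_iff P_add P_scale Q_add Q_scale)

text \<open>For \<open>b \<in> B\<close>, the member of the dual basis of
  \<open>\<ll>\<^sup>*\<close> belonging to \<open>b\<close>, extended by 0 on
  \<open>\<mm>\<close>.\<close>

definition e :: "'g \<Rightarrow> 'g \<Rightarrow> 'k" where "e b x = representation B (Q x) b"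

lemma e_dual [simp]: "e b \<in> D"
  using Q_\<ll> by (auto simp: dual_iff e_def Q_add Q_scale representation_add representation_scale indep span_B)

lemma e_\<mm>: "x \<in> \<mm> \<Longrightarrow> e b x = 0"
  by (simp add: e_def Q_\<mm> representation_zero)

lemma e_B: "b \<in> B \<Longrightarrow> c \<in> B \<Longrightarrow> e b c = (if b = c then 1 else 0)"
  by (simp add: e_def Q_id B_\<ll> representation_basis indep)

lemma sum_e: "x \<in> \<ll> \<Longrightarrow> (\<Sum>b\<in>B. sc (e b x) b) = x"
  by (simp add: e_def Q_id sum_representation_eq indep span_B)

lemma sum_e_Q: "(\<Sum>b\<in>B. sc (e b x) b) = Q x"
  by (simp add: e_def sum_representation_eq indep span_B Q_\<ll>)

lemma dual_Q_expand: "\<xi> \<in> D \<Longrightarrow> \<xi> \<circ> Q = (\<Sum>b\<in>B. fs (\<xi> b) (e b))"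
proof
  fix x assume "\<xi> \<in> D"
  then show "(\<xi> \<circ> Q) x = (\<Sum>b\<in>B. fs (\<xi> b) (e b)) x"
    unfolding o_def by (subst sum_e_Q[symmetric]) (simp add: dual_simps sum_apply fun_scale_def mult.commute)
qed

lemma feval_eq: "v \<in> \<ll> \<Longrightarrow> coord v = (\<lambda>\<alpha>. \<Sum>b\<in>B. if \<alpha> = {#b#} then e b v else 0)"
  unfolding feval_def e_def by (simp only: Q_id)

end

section \<open>Exponentials of commuting operators\<close>

text \<open>Models the adjoint action on the values (\<open>L\<close>) and on the arguments
  (\<open>R\<close>) of a map. These commute because they touch different ends. Only the single
  homogeneous terms of exponential identities are stated, so convergence does not arise.\<close>

locale commuting_operators = vector_space s
  for s :: "'k::field_char_0 \<Rightarrow> 'v::ab_group_add \<Rightarrow> 'v" +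
  fixes L R :: "'v \<Rightarrow> 'v"
  assumes L_add: "L (x + y) = L x + L y" and L_scale: "L (s c x) = s c (L x)"
    and R_add: "R (x + y) = R x + R y" and R_scale: "R (s c x) = s c (R x)"
    and LR: "L (R x) = R (L x)"
begin

sublocale L: Modules.additive L by unfold_locales (rule L_add)
sublocale R: Modules.additive R by unfold_locales (rule R_add)

definition T :: "'v \<Rightarrow> 'v" where "T x = L x + R x"

lemma T_add: "T (x + y) = T x + T y" and T_scale: "T (s c x) = s c (T x)"
  by (simp_all add: T_def L_add R_add L_scale R_scale scale_right_distrib)

sublocale T: Modules.additive T by unfold_locales (rule T_add)

lemma T_pow_add: "(T ^^ n) (x + y) = (T ^^ n) x + (T ^^ n) y"
  by (induction n) (simp_all add: T_add)

lemma R_L_pow: "R ((L ^^ i) x) = (L ^^ i) (R x)"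
  by (induction i) (auto simp flip: LR)

lemma L_R_pow: "L ((R ^^ i) x) = (R ^^ i) (L x)"
  by (induction i) (auto simp: LR)

lemma pow_minus: "(R ^^ n) (- x) = - (R ^^ n) x"
  by (induction n) (auto simp: R.minus)

lemma scale_recip_mult: "of_nat (Suc i) * (1 / (fact (Suc i) * c)) = 1 / (fact i * c :: 'k)"
  "of_nat (Suc i) * (1 / (c * fact (Suc i))) = 1 / (c * fact i :: 'k)"
  "of_nat (Suc i) * (1 / fact (Suc i)) = 1 / (fact i :: 'k)"
proof -
  have "of_nat (Suc i) \<noteq> (0 :: 'k)" by (simp only: of_nat_eq_0_iff)
  moreover have "fact (Suc i) = of_nat (Suc i) * (fact i :: 'k)" by simp
  ultimately show "of_nat (Suc i) * (1 / (fact (Suc i) * c)) = 1 / (fact i * c :: 'k)"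
    "of_nat (Suc i) * (1 / (c * fact (Suc i))) = 1 / (c * fact i :: 'k)"
    "of_nat (Suc i) * (1 / fact (Suc i)) = 1 / (fact i :: 'k)"
    by (simp_all del: of_nat_Suc add: divide_simps)
qed

text \<open>The degree \<open>n\<close> part of e^L e^R = e^(L + R), that is, the binomial theorem
  divided by n!.\<close>

lemma exp_add:
  "(\<Sum>i\<le>n. s (1 / (fact i * fact (n - i))) ((L ^^ i) ((R ^^ (n - i)) x))) = s (1 / fact n) ((T ^^ n) x)"
proof (induction n)
  case (Suc n)
  define c where "c i j = s (1 / (fact i * fact j)) ((L ^^ i) ((R ^^ j) x))" for i j
  have cL: "s (of_nat (Suc i)) (c (Suc i) j) = L (c i j)" for i j
    unfolding c_def by (simp only: scale_scale scale_recip_mult L_scale funpow.simps o_def)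
  have cR: "s (of_nat (Suc j)) (c i (Suc j)) = R (c i j)" for i j
    unfolding c_def by (simp only: scale_scale scale_recip_mult R_scale R_L_pow funpow.simps o_def)
  \<comment> \<open>The factor \<open>Suc n\<close> is split as \<open>i + (Suc n - i)\<close>: one
    summand lowers the factorial belonging to \<open>L\<close> and releases an \<open>L\<close>, the
    other does the same for \<open>R\<close>.\<close>
  have "s (of_nat (Suc n)) (\<Sum>i\<le>Suc n. c i (Suc n - i))
      = (\<Sum>i\<le>Suc n. s (of_nat i) (c i (Suc n - i)) + s (of_nat (Suc n - i)) (c i (Suc n - i)))"
    unfolding scale_sum_right
    by (rule sum.cong) (auto simp flip: scale_left_distrib of_nat_add simp del: of_nat_Suc)
  also have "\<dots> = (\<Sum>i\<le>n. L (c i (n - i))) + (\<Sum>i\<le>n. R (c i (n - i)))"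
    unfolding sum.distrib
    by (subst sum.atMost_Suc_shift, subst sum.atMost_Suc) (simp add: Suc_diff_le cL cR del: of_nat_Suc)
  also have "\<dots> = T (\<Sum>i\<le>n. c i (n - i))"
    by (simp add: T_def L.sum R.sum)
  also have "\<dots> = s (1 / fact n) ((T ^^ Suc n) x)"
    unfolding c_def Suc by (simp add: T_scale)
  also have "\<dots> = s (of_nat (Suc n)) (s (1 / fact (Suc n)) ((T ^^ Suc n) x))"
    by (simp only: scale_scale scale_recip_mult)
  finally show ?case
    unfolding c_def by (simp only: scale_cancel_left of_nat_eq_0_iff) simp
qed simp

text \<open>The degree \<open>n\<close> part of (e^L - 1)/L e^R v - (e^R - 1)/R q = (e^T - 1)/T (v -
  q). Multiplied by T = L + R, the left side becomes (e^T - 1)(v - q) because R v = - L q makes the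
  mixed terms cancel; the induction is this computation coefficient by coefficient.\<close>

lemma exp_quotient_add:
  assumes "R v = - L q"
  shows "(\<Sum>i\<le>n. s (1 / (fact (Suc i) * fact (n - i))) ((L ^^ i) ((R ^^ (n - i)) v)))
      - s (1 / fact (Suc n)) ((R ^^ n) q) = s (1 / fact (Suc n)) ((T ^^ n) (v - q))"
proof (induction n)
  case (Suc n)
  define c where "c i j = s (1 / (fact (Suc i) * fact j)) ((L ^^ i) ((R ^^ j) v))" for i j
  define d where "d n = s (1 / fact (Suc n)) ((R ^^ n) q)" for n
  have cL: "s (of_nat (Suc (Suc i))) (c (Suc i) j) = L (c i j)" for i j
    unfolding c_def by (simp only: scale_scale scale_recip_mult L_scale funpow.simps o_def)
  \<comment> \<open>The term with no \<open>L\<close> has no predecessor under \<open>L\<close>. The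
    hypothesis turns its innermost \<open>R v\<close> into \<open>- L q\<close>, which is exactly
    the missing \<open>L\<close> part of \<open>d n\<close>.\<close>
  have c0: "s (of_nat (Suc 0)) (c 0 (Suc n)) = - L (d n)"
    unfolding c_def d_def
    by (simp only: scale_scale scale_recip_mult L_scale funpow_Suc_right o_def assms pow_minus L_R_pow) simp
  have cR: "s (of_nat (Suc j)) (c i (Suc j)) = R (c i j)" for i j
    unfolding c_def by (simp only: scale_scale scale_recip_mult R_scale R_L_pow funpow.simps o_def)
  have dR: "s (of_nat (Suc (Suc n))) (d (Suc n)) = R (d n)"
    unfolding d_def by (simp only: scale_scale scale_recip_mult R_scale funpow.simps o_def)
  have "s (of_nat (Suc (Suc n))) (\<Sum>i\<le>Suc n. c i (Suc n - i))
      = (\<Sum>i\<le>Suc n. s (of_nat (Suc i)) (c i (Suc n - i)) + s (of_nat (Suc n - i)) (c i (Suc n - i)))"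
    unfolding scale_sum_right scale_left_distrib[symmetric] of_nat_add[symmetric]
    by (rule sum.cong) auto
  also have "\<dots> = - L (d n) + (\<Sum>i\<le>n. L (c i (n - i))) + (\<Sum>i\<le>n. R (c i (n - i)))"
    unfolding sum.distrib
    by (subst sum.atMost_Suc_shift, subst sum.atMost_Suc) (simp add: Suc_diff_le cL c0 cR del: of_nat_Suc)
  finally have "s (of_nat (Suc (Suc n))) ((\<Sum>i\<le>Suc n. c i (Suc n - i)) - d (Suc n))
      = T ((\<Sum>i\<le>n. c i (n - i)) - d n)"
    by (simp add: T_def L.sum R.sum L.diff R.diff scale_right_diff_distrib dR del: of_nat_Suc)
  also have "\<dots> = s (1 / fact (Suc n)) ((T ^^ Suc n) (v - q))"
    unfolding c_def d_def Suc by (simp only: T_scale funpow.simps o_def)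
  also have "\<dots> = s (of_nat (Suc (Suc n))) (s (1 / fact (Suc (Suc n))) ((T ^^ Suc n) (v - q)))"
    by (simp only: scale_scale scale_recip_mult)
  finally show ?case
    unfolding c_def d_def by (simp only: scale_cancel_left of_nat_eq_0_iff) simp
qed simp

end

lemma sum_triangle:
  fixes f :: "nat \<Rightarrow> nat \<Rightarrow> 'w::comm_monoid_add"
  assumes "\<And>i j. i + j > N \<Longrightarrow> f i j = 0"
  shows "(\<Sum>i\<le>N. \<Sum>j\<le>N. f i j) = (\<Sum>n\<le>N. \<Sum>i\<le>n. f i (n - i))"
proof -
  have "(\<Sum>i\<le>N. \<Sum>j\<le>N. f i j) = (\<Sum>(i, j)\<in>{..N} \<times> {..N}. f i j)"
    by (rule sum.cartesian_product)
  also have "\<dots> = (\<Sum>(i, j)\<in>{(i, j). i + j \<le> N}. f i j)"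
    by (rule sum.mono_neutral_right) (use assms leI in fastforce)+
  finally show ?thesis by (simp add: sum.triangle_reindex_eq)
qed

context reductive_lqb begin

section \<open>The generator of a gauge transformation\<close>

abbreviation hs :: "'k \<Rightarrow> ('g, 'k) hom_formal \<Rightarrow> ('g, 'k) hom_formal" where
  "hs \<equiv> fun_scale (fun_scale sc)"

abbreviation lin :: "(('g \<Rightarrow> 'k) \<Rightarrow> 'g) \<Rightarrow> bool" where "lin t \<equiv> linear_on D fs sc t"

text \<open>
  In the notation of the paper, \<open>Lop\<close> and \<open>Rop\<close> are \<open>l \<mapsto> ad\<^sub>\<Sigma> l\<close> and \<open>l \<mapsto> l ad\<^sup>*\<^sub>\<Sigma>\<close>, while \<open>vop\<close> and \<open>qop\<close> are
  \<open>d\<Sigma> i\<^sup>*\<close> and \<open>i d\<Sigma>\<^sup>*\<close>. All of them vanish off \<open>\<gg>\<^sup>*\<close>, which makes the operator identities equalities of functions.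
\<close>

definition Lop :: "('g, 'g) formal \<Rightarrow> ('g, 'k) hom_formal \<Rightarrow> ('g, 'k) hom_formal" where
  "Lop S f \<alpha> \<xi> = (if \<xi> \<in> D then conv (\<lambda>\<mu> \<nu>. br (S \<mu>) (f \<nu> \<xi>)) \<alpha> else 0)"

definition Rop :: "('g, 'g) formal \<Rightarrow> ('g, 'k) hom_formal \<Rightarrow> ('g, 'k) hom_formal" where
  "Rop S f \<alpha> \<xi> = (if \<xi> \<in> D then conv (\<lambda>\<mu> \<nu>. f \<nu> (\<xi> \<circ> br (S \<mu>))) \<alpha> else 0)"

definition vop :: "('g, 'g) formal \<Rightarrow> ('g, 'k) hom_formal" where
  "vop S \<alpha> \<xi> = (if \<xi> \<in> D then \<Sum>b\<in>B. sc (\<xi> b) (pd b S \<alpha>) else 0)"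

definition qop :: "('g, 'g) formal \<Rightarrow> ('g, 'k) hom_formal" where
  "qop S \<alpha> \<xi> = (if \<xi> \<in> D then \<Sum>b\<in>B. sc (\<xi> (pd b S \<alpha>)) b else 0)"

text \<open>The translation part of the affine generator whose linear part is \<open>Top S\<close>
  below.\<close>

definition uop :: "('g, 'g) formal \<Rightarrow> ('g, 'k) hom_formal" where
  "uop S = vop S - qop S + (\<lambda>\<alpha>. \<omega> (S \<alpha>))"

lemma br_conv_right: "br x (conv h \<alpha>) = conv (\<lambda>\<mu> \<nu>. br x (h \<mu> \<nu>)) \<alpha>"
  by (rule conv_hom) (simp_all add: br_right.zero br_add_right)

lemma br_conv_left: "br (conv h \<alpha>) x = conv (\<lambda>\<mu> \<nu>. br (h \<mu> \<nu>) x) \<alpha>"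
  by (rule conv_hom[where f = "\<lambda>y. br y x"]) (simp_all add: br_left.zero br_add_left)

lemma sc_conv: "sc c (conv h \<alpha>) = conv (\<lambda>\<mu> \<nu>. sc c (h \<mu> \<nu>)) \<alpha>"
  by (rule conv_hom) (simp_all add: scale_right_distrib)

lemma lin_add: "lin t \<Longrightarrow> \<xi> \<in> D \<Longrightarrow> \<eta> \<in> D \<Longrightarrow> t (\<xi> + \<eta>) = t \<xi> + t \<eta>"
  and lin_scale: "lin t \<Longrightarrow> \<xi> \<in> D \<Longrightarrow> t (fs c \<xi>) = sc c (t \<xi>)"
  by (auto simp: linear_on_def)

lemma lin_zero: "lin t \<Longrightarrow> t 0 = 0"
  using lin_add[of t 0 0] by simp

lemma lin_sum: "lin t \<Longrightarrow> (\<And>i. i \<in> I \<Longrightarrow> f i \<in> D) \<Longrightarrow> t (sum f I) = (\<Sum>i\<in>I. t (f i))"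
  by (rule sum_hom_on[where V = D and f = t]) (auto simp: lin_zero lin_add)

lemma lin_conv: "lin t \<Longrightarrow> (\<And>\<mu> \<nu>. h \<mu> \<nu> \<in> D) \<Longrightarrow> t (conv h \<alpha>) = conv (\<lambda>\<mu> \<nu>. t (h \<mu> \<nu>)) \<alpha>"
  by (rule conv_hom_on[where V = D and f = t]) (auto simp: lin_zero lin_add)

lemma skew_lin: "t \<in> SK \<Longrightarrow> lin t"
  by (simp add: skew_maps_def)

lemma vop_lin: "lin (vop S \<alpha>)"
  by (auto simp: linear_on_def vop_def fun_scale_def dual_closed[unfolded fun_scale_def] dual_add_closed scale_left_distrib
      sum.distrib scale_sum_right)

sublocale ops: commuting_operators hs "Lop S" "Rop S" for S
proof (unfold_locales, goal_cases)
  case (9 f)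
  show ?case
  proof (intro ext)
    fix \<alpha> \<xi>
    show "Lop S (Rop S f) \<alpha> \<xi> = Rop S (Lop S f) \<alpha> \<xi>"
      by (cases "\<xi> \<in> D") (simp_all add: Lop_def Rop_def dual_closed br_conv_right
          conv_left_commute[of "\<lambda>\<mu> \<rho> \<tau>. br (S \<mu>) (f \<tau> (\<xi> \<circ> br (S \<rho>)))"])
  qed
qed (auto simp: fun_eq_iff fun_scale_def Lop_def Rop_def scale_right_distrib scale_left_distrib
      br_add_right br_scale_right conv_add sc_conv)

abbreviation Top where "Top \<equiv> ops.T"

lemma Top_eq: "Top S f \<alpha> \<xi> = Lop S f \<alpha> \<xi> + Rop S f \<alpha> \<xi>"
  by (simp add: ops.T_def)

lemma split_size: "\<mu> + \<nu> = (\<alpha> :: 'a multiset) \<Longrightarrow> size \<mu> + size \<nu> = size \<alpha>"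
  by auto

text \<open>Linearity is tracked apart from skewness because \<open>vop S\<close> and
  \<open>qop S\<close> are linear but in general only their difference is skew.\<close>

definition linF :: "('g, 'k) hom_formal \<Rightarrow> bool" where "linF f \<longleftrightarrow> (\<forall>\<alpha>. lin (f \<alpha>))"

lemma linF_D: "linF f \<Longrightarrow> lin (f \<alpha>)"
  by (simp add: linF_def)

lemma Lop_apply: "\<xi> \<in> D \<Longrightarrow> Lop S f \<alpha> \<xi> = conv (\<lambda>\<mu> \<nu>. br (S \<mu>) (f \<nu> \<xi>)) \<alpha>"
  and Rop_apply: "\<xi> \<in> D \<Longrightarrow> Rop S f \<alpha> \<xi> = conv (\<lambda>\<mu> \<nu>. f \<nu> (\<xi> \<circ> br (S \<mu>))) \<alpha>"
  by (simp_all add: Lop_def Rop_def)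

lemma linF_Lop: "linF f \<Longrightarrow> linF (Lop S f)"
  by (simp add: linF_def linear_on_def Lop_def dual_closed dual_add_closed br_add_right br_scale_right conv_add sc_conv)

lemma linF_Rop: "linF f \<Longrightarrow> linF (Rop S f)"
  by (simp add: linF_def linear_on_def Rop_def dual_closed dual_add_closed add_comp fs_comp conv_add sc_conv)

lemma linF_add: "linF f \<Longrightarrow> linF g \<Longrightarrow> linF (f + g)"
  by (simp add: linF_def linear_on_def scale_right_distrib)

lemma linF_Top: "linF f \<Longrightarrow> linF (Top S f)"
  by (simp add: ops.T_def linF_add linF_Lop linF_Rop)

lemma linF_pow: "linF f \<Longrightarrow> linF ((Lop S ^^ n) f)" "linF f \<Longrightarrow> linF ((Rop S ^^ n) f)" "linF f \<Longrightarrow> linF ((Top S ^^ n) f)"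
  by (induction n) (auto simp: linF_Lop linF_Rop linF_Top)

text \<open>As \<open>S {#} = 0\<close>, at least one degree of every contributing splitting is used
  up by \<open>S\<close>, so each application raises the order of vanishing.\<close>

lemma Lop_Rop_vanish:
  assumes "S {#} = 0" "linF f" "\<And>\<alpha>. size \<alpha> < k \<Longrightarrow> f \<alpha> = 0" "size \<alpha> < Suc k"
  shows "Lop S f \<alpha> = 0" "Rop S f \<alpha> = 0"
proof -
  have z: "S \<mu> = 0 \<or> f \<nu> = 0" if "\<mu> + \<nu> = \<alpha>" for \<mu> \<nu>
  proof (cases "\<mu> = {#}")
    case False
    then have "size \<nu> < k" using that assms(4) split_size[OF that] by (cases \<mu>) auto
    then show ?thesis using assms(3) by simp
  qed (simp add: assms(1))
  have z0: "f \<nu> 0 = 0" for \<nu>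
    using assms(2) by (simp add: linF_def lin_zero)
  show "Lop S f \<alpha> = 0" 
    by (rule ext) (use z in \<open>auto simp: Lop_def br_left.zero br_right.zero intro!: conv_eq_0, fastforce simp: br_left.zero br_right.zero\<close>)
  show "Rop S f \<alpha> = 0"
    by (rule ext) (use z in \<open>auto simp: Rop_def intro!: conv_eq_0, fastforce simp: comp_br_zero z0\<close>)
qed

lemma Lop_Rop_pow_vanish:
  assumes "S {#} = 0" "linF f"
  shows "size \<alpha> < i + j \<Longrightarrow> (Lop S ^^ i) ((Rop S ^^ j) f) \<alpha> = 0"
proof (induction i arbitrary: \<alpha>)
  case 0
  then have "size \<alpha> < j" by simp
  then have "(Rop S ^^ j) f \<alpha> = 0"
  proof (induction j arbitrary: \<alpha>)
    case (Suc j)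
    show ?case
      unfolding funpow.simps o_def
      by (rule Lop_Rop_vanish(2)[where k = j]) (use Suc assms linF_pow in auto)
  qed simp
  then show ?case by simp
next
  case (Suc i)
  show ?case
    unfolding funpow.simps o_def
    by (rule Lop_Rop_vanish(1)[where k = "i + j"]) (use Suc assms linF_pow in auto)
qed

lemma Top_vanish:
  assumes "S {#} = 0" "linF f" "\<And>\<alpha>. size \<alpha> < k \<Longrightarrow> f \<alpha> = 0" "size \<alpha> < Suc k"
  shows "Top S f \<alpha> = 0"
  unfolding ops.T_def using Lop_Rop_vanish[where S = S and f = f, OF assms] by simp

lemma Top_pow_vanish:
  assumes "S {#} = 0" "linF f"
  shows "size \<alpha> < n \<Longrightarrow> (Top S ^^ n) f \<alpha> = 0"
proof (induction n arbitrary: \<alpha>)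
  case (Suc n)
  show ?case
    unfolding funpow.simps o_def
    by (rule Top_vanish[where k = n]) (use Suc assms linF_pow in auto)
qed simp

section \<open>The gauge action as a power series in \<open>Top\<close>\<close>

abbreviation ad :: "('g, 'g) formal \<Rightarrow> ('g, 'g) formal \<Rightarrow> 'g multiset \<Rightarrow> 'g" where "ad \<equiv> fprod br"

lemma fprod_conv: "fprod bil f h \<alpha> = conv (\<lambda>\<mu> \<nu>. bil (f \<mu>) (h \<nu>)) \<alpha>"
  by (simp add: fprod_def conv_def)

lemma ad_eq: "ad S v \<alpha> = conv (\<lambda>\<mu> \<nu>. br (S \<mu>) (v \<nu>)) \<alpha>"
  by (simp add: fprod_def conv_def)

lemma ad_pow_Suc: "(ad S ^^ Suc n) v \<alpha> = conv (\<lambda>\<mu> \<nu>. br (S \<mu>) ((ad S ^^ n) v \<nu>)) \<alpha>"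
  by (simp only: funpow.simps o_def ad_eq)

lemma Lop_pow: "\<xi> \<in> D \<Longrightarrow> (Lop S ^^ n) f \<alpha> \<xi> = (ad S ^^ n) (\<lambda>\<mu>. f \<mu> \<xi>) \<alpha>"
proof (induction n arbitrary: \<alpha>)
  case (Suc n)
  then show ?case by (simp add: Lop_apply ad_pow_Suc del: funpow.simps(2)) (simp add: Lop_apply)
qed simp

lemma ad_pow_cong:
  "(\<And>\<mu>. size \<mu> \<le> N \<Longrightarrow> v \<mu> = w \<mu>) \<Longrightarrow> size \<alpha> \<le> N \<Longrightarrow> (ad S ^^ n) v \<alpha> = (ad S ^^ n) w \<alpha>"
proof (induction n arbitrary: \<alpha>)
  case (Suc n)
  show ?case
    unfolding ad_pow_Suc
    by (rule conv_cong) (use Suc split_size in \<open>metis add_leD2\<close>)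
qed simp

lemma ad_pow_add: "(ad S ^^ n) (\<lambda>\<mu>. v \<mu> + w \<mu>) \<alpha> = (ad S ^^ n) v \<alpha> + (ad S ^^ n) w \<alpha>"
  by (induction n arbitrary: \<alpha>) (simp_all add: ad_pow_Suc br_add_right conv_add del: funpow.simps(2))

lemma ad_pow_scale: "(ad S ^^ n) (\<lambda>\<mu>. sc c (v \<mu>)) \<alpha> = sc c ((ad S ^^ n) v \<alpha>)"
  by (induction n arbitrary: \<alpha>) (simp_all add: ad_pow_Suc br_scale_right sc_conv del: funpow.simps(2))

lemma ad_pow_zero: "(ad S ^^ n) (\<lambda>\<mu>. 0) \<alpha> = 0"
  by (induction n arbitrary: \<alpha>) (simp_all add: ad_pow_Suc br_right.zero del: funpow.simps(2))

lemma ad_pow_sum: "(ad S ^^ n) (\<lambda>\<mu>. \<Sum>i\<in>I. v i \<mu>) \<alpha> = (\<Sum>i\<in>I. (ad S ^^ n) (v i) \<alpha>)"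
  by (induction I rule: infinite_finite_induct) (simp_all add: ad_pow_zero ad_pow_add)

lemma ad_pow_vanish: "S {#} = 0 \<Longrightarrow> size \<alpha> < n \<Longrightarrow> (ad S ^^ n) v \<alpha> = 0"
proof (induction n arbitrary: \<alpha>)
  case (Suc n)
  have "br (S \<mu>) ((ad S ^^ n) v \<nu>) = 0" if "\<mu> + \<nu> = \<alpha>" for \<mu> \<nu>
  proof (cases "\<mu> = {#}")
    case False
    then have "size \<nu> < n" using that Suc(3) split_size[OF that] by (cases \<mu>) auto
    then show ?thesis using Suc by (simp add: br_right.zero)
  qed (simp add: Suc br_left.zero)
  then show ?case unfolding ad_pow_Suc by (rule conv_eq_0)
qed simp

lemma ad_series_eq:
  assumes "S {#} = 0" "size \<alpha> \<le> N"
  shows "ad_series sc br c S v \<alpha> = (\<Sum>n\<le>N. sc (c n) ((ad S ^^ n) v \<alpha>))"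
  unfolding ad_series_def
  by (rule sum.mono_neutral_left) (use assms in \<open>auto simp: ad_pow_vanish\<close>)

text \<open>The \<open>n\<close>-th power of the transpose of \<open>ad S\<close>, applied to the
  constant \<open>\<xi>\<close>; \<open>Ad_star\<close> is the exponential series of these
  powers.\<close>

definition coad :: "('g, 'g) formal \<Rightarrow> nat \<Rightarrow> ('g \<Rightarrow> 'k) \<Rightarrow> 'g multiset \<Rightarrow> 'g \<Rightarrow> 'k" where
  "coad S n \<xi> \<mu> = (\<lambda>x. \<xi> ((ad S ^^ n) (fconst x) \<mu>))"

lemma coad_0: "\<xi> \<in> D \<Longrightarrow> coad S 0 \<xi> \<mu> = (if \<mu> = {#} then \<xi> else 0)"
  by (auto simp: coad_def fconst_def dual_zero)

lemma coad_Suc: "\<xi> \<in> D \<Longrightarrow> coad S (Suc n) \<xi> \<alpha> = conv (\<lambda>\<mu> \<nu>. coad S n (\<xi> \<circ> br (S \<mu>)) \<nu>) \<alpha>"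
  by (rule ext) (simp add: coad_def conv_apply ad_pow_Suc dual_conv del: funpow.simps(2))

lemma coad_dual [intro]: "\<xi> \<in> D \<Longrightarrow> coad S n \<xi> \<mu> \<in> D"
proof (induction n arbitrary: \<xi> \<mu>)
  case (Suc n)
  show ?case unfolding coad_Suc[OF Suc(2)] by (intro dual_conv_closed Suc(1) dual_closed(1) Suc(2))
qed (auto simp: coad_0)

lemma Rop_pow:
  assumes "linF f"
  shows "\<xi> \<in> D \<Longrightarrow> (Rop S ^^ n) f \<alpha> \<xi> = conv (\<lambda>\<mu> \<nu>. f \<mu> (coad S n \<xi> \<nu>)) \<alpha>"
proof (induction n arbitrary: \<xi> \<alpha>)
  case 0
  have "conv (\<lambda>\<mu> \<nu>. f \<mu> (coad S 0 \<xi> \<nu>)) \<alpha> = conv (\<lambda>\<mu> \<nu>. if \<nu> = {#} then f \<mu> \<xi> else 0) \<alpha>"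
    by (rule conv_cong) (use assms 0 in \<open>auto simp: coad_0 linF_def lin_zero\<close>)
  then show ?case by (simp add: conv_const_right)
next
  case (Suc n)
  have "(Rop S ^^ Suc n) f \<alpha> \<xi> = convr (\<lambda>\<mu> \<rho> \<tau>. f \<rho> (coad S n (\<xi> \<circ> br (S \<mu>)) \<tau>)) \<alpha>"
    unfolding funpow.simps o_apply[of _ _ f] Rop_apply[OF Suc(2)] Suc(1)[OF dual_closed(1)[OF Suc(2)]] ..
  also have "\<dots> = convr (\<lambda>\<mu> \<rho> \<tau>. f \<mu> (coad S n (\<xi> \<circ> br (S \<rho>)) \<tau>)) \<alpha>"
    by (rule conv_left_commute)
  also have "\<dots> = conv (\<lambda>\<mu> \<nu>. f \<mu> (coad S (Suc n) \<xi> \<nu>)) \<alpha>"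
    using Suc(2) assms by (simp add: coad_Suc lin_conv linF_D coad_dual dual_closed)
  finally show ?case .
qed

lemma Ad_star_eq:
  assumes "\<xi> \<in> D" "S {#} = 0" "size \<mu> \<le> N"
  shows "Ad_star sc br S \<xi> \<mu> = (\<Sum>n\<le>N. fs (1 / fact n) (coad S n \<xi> \<mu>))"
  by (rule ext) (simp add: assms Ad_star_def Ad_def ad_series_eq[where S = S, OF assms(2,3)] dual_simps sum_apply fun_scale_def coad_def)

lemma Ad_star_dual: "\<xi> \<in> D \<Longrightarrow> S {#} = 0 \<Longrightarrow> Ad_star sc br S \<xi> \<mu> \<in> D"
  by (subst Ad_star_eq[where N = "size \<mu>"]) (auto intro!: dual_sum_closed dual_closed coad_dual)

lemma apply_Ad_star:
  assumes "linF f" "\<xi> \<in> D" "S {#} = 0" "size \<alpha> \<le> N"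
  shows "fprod (\<lambda>s \<eta>. s \<eta>) f (Ad_star sc br S \<xi>) \<alpha> = (\<Sum>n\<le>N. sc (1 / fact n) ((Rop S ^^ n) f \<alpha> \<xi>))"
proof -
  have "fprod (\<lambda>s \<eta>. s \<eta>) f (Ad_star sc br S \<xi>) \<alpha> = conv (\<lambda>\<mu> \<nu>. f \<mu> (Ad_star sc br S \<xi> \<nu>)) \<alpha>"
    by (simp add: fprod_def conv_def)
  also have "\<dots> = conv (\<lambda>\<mu> \<nu>. \<Sum>n\<le>N. sc (1 / fact n) (f \<mu> (coad S n \<xi> \<nu>))) \<alpha>"
  proof (rule conv_cong)
    fix \<mu> \<nu> assume "\<mu> + \<nu> = \<alpha>"
    then have "size \<nu> \<le> N" using assms(4) split_size[of \<mu> \<nu> \<alpha>] by simp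
    then show "f \<mu> (Ad_star sc br S \<xi> \<nu>) = (\<Sum>n\<le>N. sc (1 / fact n) (f \<mu> (coad S n \<xi> \<nu>)))"
      using assms by (simp add: Ad_star_eq lin_sum linF_D dual_closed coad_dual lin_scale)
  qed
  also have "\<dots> = (\<Sum>n\<le>N. sc (1 / fact n) ((Rop S ^^ n) f \<alpha> \<xi>))"
    using assms by (simp add: conv_sum Rop_pow sc_conv)
  finally show ?thesis .
qed

text \<open>A series in \<open>L\<close> applied to e^R, regrouped by total degree; the terms
  outside the triangle vanish since \<open>L\<close> and \<open>R\<close> raise the order. The
  coefficients \<open>c\<close> stay general to serve both \<open>Ad\<close> (1/n!) and
  \<open>S_map\<close> (1/(n+1)!).\<close>

lemma ad_series_apply_Ad_star:
  assumes "linF f" "\<xi> \<in> D" "S {#} = 0" "\<And>\<mu>. size \<mu> \<le> size \<alpha> \<Longrightarrow> w \<mu> = fprod (\<lambda>s \<eta>. s \<eta>) f (Ad_star sc br S \<xi>) \<mu>"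
  shows "ad_series sc br c S w \<alpha>
       = (\<Sum>n\<le>size \<alpha>. \<Sum>i\<le>n. sc (c i / fact (n - i)) ((Lop S ^^ i) ((Rop S ^^ (n - i)) f) \<alpha> \<xi>))"
proof -
  let ?N = "size \<alpha>"
  have "(ad S ^^ i) w \<alpha> = (\<Sum>n\<le>?N. sc (1 / fact n) ((Lop S ^^ i) ((Rop S ^^ n) f) \<alpha> \<xi>))" for i
  proof -
    have "(ad S ^^ i) w \<alpha> = (ad S ^^ i) (\<lambda>\<mu>. \<Sum>n\<le>?N. sc (1 / fact n) ((Rop S ^^ n) f \<mu> \<xi>)) \<alpha>"
      by (rule ad_pow_cong[where N = ?N]) (use assms in \<open>auto simp: apply_Ad_star\<close>)
    then show ?thesis
      using assms by (simp add: ad_pow_sum ad_pow_scale Lop_pow)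
  qed
  then have "ad_series sc br c S w \<alpha>
      = (\<Sum>i\<le>?N. \<Sum>j\<le>?N. sc (c i / fact j) ((Lop S ^^ i) ((Rop S ^^ j) f) \<alpha> \<xi>))"
    using assms by (simp add: ad_series_eq[where N = ?N] scale_sum_right)
  also have "\<dots> = (\<Sum>n\<le>?N. \<Sum>i\<le>n. sc (c i / fact (n - i)) ((Lop S ^^ i) ((Rop S ^^ (n - i)) f) \<alpha> \<xi>))"
    by (rule sum_triangle) (use assms in \<open>simp add: Lop_Rop_pow_vanish\<close>)
  finally show ?thesis .
qed

lemma hs_apply: "hs c f \<alpha> \<xi> = sc c (f \<alpha> \<xi>)"
  by (simp add: fun_scale_def)

lemma Ad_conj_eq:
  assumes "linF f" "\<xi> \<in> D" "S {#} = 0"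
  shows "Ad_conj sc br S f \<xi> \<alpha> = (\<Sum>n\<le>size \<alpha>. sc (1 / fact n) ((Top S ^^ n) f \<alpha> \<xi>))"
proof -
  have "(\<Sum>i\<le>n. sc (1 / fact i / fact (n - i)) ((Lop S ^^ i) ((Rop S ^^ (n - i)) f) \<alpha> \<xi>))
      = sc (1 / fact n) ((Top S ^^ n) f \<alpha> \<xi>)" for n
    using fun_cong[OF fun_cong[OF ops.exp_add[of n S f]], of \<alpha> \<xi>] by (simp add: sum_apply hs_apply)
  then show ?thesis
    unfolding Ad_conj_def Ad_def by (subst ad_series_apply_Ad_star[where S = S and f = f, OF assms]) simp_all
qed

text \<open>The first half of \<open>theta\<close> is \<open>vop S\<close> evaluated at the
  transposed exponential, followed by the series in \<open>L\<close>. In the second half the series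
  is transposed, so it acts on the argument and produces powers of \<open>R\<close> on
  \<open>qop S\<close>. \<open>exp_quotient_add\<close> merges the two.\<close>

lemma theta_eq:
  assumes "\<xi> \<in> D" "S {#} = 0" "Rop S (vop S) = - Lop S (qop S)"
  shows "theta sc br B S \<xi> \<alpha> = (\<Sum>n\<le>size \<alpha>. sc (1 / fact (Suc n)) ((Top S ^^ n) (vop S - qop S) \<alpha> \<xi>))"
proof -
  let ?N = "size \<alpha>"
  have fd: "fdiff sc B S (\<lambda>b \<mu>. Ad_star sc br S \<xi> \<mu> b) \<mu> = fprod (\<lambda>s \<eta>. s \<eta>) (vop S) (Ad_star sc br S \<xi>) \<mu>" for \<mu>
  proof -
    have "fdiff sc B S (\<lambda>b \<mu>. Ad_star sc br S \<xi> \<mu> b) \<mu>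
        = conv (\<lambda>\<nu> \<rho>. vop S \<rho> (Ad_star sc br S \<xi> \<nu>)) \<mu>"
      using Ad_star_dual[where S = S, OF assms(1,2)]
      by (simp add: fdiff_def fprod_conv vop_def flip: conv_sum)
    also have "\<dots> = conv (\<lambda>\<nu> \<rho>. vop S \<nu> (Ad_star sc br S \<xi> \<rho>)) \<mu>"
      by (rule conv_commute)
    finally show ?thesis by (simp add: fprod_def conv_def)
  qed
  have vl: "linF (vop S)" by (simp add: linF_def vop_lin)
  have 1: "S_map sc br B S (\<lambda>b \<mu>. Ad_star sc br S \<xi> \<mu> b) \<alpha>
      = (\<Sum>n\<le>?N. \<Sum>i\<le>n. sc (1 / fact (Suc i) / fact (n - i)) ((Lop S ^^ i) ((Rop S ^^ (n - i)) (vop S)) \<alpha> \<xi>))"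
    unfolding S_map_def by (rule ad_series_apply_Ad_star[where S = S and f = "vop S", OF vl assms(1,2)]) (rule fd)
  have Rq: "(Rop S ^^ n) (qop S) \<alpha> \<xi> = (\<Sum>b\<in>B. sc (\<xi> ((ad S ^^ n) (pd b S) \<alpha>)) b)" if "\<xi> \<in> D" for n \<xi> \<alpha>
    using that
  proof (induction n arbitrary: \<xi> \<alpha>)
    case (Suc n)
    have "(Rop S ^^ Suc n) (qop S) \<alpha> \<xi>
        = conv (\<lambda>\<mu> \<nu>. \<Sum>b\<in>B. sc (\<xi> (br (S \<mu>) ((ad S ^^ n) (pd b S) \<nu>))) b) \<alpha>"
      using Suc(2) by (simp add: Rop_apply Suc(1)[OF dual_closed(1)[OF Suc(2)]])
    also have "\<dots> = (\<Sum>b\<in>B. sc (conv (\<lambda>\<mu> \<nu>. \<xi> (br (S \<mu>) ((ad S ^^ n) (pd b S) \<nu>))) \<alpha>) b)"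
      unfolding conv_sum
      by (intro sum.cong refl conv_hom[where f = "\<lambda>c. sc c x" for x, symmetric]) (auto simp: scale_left_distrib)
    finally show ?case unfolding ad_pow_Suc using Suc(2) by (simp add: dual_conv)
  qed (simp add: qop_def)
  have 2: "S_star sc br B S \<xi> \<alpha> = (\<Sum>n\<le>?N. sc (1 / fact (Suc n)) ((Rop S ^^ n) (qop S) \<alpha> \<xi>))"
  proof -
    have "fdiff sc B S (\<lambda>c. fconst (if c = b then 1 else 0)) \<mu> = pd b S \<mu>" if "b \<in> B" for b \<mu>
    proof -
      have "fprod sc (fconst (if c = b then 1 else 0)) (pd c S) \<mu> = (if c = b then pd b S \<mu> else 0)" for c
      proof -
        have "fprod sc (fconst (if c = b then 1 else 0)) (pd c S) \<mu>
           = conv (\<lambda>\<mu> \<nu>. if \<mu> = {#} then sc (if c = b then 1 else 0) (pd c S \<nu>) else 0) \<mu>"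
          unfolding fprod_conv fconst_def by (rule conv_cong) simp
        then show ?thesis by (simp add: conv_const_left)
      qed
      then show ?thesis using that by (simp add: fdiff_def)
    qed
    then have "fdiff sc B S (\<lambda>c. fconst (if c = b then 1 else 0)) = pd b S" if "b \<in> B" for b
      using that by auto
    then have "S_star sc br B S \<xi> \<alpha> = (\<Sum>b\<in>B. \<Sum>n\<le>?N. sc (1 / fact (Suc n) * \<xi> ((ad S ^^ n) (pd b S) \<alpha>)) b)"
      using assms by (simp add: S_star_def S_map_def ad_series_def dual_simps scale_sum_left del: fact_Suc)
    then show ?thesis
      using assms by (subst (asm) sum.swap) (simp add: Rq scale_sum_right del: fact_Suc)
  qed
  have "(\<Sum>i\<le>n. sc (1 / fact (Suc i) / fact (n - i)) ((Lop S ^^ i) ((Rop S ^^ (n - i)) (vop S)) \<alpha> \<xi>))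
      - sc (1 / fact (Suc n)) ((Rop S ^^ n) (qop S) \<alpha> \<xi>)
      = sc (1 / fact (Suc n)) ((Top S ^^ n) (vop S - qop S) \<alpha> \<xi>)" for n
    using fun_cong[OF fun_cong[OF ops.exp_quotient_add[OF assms(3), of n]], of \<alpha> \<xi>]
    by (simp add: sum_apply hs_apply del: fact_Suc)
  then show ?thesis
    unfolding theta_def 1 2 by (simp flip: sum_subtractf del: fact_Suc)
qed


lemma Top_scale_left:
  assumes "linF f"
  shows "Top (\<lambda>\<mu>. sc c (S \<mu>)) f = hs c (Top S f)"
proof (intro ext)
  fix \<alpha> \<xi>
  show "Top (\<lambda>\<mu>. sc c (S \<mu>)) f \<alpha> \<xi> = hs c (Top S f) \<alpha> \<xi>"
    using assms
    by (cases "\<xi> \<in> D") (simp_all add: Top_eq Lop_def Rop_def hs_apply br_scale_left comp_br_scale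
        lin_scale linF_D dual_closed scale_right_distrib sc_conv del: o_apply)
qed

lemma Top_pow_scale_left:
  assumes "linF f"
  shows "(Top (\<lambda>\<mu>. sc c (S \<mu>)) ^^ n) f = hs (c ^ n) ((Top S ^^ n) f)"
proof (induction n)
  case (Suc n)
  have "(Top (\<lambda>\<mu>. sc c (S \<mu>)) ^^ Suc n) f = hs (c ^ n) (Top (\<lambda>\<mu>. sc c (S \<mu>)) ((Top S ^^ n) f))"
    by (simp only: funpow.simps o_apply Suc ops.T_scale)
  also have "\<dots> = hs (c ^ n) (hs c ((Top S ^^ Suc n) f))"
    by (simp only: Top_scale_left linF_pow(3)[OF assms] funpow.simps o_apply)
  finally show ?case by (simp add: fun_eq_iff hs_apply mult.commute)
qed (simp add: fun_eq_iff hs_apply)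

lemma integral01_eq:
  assumes "\<And>\<zeta>. \<zeta> \<in> D \<Longrightarrow> ((\<lambda>\<tau>. \<zeta> (f \<tau>)) has_integral \<zeta> v) {0..1}"
  shows "integral01 sc f = v"
  unfolding integral01_def
proof (rule the_equality)
  fix v' assume "\<forall>\<zeta>\<in>D. ((\<lambda>\<tau>. \<zeta> (f \<tau>)) has_integral \<zeta> v') {0..1}"
  then show "v' = v" using assms has_integral_unique by (intro dual_separates) blast
qed (use assms in blast)

lemma has_integral_monomial:
  fixes c :: 'k
  shows "((\<lambda>\<tau>::real. of_real \<tau> ^ n * c) has_integral (1 / of_nat (Suc n) * c)) {0..1}"
proof -
  have "((\<lambda>\<tau>::real. \<tau> ^ n) has_integral (1 ^ Suc n / real (Suc n) - 0 ^ Suc n / real (Suc n))) {0..1}"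
    by (rule fundamental_theorem_of_calculus)
      (auto intro!: derivative_eq_intros simp: has_real_derivative_iff_has_vector_derivative[symmetric] simp del: power_Suc of_nat_Suc)
  then have "((\<lambda>\<tau>::real. \<tau> ^ n) has_integral (1 / real (Suc n))) {0..1}" by simp
  from has_integral_linear[OF this, of "\<lambda>r. of_real r * c"]
  have "((\<lambda>\<tau>::real. of_real (\<tau> ^ n) * c) has_integral (of_real (1 / real (Suc n)) * c)) {0..1}"
    by (simp add: o_def bounded_linear_mult_left bounded_linear_of_real
        bounded_linear_compose[OF bounded_linear_mult_left bounded_linear_of_real] del: of_nat_Suc)
  then show ?thesis by (simp del: of_nat_Suc)
qed

lemma linF_\<omega>: "linF (\<lambda>\<alpha>. \<omega> (S \<alpha>))"
  by (simp add: linF_def skew_lin \<omega>_skew)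

text \<open>Scaling \<open>S\<close> by \<tau> multiplies the \<open>n\<close>-th term by \<tau>^n,
  whose integral 1/(n+1) turns 1/n! into 1/(n+1)!. This is the same factor as in
  \<open>theta_eq\<close>, so both can be combined into \<open>uop\<close>.\<close>

lemma group_cocycle_eq:
  assumes "\<xi> \<in> D" "S {#} = 0"
  shows "group_cocycle sc br \<omega> S \<xi> \<alpha>
       = (\<Sum>n\<le>size \<alpha>. sc (1 / fact (Suc n)) ((Top S ^^ n) (\<lambda>\<alpha>. \<omega> (S \<alpha>)) \<alpha> \<xi>))"
  unfolding group_cocycle_def
proof (rule integral01_eq)
  fix \<zeta> assume \<zeta>: "\<zeta> \<in> D"
  let ?t = "\<lambda>n. (Top S ^^ n) (\<lambda>\<alpha>. \<omega> (S \<alpha>)) \<alpha> \<xi>"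
  have "Ad_conj sc br (\<lambda>\<mu>. sc (of_real \<tau>) (S \<mu>)) (\<lambda>\<mu>. \<omega> (S \<mu>)) \<xi> \<alpha>
      = (\<Sum>n\<le>size \<alpha>. sc (1 / fact n * of_real \<tau> ^ n) (?t n))" for \<tau>
    using assms by (subst Ad_conj_eq) (simp_all add: linF_\<omega> Top_pow_scale_left hs_apply)
  then have "\<zeta> (Ad_conj sc br (\<lambda>\<mu>. sc (of_real \<tau>) (S \<mu>)) (\<lambda>\<mu>. \<omega> (S \<mu>)) \<xi> \<alpha>)
      = (\<Sum>n\<le>size \<alpha>. of_real \<tau> ^ n * (1 / fact n * \<zeta> (?t n)))" for \<tau>
    using \<zeta> by (simp add: dual_simps mult_ac)
  moreover have "\<zeta> (\<Sum>n\<le>size \<alpha>. sc (1 / fact (Suc n)) (?t n))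
      = (\<Sum>n\<le>size \<alpha>. 1 / of_nat (Suc n) * (1 / fact n * \<zeta> (?t n)))"
    using \<zeta> by (simp add: dual_simps del: of_nat_Suc)
  ultimately show "((\<lambda>\<tau>. \<zeta> (Ad_conj sc br (\<lambda>\<mu>. sc (of_real \<tau>) (S \<mu>)) (\<lambda>\<mu>. \<omega> (S \<mu>)) \<xi> \<alpha>))
      has_integral \<zeta> (\<Sum>n\<le>size \<alpha>. sc (1 / fact (Suc n)) (?t n))) {0..1}"
    by (simp only:) (intro has_integral_sum has_integral_monomial finite_atMost)
qed

lemma Top_off: "\<xi> \<notin> D \<Longrightarrow> Top S f \<alpha> \<xi> = 0"
  by (simp add: Top_eq Lop_def Rop_def)

lemma uop_off: "\<xi> \<notin> D \<Longrightarrow> uop S \<alpha> \<xi> = 0"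
  by (simp add: uop_def vop_def qop_def skew_off \<omega>_skew)

lemma qop_lin: "lin (qop S \<alpha>)"
  by (simp add: linear_on_def qop_def fun_scale_def[of "(*)"] dual_closed(2)[unfolded fun_scale_def] dual_add_closed
      scale_left_distrib sum.distrib scale_sum_right)

lemma linF_uop: "linF (uop S)"
  using vop_lin[of S] qop_lin[of S] skew_lin[OF \<omega>_skew]
  by (simp add: linF_def linear_on_def uop_def scale_right_distrib scale_right_diff_distrib)

text \<open>The value at time one of the solution of x' = T x + u with x(0) = l.\<close>

lemma gauge_act_eq:
  assumes "\<And>\<alpha>. l \<alpha> \<in> SK" "S {#} = 0" "Rop S (vop S) = - Lop S (qop S)"
  shows "gauge_act sc br \<omega> B S l \<alpha> \<xi> = (\<Sum>n\<le>size \<alpha>. sc (1 / fact n) ((Top S ^^ n) l \<alpha> \<xi>))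
       + (\<Sum>n\<le>size \<alpha>. sc (1 / fact (Suc n)) ((Top S ^^ n) (uop S) \<alpha> \<xi>))"
proof (cases "\<xi> \<in> D")
  case True
  have "linF l" using assms(1) by (simp add: linF_def skew_lin)
  moreover have "(Top S ^^ n) (uop S) = (Top S ^^ n) (vop S - qop S) + (Top S ^^ n) (\<lambda>\<alpha>. \<omega> (S \<alpha>))" for n
    unfolding uop_def by (rule ops.T_pow_add)
  ultimately show ?thesis
    using True assms
    by (simp add: gauge_act_def Ad_conj_eq theta_eq group_cocycle_eq scale_right_distrib sum.distrib del: fact_Suc)
next
  case False
  have "(Top S ^^ n) f \<alpha> \<xi> = 0" if "f \<alpha> \<xi> = 0" for f n
    using that False by (cases n) (auto simp: Top_off)
  with False assms(1) show ?thesis by (simp add: gauge_act_def uop_off skew_off)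
qed

section \<open>Derivatives\<close>

text \<open>The multiplicity of \<open>b\<close> is additive over a splitting, so the factor coming
  from the derivative distributes over the two halves.\<close>

lemma sc_Leibniz:
  "sc (of_nat (Suc (count \<alpha> b))) (conv h (add_mset b \<alpha>))
   = conv (\<lambda>\<mu> \<nu>. sc (of_nat (Suc (count \<mu> b))) (h (add_mset b \<mu>) \<nu>)) \<alpha>
   + conv (\<lambda>\<mu> \<nu>. sc (of_nat (Suc (count \<nu> b))) (h \<mu> (add_mset b \<nu>))) \<alpha>"
proof -
  have "sc (of_nat (Suc (count \<alpha> b))) (conv h (add_mset b \<alpha>))
      = conv (\<lambda>\<mu> \<nu>. sc (of_nat (count \<mu> b)) (h \<mu> \<nu>) + sc (of_nat (count \<nu> b)) (h \<mu> \<nu>)) (add_mset b \<alpha>)"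
    unfolding sc_conv
  proof (rule conv_cong)
    fix \<mu> \<nu> assume "\<mu> + \<nu> = add_mset b \<alpha>"
    then have "Suc (count \<alpha> b) = count \<mu> b + count \<nu> b" by (metis count_add_mset count_union)
    then show "sc (of_nat (Suc (count \<alpha> b))) (h \<mu> \<nu>) = sc (of_nat (count \<mu> b)) (h \<mu> \<nu>) + sc (of_nat (count \<nu> b)) (h \<mu> \<nu>)"
      by (simp add: scale_left_distrib del: of_nat_Suc)
  qed
  also have "\<dots> = conv (\<lambda>\<mu> \<nu>. sc (of_nat (count \<mu> b)) (h \<mu> \<nu>)) (add_mset b \<alpha>)
      + conv (\<lambda>\<mu> \<nu>. sc (of_nat (count \<mu> b)) (h \<nu> \<mu>)) (add_mset b \<alpha>)"
    unfolding conv_add by (subst (2) conv_commute) simp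
  also have "\<dots> = conv (\<lambda>\<mu> \<nu>. sc (of_nat (Suc (count \<mu> b))) (h (add_mset b \<mu>) \<nu>)) \<alpha>
      + conv (\<lambda>\<mu> \<nu>. sc (of_nat (Suc (count \<mu> b))) (h \<nu> (add_mset b \<mu>))) \<alpha>"
    using conv_count_left[of "\<lambda>n \<mu> \<nu>. sc (of_nat n) (h \<mu> \<nu>)" b \<alpha>]
      conv_count_left[of "\<lambda>n \<mu> \<nu>. sc (of_nat n) (h \<nu> \<mu>)" b \<alpha>] by (simp del: of_nat_Suc)
  also have "conv (\<lambda>\<mu> \<nu>. sc (of_nat (Suc (count \<mu> b))) (h \<nu> (add_mset b \<mu>))) \<alpha>
      = conv (\<lambda>\<mu> \<nu>. sc (of_nat (Suc (count \<nu> b))) (h \<mu> (add_mset b \<nu>))) \<alpha>"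
    by (rule conv_commute)
  finally show ?thesis .
qed

definition hp :: "'g \<Rightarrow> ('g, 'k) hom_formal \<Rightarrow> ('g, 'k) hom_formal" where
  "hp b f \<alpha> \<xi> = pd b (\<lambda>\<mu>. f \<mu> \<xi>) \<alpha>"

abbreviation dz :: "'g \<Rightarrow> ('g, 'g) formal \<Rightarrow> 'g multiset \<Rightarrow> 'g" where
  "dz z f \<equiv> fdiff sc B f (coad_field sc br B z)"

lemma hp_eq: "hp b f \<alpha> \<xi> = sc (of_nat (Suc (count \<alpha> b))) (f (add_mset b \<alpha>) \<xi>)"
  by (simp add: hp_def fpartial_def)

lemma hp_skew: "(\<And>\<alpha>. f \<alpha> \<in> SK) \<Longrightarrow> hp b f \<alpha> \<in> SK"
  using skew_scale_closed[of "f (add_mset b \<alpha>)" "of_nat (Suc (count \<alpha> b))"]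
  by (simp add: fun_scale_def hp_eq[abs_def] del: of_nat_Suc)

definition tt :: "'g \<Rightarrow> (('g \<Rightarrow> 'k) \<Rightarrow> 'g) \<Rightarrow> ('g \<Rightarrow> 'k) \<Rightarrow> 'g" where
  "tt y t \<xi> = br y (t \<xi>) + t (\<xi> \<circ> br y)"

lemma Top_conv: "\<xi> \<in> D \<Longrightarrow> Top S f \<alpha> \<xi> = conv (\<lambda>\<mu> \<nu>. tt (S \<mu>) (f \<nu>) \<xi>) \<alpha>"
  by (simp add: Top_eq Lop_apply Rop_apply tt_def conv_add)

lemma tt_add_left: "lin t \<Longrightarrow> \<xi> \<in> D \<Longrightarrow> tt (x + y) t \<xi> = tt x t \<xi> + tt y t \<xi>"
  by (simp add: tt_def br_add_left comp_br_add lin_add dual_closed del: o_apply)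

lemma tt_scale_left: "lin t \<Longrightarrow> \<xi> \<in> D \<Longrightarrow> tt (sc c x) t \<xi> = sc c (tt x t \<xi>)"
  by (simp add: tt_def br_scale_left comp_br_scale lin_scale dual_closed scale_right_distrib del: o_apply)

lemma tt_zero_left: "lin t \<Longrightarrow> \<xi> \<in> D \<Longrightarrow> tt 0 t \<xi> = 0"
  using tt_scale_left[of t \<xi> 0 0] by simp

lemma tt_conv_left: "lin t \<Longrightarrow> \<xi> \<in> D \<Longrightarrow> tt (conv h \<alpha>) t \<xi> = conv (\<lambda>\<mu> \<nu>. tt (h \<mu> \<nu>) t \<xi>) \<alpha>"
  by (rule conv_hom[where f = "\<lambda>x. tt x t \<xi>"]) (simp_all add: tt_zero_left tt_add_left)

lemma tt_scale_right: "tt x (\<lambda>\<xi>. sc c (t \<xi>)) \<xi> = sc c (tt x t \<xi>)"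
  by (simp add: tt_def br_scale_right scale_right_distrib)

lemma tt_conv_right: "tt x (\<lambda>\<xi>. conv (\<lambda>\<mu> \<nu>. h \<mu> \<nu> \<xi>) \<alpha>) \<xi> = conv (\<lambda>\<mu> \<nu>. tt x (h \<mu> \<nu>) \<xi>) \<alpha>"
  by (simp add: tt_def br_conv_right conv_add)

lemma tt_sum_right: "tt x (\<lambda>\<xi>. \<Sum>i\<in>I. h i \<xi>) \<xi> = (\<Sum>i\<in>I. tt x (h i) \<xi>)"
  by (simp add: tt_def br_right.sum sum.distrib)

lemma tt_sum_left: "lin t \<Longrightarrow> \<xi> \<in> D \<Longrightarrow> tt (sum h I) t \<xi> = (\<Sum>i\<in>I. tt (h i) t \<xi>)"
  by (rule sum_hom_on[where V = UNIV and f = "\<lambda>x. tt x t \<xi>"]) (simp_all add: tt_zero_left tt_add_left)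

lemma hp_Top:
  assumes "linF f" "\<xi> \<in> D"
  shows "hp b (Top S f) \<alpha> \<xi> = conv (\<lambda>\<mu> \<nu>. tt (pd b S \<mu>) (f \<nu>) \<xi>) \<alpha>
                           + conv (\<lambda>\<mu> \<nu>. tt (S \<mu>) (hp b f \<nu>) \<xi>) \<alpha>"
  using assms
  by (simp add: hp_eq[abs_def] Top_conv sc_Leibniz fpartial_def linF_D tt_scale_left tt_scale_right del: of_nat_Suc)

lemma feval_dest: "\<mu> \<noteq> {#} \<Longrightarrow> v \<in> \<ll> \<Longrightarrow> c \<in> B \<Longrightarrow> coord v (add_mset c \<mu>) = 0"
  by (auto simp: feval_eq)

lemma feval_single: "v \<in> \<ll> \<Longrightarrow> c \<in> B \<Longrightarrow> coord v {#c#} = e c v"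
proof -
  assume "v \<in> \<ll>" "c \<in> B"
  then have "coord v {#c#} = (\<Sum>b\<in>B. if b = c then e b v else 0)"
    unfolding feval_eq[OF \<open>v \<in> \<ll>\<close>] by (intro sum.cong) auto
  with \<open>c \<in> B\<close> show ?thesis by simp
qed

lemma feval_uminus: "v \<in> \<ll> \<Longrightarrow> coord (- v) \<alpha> = - coord v \<alpha>"
  using sub_\<ll> by (simp add: feval_eq subspace_neg dual_minus[OF e_dual] sum_negf[symmetric] if_distrib cong: if_cong)

lemma dz_eq: "dz z f \<alpha> = (\<Sum>b\<in>B. conv (\<lambda>\<mu> \<nu>. sc (coord (br z b) \<mu>) (pd b f \<nu>)) \<alpha>)"
  by (simp add: fdiff_def fprod_conv coad_field_def)

text \<open>Differentiation along the coadjoint vector field is a derivation of the product that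
  defines \<open>Top\<close>.\<close>

lemma dz_Top:
  assumes "linF f" "\<xi> \<in> D"
  shows "dz z (\<lambda>\<mu>. Top S f \<mu> \<xi>) \<alpha> = conv (\<lambda>\<mu> \<nu>. tt (dz z S \<mu>) (f \<nu>) \<xi>) \<alpha>
       + conv (\<lambda>\<mu> \<nu>. tt (S \<mu>) (\<lambda>\<eta>. dz z (\<lambda>\<mu>. f \<mu> \<eta>) \<nu>) \<xi>) \<alpha>"
proof -
  let ?p = "\<lambda>b. coord (br z b)"
  have "dz z (\<lambda>\<mu>. Top S f \<mu> \<xi>) \<alpha>
     = (\<Sum>b\<in>B. convr (\<lambda>\<mu> \<rho> \<tau>. sc (?p b \<mu>) (tt (pd b S \<rho>) (f \<tau>) \<xi>)) \<alpha>
       + convr (\<lambda>\<mu> \<rho> \<tau>. sc (?p b \<mu>) (tt (S \<rho>) (hp b f \<tau>) \<xi>)) \<alpha>)"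
    using hp_Top[OF assms] by (simp add: dz_eq hp_def[symmetric] scale_right_distrib conv_add sc_conv)
  also have "\<dots> = (\<Sum>b\<in>B. conv (\<lambda>\<mu> \<nu>. tt (conv (\<lambda>\<rho> \<tau>. sc (?p b \<rho>) (pd b S \<tau>)) \<mu>) (f \<nu>) \<xi>) \<alpha>)
       + (\<Sum>b\<in>B. convr (\<lambda>\<mu> \<rho> \<tau>. sc (?p b \<rho>) (tt (S \<mu>) (hp b f \<tau>) \<xi>)) \<alpha>)"
    unfolding sum.distrib conv_assoc[of "\<lambda>\<mu> \<rho> \<tau>. sc (?p b \<mu>) (tt (pd b S \<rho>) (f \<tau>) \<xi>)" for b]
      conv_left_commute[of "\<lambda>\<mu> \<rho> \<tau>. sc (?p b \<mu>) (tt (S \<rho>) (hp b f \<tau>) \<xi>)" for b]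
    using assms by (simp add: tt_conv_left linF_D tt_scale_left)
  also have "\<dots> = conv (\<lambda>\<mu> \<nu>. tt (dz z S \<mu>) (f \<nu>) \<xi>) \<alpha>
       + conv (\<lambda>\<mu> \<nu>. tt (S \<mu>) (\<lambda>\<eta>. dz z (\<lambda>\<mu>. f \<mu> \<eta>) \<nu>) \<xi>) \<alpha>"
    using assms by (simp add: dz_eq tt_sum_left linF_D conv_sum hp_def[symmetric] tt_sum_right tt_conv_right tt_scale_right)
  finally show ?thesis .
qed


section \<open>Equivariance\<close>

definition equivariant :: "('g, 'g) formal \<Rightarrow> bool" where
  "equivariant S \<longleftrightarrow> (\<forall>z\<in>\<ll>. \<forall>\<alpha>. dz z S \<alpha> = - br z (S \<alpha>))"

definition invariant :: "('g, 'k) hom_formal \<Rightarrow> bool" where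
  "invariant f \<longleftrightarrow> (\<forall>z\<in>\<ll>. \<forall>\<xi>\<in>D. \<forall>\<alpha>. dz z (\<lambda>\<mu>. f \<mu> \<xi>) \<alpha> + br z (f \<alpha> \<xi>) + f \<alpha> (\<xi> \<circ> br z) = 0)"

lemma equivariantD: "equivariant S \<Longrightarrow> z \<in> \<ll> \<Longrightarrow> dz z S \<alpha> = - br z (S \<alpha>)"
  by (simp add: equivariant_def)

lemma invariantD: "invariant f \<Longrightarrow> z \<in> \<ll> \<Longrightarrow> \<xi> \<in> D \<Longrightarrow>
    dz z (\<lambda>\<mu>. f \<mu> \<xi>) \<alpha> = - br z (f \<alpha> \<xi>) - f \<alpha> (\<xi> \<circ> br z)"
  by (simp add: invariant_def eq_neg_iff_add_eq_0 algebra_simps del: o_apply)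

lemma invariantI:
  assumes "\<And>z \<xi> \<alpha>. z \<in> \<ll> \<Longrightarrow> \<xi> \<in> D \<Longrightarrow> dz z (\<lambda>\<mu>. f \<mu> \<xi>) \<alpha> = - br z (f \<alpha> \<xi>) - f \<alpha> (\<xi> \<circ> br z)"
  shows "invariant f"
  using assms by (simp add: invariant_def del: o_apply)

text \<open>Equivariance at \<open>z = b\<close>, read backwards as a formula for the bracket of
  \<open>S\<close> with a basis vector of \<open>\<ll>\<close> in terms of derivatives of
  \<open>S\<close>.\<close>

lemma ad_equivariant:
  assumes "equivariant S" "b \<in> B"
  shows "br (S \<alpha>) b = (\<Sum>c\<in>B. conv (\<lambda>\<mu> \<nu>. sc (coord (br b c) \<mu>) (pd c S \<nu>)) \<alpha>)"
  using equivariantD[OF assms(1) B_\<ll>[OF assms(2)], of \<alpha>] by (simp add: br_anti[of "S \<alpha>"] dz_eq)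

text \<open>Both sides are obtained by inserting the formula for \<open>[\<Sigma>, b]\<close> that equivariance provides;
  they match because \<open>[b, c] = - [c, b]\<close>.\<close>

lemma Rop_vop:
  assumes "equivariant S"
  shows "Rop S (vop S) = - Lop S (qop S)"
proof (intro ext)
  fix \<alpha> \<xi>
  show "Rop S (vop S) \<alpha> \<xi> = (- Lop S (qop S)) \<alpha> \<xi>"
  proof (cases "\<xi> \<in> D")
    case True
    define x where "x b = pd b S" for b
    define p where "p b c = coord (br b c)" for b c
    define K where "K b c = convl (\<lambda>\<rho> \<tau> \<nu>. sc (p b c \<rho> * \<xi> (x c \<tau>)) (x b \<nu>)) \<alpha>" for b c
    have K': "convl (\<lambda>\<rho> \<tau> \<nu>. sc (p b c \<rho> * \<xi> (x b \<nu>)) (x c \<tau>)) \<alpha> = - K c b"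
      if "b \<in> B" "c \<in> B" for b c
    proof -
      have p: "p b c \<rho> = - p c b \<rho>" for \<rho>
        unfolding p_def using that by (subst br_anti) (simp add: feval_uminus br_\<ll> B_\<ll>)
      have "convl (\<lambda>\<rho> \<tau> \<nu>. sc (p b c \<rho> * \<xi> (x b \<nu>)) (x c \<tau>)) \<alpha>
          = convr (\<lambda>\<mu> \<rho> \<tau>. sc (p b c \<mu> * \<xi> (x b \<tau>)) (x c \<rho>)) \<alpha>"
        by (rule conv_assoc[symmetric])
      also have "\<dots> = convr (\<lambda>\<mu> \<rho> \<tau>. sc (p b c \<mu> * \<xi> (x b \<rho>)) (x c \<tau>)) \<alpha>"
        by (subst (2) conv_commute) simp
      also have "\<dots> = convl (\<lambda>\<rho> \<tau> \<nu>. sc (p b c \<rho> * \<xi> (x b \<tau>)) (x c \<nu>)) \<alpha>"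
        by (rule conv_assoc)
      finally show ?thesis unfolding K_def p by (simp add: conv_minus)
    qed
    have "Rop S (vop S) \<alpha> \<xi> = (\<Sum>b\<in>B. conv (\<lambda>\<mu> \<nu>. sc (\<xi> (br (S \<mu>) b)) (x b \<nu>)) \<alpha>)"
      using True by (simp add: Rop_apply vop_def dual_closed conv_sum x_def)
    also have "\<dots> = (\<Sum>b\<in>B. \<Sum>c\<in>B. K b c)"
    proof (rule sum.cong[OF refl])
      fix b assume "b \<in> B"
      have "sc (\<xi> (br (S \<mu>) b)) y = (\<Sum>c\<in>B. conv (\<lambda>\<rho> \<tau>. sc (p b c \<rho> * \<xi> (x c \<tau>)) y) \<mu>)" for \<mu> y
      proof -
        have "sc (conv h \<mu>) y = conv (\<lambda>\<rho> \<tau>. sc (h \<rho> \<tau>) y) \<mu>" for h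
          by (rule conv_hom[where f = "\<lambda>c. sc c y"]) (simp_all add: scale_left_distrib)
        then show ?thesis
          using True \<open>b \<in> B\<close> assms by (simp add: ad_equivariant dual_simps dual_conv scale_sum_left p_def x_def)
      qed
      then show "conv (\<lambda>\<mu> \<nu>. sc (\<xi> (br (S \<mu>) b)) (x b \<nu>)) \<alpha> = (\<Sum>c\<in>B. K b c)"
        by (simp add: conv_sum K_def)
    qed
    also have "\<dots> = (\<Sum>c\<in>B. \<Sum>b\<in>B. K b c)" by (rule sum.swap)
    also have "\<dots> = - Lop S (qop S) \<alpha> \<xi>"
    proof -
      have "Lop S (qop S) \<alpha> \<xi> = (\<Sum>b\<in>B. conv (\<lambda>\<mu> \<nu>. sc (\<xi> (x b \<nu>)) (br (S \<mu>) b)) \<alpha>)"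
        using True by (simp add: Lop_apply qop_def br_right.sum br_scale_right conv_sum x_def)
      also have "\<dots> = (\<Sum>b\<in>B. \<Sum>c\<in>B. - K c b)"
      proof (rule sum.cong[OF refl])
        fix b assume b: "b \<in> B"
        have "sc a (br (S \<mu>) b) = (\<Sum>c\<in>B. conv (\<lambda>\<rho> \<tau>. sc (p b c \<rho> * a) (x c \<tau>)) \<mu>)" for \<mu> a
          using b assms by (simp add: ad_equivariant scale_sum_right sc_conv p_def x_def mult.commute)
        then show "conv (\<lambda>\<mu> \<nu>. sc (\<xi> (x b \<nu>)) (br (S \<mu>) b)) \<alpha> = (\<Sum>c\<in>B. - K c b)"
          using b by (simp add: conv_sum K')
      qed
      finally show ?thesis by (simp add: sum_negf)
    qed
    finally show ?thesis by simp
  qed (simp add: Lop_def Rop_def)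
qed

lemma invariant_add: "invariant f \<Longrightarrow> invariant g \<Longrightarrow> invariant (f + g)"
proof (rule invariantI)
  fix z \<xi> \<alpha> assume "invariant f" "invariant g" "z \<in> \<ll>" "\<xi> \<in> D"
  moreover have "dz z (\<lambda>\<mu>. (f + g) \<mu> \<xi>) \<alpha> = dz z (\<lambda>\<mu>. f \<mu> \<xi>) \<alpha> + dz z (\<lambda>\<mu>. g \<mu> \<xi>) \<alpha>"
    by (simp add: dz_eq fpartial_def scale_right_distrib conv_add sum.distrib)
  ultimately show "dz z (\<lambda>\<mu>. (f + g) \<mu> \<xi>) \<alpha> = - br z ((f + g) \<alpha> \<xi>) - (f + g) \<alpha> (\<xi> \<circ> br z)"
    by (simp add: invariantD br_add_right)
qed

lemma dz_scale: "dz z (\<lambda>\<mu>. sc c (f \<mu>)) \<alpha> = sc c (dz z f \<alpha>)"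
  by (simp add: dz_eq fpartial_def sc_conv scale_sum_right mult_ac)

lemma invariant_scale: "invariant f \<Longrightarrow> invariant (hs c f)"
  by (rule invariantI) (simp add: hs_apply dz_scale invariantD br_scale_right scale_right_diff_distrib)

lemma invariant_minus: "invariant f \<Longrightarrow> invariant (- f)"
  using invariant_scale[of f "-1"] by (simp add: fun_scale_def fun_Compl_def)

lemma lin_uminus: "lin t \<Longrightarrow> \<xi> \<in> D \<Longrightarrow> t (- \<xi>) = - t \<xi>"
  using lin_scale[of t \<xi> "-1"] by (simp add: fun_scale_def fun_Compl_def)

lemma lin_diff: "lin t \<Longrightarrow> \<xi> \<in> D \<Longrightarrow> \<eta> \<in> D \<Longrightarrow> t (\<xi> - \<eta>) = t \<xi> - t \<eta>"
  using lin_add[of t \<xi> "- \<eta>"] lin_uminus[of t \<eta>] by (simp add: dual_closed)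

text \<open>Equivariance and invariance replace the derivatives by brackets; what remains cancels in
  each splitting separately by the Jacobi identity.\<close>

lemma invariant_Top:
  assumes "linF f" "invariant f" "equivariant S"
  shows "invariant (Top S f)"
proof (rule invariantI)
  fix z \<xi> \<alpha> assume z: "z \<in> \<ll>" and \<xi>: "\<xi> \<in> D"
  have d: "dz z (\<lambda>\<mu>. f \<mu> \<eta>) \<nu> = - br z (f \<nu> \<eta>) - f \<nu> (\<eta> \<circ> br z)" if "\<eta> \<in> D" for \<eta> \<nu>
    using invariantD[OF assms(2) z that] .
  have "dz z (\<lambda>\<mu>. Top S f \<mu> \<xi>) \<alpha> + br z (Top S f \<alpha> \<xi>) + Top S f \<alpha> (\<xi> \<circ> br z) = 0"
    unfolding dz_Top[OF assms(1) \<xi>]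
    unfolding Top_conv[OF \<xi>] Top_conv[OF dual_closed(1)[OF \<xi>]] br_conv_right
      conv_add[symmetric]
  proof (rule conv_eq_0)
    fix \<mu> \<nu>
    show "tt (dz z S \<mu>) (f \<nu>) \<xi> + tt (S \<mu>) (\<lambda>\<eta>. dz z (\<lambda>\<mu>. f \<mu> \<eta>) \<nu>) \<xi> + br z (tt (S \<mu>) (f \<nu>) \<xi>) + tt (S \<mu>) (f \<nu>) (\<xi> \<circ> br z) = 0"
      using jacobi'[of z "S \<mu>" "f \<nu> \<xi>"] z \<xi> assms(1)
      by (simp add: tt_def d dual_closed equivariantD[OF assms(3)] br_left.minus br_right.minus br_right.diff br_add_right
          comp_br_minus comp_br_br linF_D lin_uminus lin_diff algebra_simps del: o_apply)
  qed
  then show "dz z (\<lambda>\<mu>. Top S f \<mu> \<xi>) \<alpha> = - br z (Top S f \<alpha> \<xi>) - Top S f \<alpha> (\<xi> \<circ> br z)"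
    by (simp add: eq_neg_iff_add_eq_0 algebra_simps del: o_apply)
qed

lemma fpartial_commute: "pd b (pd c f) = pd c (pd b f)"
  by (rule ext, cases "b = c") (simp_all add: fpartial_def add_mset_commute mult.commute del: of_nat_Suc)

text \<open>The partial derivative of the equivariance equation. The additional sum arises because
  the coefficients of the coadjoint field depend on p as well.\<close>

lemma dz_fpartial:
  assumes "equivariant S" "z \<in> \<ll>" "c \<in> B"
  shows "dz z (pd c S) \<alpha> = - br z (pd c S \<alpha>) - (\<Sum>b\<in>B. sc (e c (br z b)) (pd b S \<alpha>))"
proof -
  let ?p = "\<lambda>b. coord (br z b)" and ?x = "\<lambda>b. pd b S"
  have "(\<Sum>b\<in>B. sc (of_nat (Suc (count \<alpha> c))) (conv (\<lambda>\<mu> \<nu>. sc (?p b \<mu>) (?x b \<nu>)) (add_mset c \<alpha>)))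
      = sc (of_nat (Suc (count \<alpha> c))) (dz z S (add_mset c \<alpha>))"
    by (simp add: dz_eq scale_sum_right)
  also have "\<dots> = - br z (?x c \<alpha>)"
    using assms by (simp add: equivariantD fpartial_def br_scale_right del: of_nat_Suc)
  also have "(\<Sum>b\<in>B. sc (of_nat (Suc (count \<alpha> c))) (conv (\<lambda>\<mu> \<nu>. sc (?p b \<mu>) (?x b \<nu>)) (add_mset c \<alpha>)))
      = (\<Sum>b\<in>B. sc (e c (br z b)) (?x b \<alpha>)) + (\<Sum>b\<in>B. conv (\<lambda>\<mu> \<nu>. sc (?p b \<mu>) (pd b (?x c) \<nu>)) \<alpha>)"
    unfolding sum.distrib[symmetric]
  proof (rule sum.cong[OF refl])
    fix b assume b: "b \<in> B"
    then have zb: "br z b \<in> \<ll>" using assms by (simp add: br_\<ll> B_\<ll>)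
    \<comment> \<open>These coefficients are linear in p, so their derivative is the constant
      \<open>e c (br z b)\<close>.\<close>
    have "conv (\<lambda>\<mu> \<nu>. sc (of_nat (Suc (count \<mu> c))) (sc (?p b (add_mset c \<mu>)) (?x b \<nu>))) \<alpha>
        = conv (\<lambda>\<mu> \<nu>. if \<mu> = {#} then sc (e c (br z b)) (?x b \<nu>) else 0) \<alpha>"
      by (rule conv_cong) (use zb assms in \<open>auto simp: feval_dest feval_single\<close>)
    moreover have "sc (of_nat (Suc (count \<nu> c))) (?x b (add_mset c \<nu>)) = pd b (?x c) \<nu>" for \<nu>
      unfolding fpartial_commute[of b c] by (simp add: fpartial_def)
    then have "sc (of_nat (Suc (count \<nu> c))) (sc (?p b \<mu>) (?x b (add_mset c \<nu>))) = sc (?p b \<mu>) (pd b (?x c) \<nu>)" for \<mu> \<nu>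
      by (metis scale_left_commute)
    ultimately show "sc (of_nat (Suc (count \<alpha> c))) (conv (\<lambda>\<mu> \<nu>. sc (?p b \<mu>) (?x b \<nu>)) (add_mset c \<alpha>))
        = sc (e c (br z b)) (?x b \<alpha>) + conv (\<lambda>\<mu> \<nu>. sc (?p b \<mu>) (pd b (?x c) \<nu>)) \<alpha>"
      by (simp only: sc_Leibniz conv_const_left)
  qed
  finally show ?thesis by (simp add: dz_eq algebra_simps)
qed

lemma sum_pairing_e: "\<xi> \<in> D \<Longrightarrow> y \<in> \<ll> \<Longrightarrow> (\<Sum>c\<in>B. \<xi> c * e c y) = \<xi> y"
  using arg_cong[OF sum_e, of y \<xi>] by (simp add: dual_simps mult.commute)

lemma dz_sum: "dz z (\<lambda>\<mu>. \<Sum>i\<in>I. f i \<mu>) \<alpha> = (\<Sum>i\<in>I. dz z (f i) \<alpha>)"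
proof -
  have "dz z (\<lambda>\<mu>. \<Sum>i\<in>I. f i \<mu>) \<alpha> = (\<Sum>b\<in>B. \<Sum>i\<in>I. conv (\<lambda>\<mu> \<nu>. sc (coord (br z b) \<mu>) (pd b (f i) \<nu>)) \<alpha>)"
    by (simp add: dz_eq fpartial_def scale_sum_right conv_sum)
  then show ?thesis unfolding dz_eq by (subst sum.swap)
qed

lemma dz_map:
  assumes "\<And>x y. h (x + y) = h x + h y" "\<And>c x. h (sc c x) = sc c (h x)"
  shows "dz z (\<lambda>\<mu>. h (f \<mu>)) \<alpha> = h (dz z f \<alpha>)"
proof -
  have h0: "h 0 = 0" using assms(2)[of 0 0] by simp
  have "h (sum g A) = (\<Sum>a\<in>A. h (g a))" for g :: "'g \<Rightarrow> 'g" and A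
    by (rule sum_hom_on[where V = UNIV]) (simp_all add: h0 assms)
  then show ?thesis
    by (simp add: dz_eq fpartial_def assms conv_hom[where f = h, OF h0 assms(1)])
qed

lemma invariant_vop:
  assumes "equivariant S"
  shows "invariant (vop S)"
proof (rule invariantI)
  fix z \<xi> \<alpha> assume z: "z \<in> \<ll>" and \<xi>: "\<xi> \<in> D"
  let ?x = "\<lambda>b. pd b S \<alpha>"
  have "dz z (\<lambda>\<mu>. vop S \<mu> \<xi>) \<alpha> = (\<Sum>c\<in>B. sc (\<xi> c) (- br z (?x c) - (\<Sum>b\<in>B. sc (e c (br z b)) (?x b))))"
    using \<xi> z assms by (simp add: vop_def dz_sum dz_scale dz_fpartial)
  also have "\<dots> = - br z (vop S \<alpha> \<xi>) - (\<Sum>c\<in>B. \<Sum>b\<in>B. sc (\<xi> c * e c (br z b)) (?x b))"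
    using \<xi> by (simp add: vop_def br_right.sum br_scale_right scale_right_diff_distrib sum_subtractf sum_negf scale_sum_right)
  also have "(\<Sum>c\<in>B. \<Sum>b\<in>B. sc (\<xi> c * e c (br z b)) (?x b)) = vop S \<alpha> (\<xi> \<circ> br z)"
    using \<xi> z by (subst sum.swap) (simp add: vop_def dual_closed sum_pairing_e br_\<ll> B_\<ll> flip: scale_sum_left)
  finally show "dz z (\<lambda>\<mu>. vop S \<mu> \<xi>) \<alpha> = - br z (vop S \<alpha> \<xi>) - vop S \<alpha> (\<xi> \<circ> br z)" .
qed

lemma invariant_qop:
  assumes "equivariant S"
  shows "invariant (qop S)"
proof (rule invariantI)
  fix z \<xi> \<alpha> assume z: "z \<in> \<ll>" and \<xi>: "\<xi> \<in> D"
  let ?x = "\<lambda>b. pd b S \<alpha>"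
  have "dz z (\<lambda>\<mu>. sc (\<xi> (pd c S \<mu>)) c) \<alpha> = sc (\<xi> (dz z (pd c S) \<alpha>)) c" for c
    using \<xi> by (intro dz_map) (simp_all add: dual_simps scale_left_distrib)
  then have "dz z (\<lambda>\<mu>. qop S \<mu> \<xi>) \<alpha> = (\<Sum>c\<in>B. sc (\<xi> (- br z (?x c) - (\<Sum>b\<in>B. sc (e c (br z b)) (?x b)))) c)"
    using \<xi> z assms by (simp add: qop_def dz_sum dz_fpartial)
  also have "\<dots> = - qop S \<alpha> (\<xi> \<circ> br z) - (\<Sum>c\<in>B. \<Sum>b\<in>B. sc (\<xi> (?x b)) (sc (e c (br z b)) c))"
    using \<xi> by (simp add: qop_def dual_closed dual_simps scale_left_diff_distrib sum_subtractf sum_negf scale_sum_left mult.commute)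
  also have "(\<Sum>c\<in>B. \<Sum>b\<in>B. sc (\<xi> (?x b)) (sc (e c (br z b)) c)) = br z (qop S \<alpha> \<xi>)"
    using \<xi> z by (subst sum.swap) (simp add: qop_def br_right.sum br_scale_right sum_e br_\<ll> B_\<ll> flip: scale_sum_right del: scale_scale)
  finally show "dz z (\<lambda>\<mu>. qop S \<mu> \<xi>) \<alpha> = - br z (qop S \<alpha> \<xi>) - qop S \<alpha> (\<xi> \<circ> br z)"
    by (simp only: diff_conv_add_uminus add.commute)
qed

text \<open>For \<open>z\<close> in \<open>\<ll>\<close> the terms of the cocycle identity
  containing \<open>\<omega> z\<close> disappear, and it becomes \<ll>-equivariance of
  \<open>\<omega>\<close>.\<close>

lemma invariant_\<omega>:
  assumes "equivariant S"
  shows "invariant (\<lambda>\<alpha>. \<omega> (S \<alpha>))"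
proof (rule invariantI)
  fix z \<xi> \<alpha> assume z: "z \<in> \<ll>" and \<xi>: "\<xi> \<in> D"
  have "dz z (\<lambda>\<mu>. \<omega> (S \<mu>) \<xi>) \<alpha> = \<omega> (dz z S \<alpha>) \<xi>"
    by (rule dz_map[where h = "\<lambda>x. \<omega> x \<xi>"]) (simp_all add: \<omega>_add \<omega>_scale)
  then show "dz z (\<lambda>\<mu>. \<omega> (S \<mu>) \<xi>) \<alpha> = - br z (\<omega> (S \<alpha>) \<xi>) - \<omega> (S \<alpha>) (\<xi> \<circ> br z)"
    using z \<xi> assms by (simp add: equivariantD \<omega>_minus \<omega>_cocycle \<omega>_\<ll> br_right.zero del: o_apply)
qed

lemma invariant_uop: "equivariant S \<Longrightarrow> invariant (uop S)"
  using invariant_add[OF invariant_add[OF invariant_vop invariant_minus[OF invariant_qop]] invariant_\<omega>]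
  by (simp add: uop_def)


section \<open>The dynamical equation along a gauge flow\<close>

text \<open>The dynamical equation reads \<open>Lin l + Quad l l + Con = 0\<close> (see
  \<open>Dynl_iff\<close>). Sorting it by degree in \<open>l\<close>, with two separate arguments in
  \<open>Quad\<close>, makes it possible to substitute a power series in the flow time.\<close>

definition Lin :: "('g, 'k) hom_formal \<Rightarrow> 'g multiset \<Rightarrow> ('g, 'k) trilinear" where
  "Lin f \<alpha> = cyc (\<lambda>\<xi> \<eta> \<zeta>. (\<Sum>b\<in>B. \<xi> b * \<zeta> (hp b f \<alpha> \<eta>)) - \<zeta> (\<omega> (f \<alpha> \<xi>) \<eta>))"

definition Quad :: "('g, 'k) hom_formal \<Rightarrow> ('g, 'k) hom_formal \<Rightarrow>
    'g multiset \<Rightarrow> ('g, 'k) trilinear" where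
  "Quad f g \<alpha> = cyc (\<lambda>\<xi> \<eta> \<zeta>. - conv (\<lambda>\<mu> \<nu>. \<zeta> (br (f \<mu> \<xi>) (g \<nu> \<eta>))) \<alpha>)"

definition Con :: "'g multiset \<Rightarrow> ('g, 'k) trilinear" where
  "Con \<alpha> \<xi> \<eta> \<zeta> = - fconst (\<zeta> (\<phi> \<xi> \<eta>)) \<alpha>"

definition ad3 :: "('g, 'g) formal \<Rightarrow> ('g multiset \<Rightarrow> ('g, 'k) trilinear) \<Rightarrow>
    'g multiset \<Rightarrow> ('g, 'k) trilinear" where
  "ad3 S M \<alpha> \<xi> \<eta> \<zeta> = conv (\<lambda>\<mu> \<nu>. M \<nu> (\<xi> \<circ> br (S \<mu>)) \<eta> \<zeta> + M \<nu> \<xi> (\<eta> \<circ> br (S \<mu>)) \<zeta> + M \<nu> \<xi> \<eta> (\<zeta> \<circ> br (S \<mu>))) \<alpha>"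

lemma ad3_cyc: "ad3 S (\<lambda>\<alpha>. cyc (M \<alpha>)) \<alpha> = cyc (ad3 S M \<alpha>)"
  by (intro ext) (simp add: ad3_def cyc_def conv_add[symmetric] algebra_simps del: o_apply)

lemma cyc_eqI:
  assumes "\<And>\<xi> \<eta> \<zeta>. \<xi> \<in> D \<Longrightarrow> \<eta> \<in> D \<Longrightarrow> \<zeta> \<in> D \<Longrightarrow> F \<xi> \<eta> \<zeta> = G \<xi> \<eta> \<zeta>" "\<xi> \<in> D" "\<eta> \<in> D" "\<zeta> \<in> D"
  shows "cyc F \<xi> \<eta> \<zeta> = cyc G \<xi> \<eta> \<zeta>"
  using assms by (simp add: cyc_def)

lemma cyc_add: "cyc (\<lambda>\<xi> \<eta> \<zeta>. F \<xi> \<eta> \<zeta> + G \<xi> \<eta> \<zeta>) \<xi> \<eta> \<zeta> = cyc F \<xi> \<eta> \<zeta> + cyc G \<xi> \<eta> \<zeta>"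
  by (simp add: cyc_def algebra_simps)

lemma cyc_conv: "cyc (\<lambda>\<xi> \<eta> \<zeta>. conv (\<lambda>\<mu> \<nu>. F \<mu> \<nu> \<xi> \<eta> \<zeta>) \<alpha>) \<xi> \<eta> \<zeta> = conv (\<lambda>\<mu> \<nu>. cyc (F \<mu> \<nu>) \<xi> \<eta> \<zeta>) \<alpha>"
  by (simp add: cyc_def conv_add)

lemma mult_conv: "(c :: 'k) * conv h \<alpha> = conv (\<lambda>\<mu> \<nu>. c * h \<mu> \<nu>) \<alpha>"
  by (rule conv_hom) (simp_all add: algebra_simps)

lemma conv_mult: "conv h \<alpha> * (c :: 'k) = conv (\<lambda>\<mu> \<nu>. h \<mu> \<nu> * c) \<alpha>"
  by (rule conv_hom[where f = "\<lambda>x. x * c"]) (simp_all add: algebra_simps)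

text \<open>The bracket is compatible with the adjoint action: by Jacobi, acting on the values of
  both factors is acting on the value of the bracket, that is, on the third argument.\<close>

lemma Quad_Top:
  assumes "linF f" "linF g" "\<xi> \<in> D" "\<eta> \<in> D" "\<zeta> \<in> D"
  shows "Quad (Top S f) g \<alpha> \<xi> \<eta> \<zeta> + Quad f (Top S g) \<alpha> \<xi> \<eta> \<zeta> = ad3 S (Quad f g) \<alpha> \<xi> \<eta> \<zeta>"
proof -
  define M where "M f g \<alpha> \<xi> \<eta> \<zeta> = - conv (\<lambda>\<mu> \<nu>. \<zeta> (br (f \<mu> \<xi>) (g \<nu> \<eta>))) \<alpha>"
    for f g :: "('g, 'k) hom_formal" and \<alpha> \<xi> \<eta> and \<zeta> :: "'g \<Rightarrow> 'k"
  have "M (Top S f) g \<alpha> \<xi> \<eta> \<zeta> + M f (Top S g) \<alpha> \<xi> \<eta> \<zeta> = ad3 S (M f g) \<alpha> \<xi> \<eta> \<zeta>"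
    if "\<xi> \<in> D" "\<eta> \<in> D" "\<zeta> \<in> D" for \<xi> \<eta> \<zeta>
  proof -
    have "M (Top S f) g \<alpha> \<xi> \<eta> \<zeta> = - convl (\<lambda>\<rho> \<tau> \<nu>. \<zeta> (br (tt (S \<rho>) (f \<tau>) \<xi>) (g \<nu> \<eta>))) \<alpha>"
      using that by (simp add: M_def Top_conv br_conv_left dual_conv)
    also have "\<dots> = - convr (\<lambda>\<mu> \<rho> \<tau>. \<zeta> (br (tt (S \<mu>) (f \<rho>) \<xi>) (g \<tau> \<eta>))) \<alpha>"
      by (simp add: conv_assoc[of "\<lambda>\<mu> \<rho> \<tau>. \<zeta> (br (tt (S \<mu>) (f \<rho>) \<xi>) (g \<tau> \<eta>))"])
    finally have 1: "M (Top S f) g \<alpha> \<xi> \<eta> \<zeta> = \<dots>" .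
    have "M f (Top S g) \<alpha> \<xi> \<eta> \<zeta> = - convr (\<lambda>\<mu> \<rho> \<tau>. \<zeta> (br (f \<mu> \<xi>) (tt (S \<rho>) (g \<tau>) \<eta>))) \<alpha>"
      using that by (simp add: M_def Top_conv br_conv_right dual_conv)
    also have "\<dots> = - convr (\<lambda>\<mu> \<rho> \<tau>. \<zeta> (br (f \<rho> \<xi>) (tt (S \<mu>) (g \<tau>) \<eta>))) \<alpha>"
      by (simp add: conv_left_commute[of "\<lambda>\<mu> \<rho> \<tau>. \<zeta> (br (f \<mu> \<xi>) (tt (S \<rho>) (g \<tau>) \<eta>))"])
    finally have 2: "M f (Top S g) \<alpha> \<xi> \<eta> \<zeta> = \<dots>" .
    have 3: "- \<zeta> (br (tt y t \<xi>) (s \<eta>)) + - \<zeta> (br (t \<xi>) (tt y s \<eta>))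
        = - \<zeta> (br (t (\<xi> \<circ> br y)) (s \<eta>)) + - \<zeta> (br (t \<xi>) (s (\<eta> \<circ> br y))) + - (\<zeta> \<circ> br y) (br (t \<xi>) (s \<eta>))" for y t s
      using arg_cong[OF jacobi'[of y "t \<xi>" "s \<eta>"], of \<zeta>] \<open>\<zeta> \<in> D\<close>
      by (simp add: tt_def br_add_left br_add_right dual_simps)
    show ?thesis
      unfolding 1 2
      unfolding ad3_def M_def conv_add[symmetric] conv_minus[symmetric] 3 ..
  qed
  then show ?thesis
    using assms unfolding Quad_def ad3_cyc M_def[symmetric] cyc_add[symmetric]
    by (intro cyc_eqI) auto
qed

text \<open>By skewness the part of \<open>tt\<close> acting on the argument of \<open>t\<close>
  becomes a bracket as well, paired with a rotated argument. Under the cyclic sum it is the mirrored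
  bracket, so \<open>tt\<close> accounts for both cross terms that \<open>Quad\<close>
  produces.\<close>

lemma cyc_tt:
  assumes "t \<in> SK" "\<xi> \<in> D" "\<eta> \<in> D" "\<zeta> \<in> D"
  shows "cyc (\<lambda>\<xi> \<eta> \<zeta>. \<zeta> (tt (s \<xi>) t \<eta>) - \<zeta> (br (s \<xi>) (t \<eta>)) - \<zeta> (br (t \<xi>) (s \<eta>))) \<xi> \<eta> \<zeta> = 0"
proof -
  have 1: "\<zeta> (t (\<eta> \<circ> br y)) = - \<eta> (br y (t \<zeta>))" if "\<eta> \<in> D" "\<zeta> \<in> D" for \<eta> \<zeta> y
    using skew_skew[OF assms(1) that(2) dual_closed(1)[OF that(1)]] by simp
  have 2: "\<zeta> (br (t \<xi>) (s \<eta>)) = - \<zeta> (br (s \<eta>) (t \<xi>))" if "\<zeta> \<in> D" for \<xi> \<eta> \<zeta>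
    using that by (subst br_anti) (simp add: dual_minus)
  show ?thesis
    using assms by (simp add: cyc_def tt_def dual_add 1 2 del: o_apply)
qed

text \<open>As in \<open>Rop_vop\<close>, now with one of the two factors differentiated along \<open>\<ll>\<close>.\<close>

lemma sum_ad_hp:
  assumes "equivariant S" "invariant f" "linF f" "\<xi> \<in> D" "\<eta> \<in> D" "\<zeta> \<in> D"
  shows "(\<Sum>b\<in>B. conv (\<lambda>\<mu> \<nu>. \<xi> (br (S \<mu>) b) * \<zeta> (hp b f \<nu> \<eta>)) \<alpha>)
       = conv (\<lambda>\<mu> \<nu>. \<zeta> (tt (qop S \<mu> \<xi>) (f \<nu>) \<eta>)) \<alpha>"
proof -
  define x where "x b \<mu> = \<xi> (pd b S \<mu>)" for b \<mu>
  define p where "p b c = coord (br b c)" for b c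
  define y where "y b \<nu> = \<zeta> (hp b f \<nu> \<eta>)" for b \<nu>
  have "conv (\<lambda>\<mu> \<nu>. \<zeta> (tt (qop S \<mu> \<xi>) (f \<nu>) \<eta>)) \<alpha>
      = (\<Sum>c\<in>B. conv (\<lambda>\<mu> \<nu>. x c \<mu> * \<zeta> (tt c (f \<nu>) \<eta>)) \<alpha>)"
    using assms by (simp add: qop_def tt_sum_left tt_scale_left linF_D dual_simps conv_sum x_def)
  also have "\<dots> = (\<Sum>c\<in>B. \<Sum>b\<in>B. - convr (\<lambda>\<mu> \<rho> \<tau>. x c \<mu> * (p c b \<rho> * y b \<tau>)) \<alpha>)"
  proof (rule sum.cong[OF refl])
    fix c assume "c \<in> B"
    have "\<zeta> (tt c (f \<nu>) \<eta>) = - \<zeta> (dz c (\<lambda>\<mu>. f \<mu> \<eta>) \<nu>)" for \<nu>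
      using invariantD[OF assms(2) B_\<ll>[OF \<open>c \<in> B\<close>] assms(5)] assms
      by (simp add: tt_def dual_simps del: o_apply)
    also have "- \<zeta> (dz c (\<lambda>\<mu>. f \<mu> \<eta>) \<nu>) = (\<Sum>b\<in>B. - conv (\<lambda>\<rho> \<tau>. p c b \<rho> * y b \<tau>) \<nu>)" for \<nu>
      using assms by (simp add: dz_eq dual_simps dual_conv p_def y_def hp_def[symmetric] sum_negf)
    finally show "conv (\<lambda>\<mu> \<nu>. x c \<mu> * \<zeta> (tt c (f \<nu>) \<eta>)) \<alpha>
        = (\<Sum>b\<in>B. - convr (\<lambda>\<mu> \<rho> \<tau>. x c \<mu> * (p c b \<rho> * y b \<tau>)) \<alpha>)"
      by (simp add: sum_distrib_left conv_sum conv_minus mult_conv)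
  qed
  also have "\<dots> = (\<Sum>c\<in>B. \<Sum>b\<in>B. convl (\<lambda>\<rho> \<tau> \<nu>. p b c \<rho> * x c \<tau> * y b \<nu>) \<alpha>)"
  proof (intro sum.cong refl)
    fix b c assume "b \<in> B" "c \<in> B"
    then have p: "p c b \<rho> = - p b c \<rho>" for \<rho>
      unfolding p_def by (subst br_anti) (simp add: feval_uminus br_\<ll> B_\<ll>)
    have "- convr (\<lambda>\<mu> \<rho> \<tau>. x c \<mu> * (p c b \<rho> * y b \<tau>)) \<alpha>
        = convr (\<lambda>\<mu> \<rho> \<tau>. p b c \<rho> * x c \<mu> * y b \<tau>) \<alpha>"
      by (simp add: p conv_minus mult_ac)
    also have "\<dots> = convr (\<lambda>\<mu> \<rho> \<tau>. p b c \<mu> * x c \<rho> * y b \<tau>) \<alpha>"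
      by (rule conv_left_commute)
    also have "\<dots> = convl (\<lambda>\<rho> \<tau> \<nu>. p b c \<rho> * x c \<tau> * y b \<nu>) \<alpha>"
      by (rule conv_assoc)
    finally show "- convr (\<lambda>\<mu> \<rho> \<tau>. x c \<mu> * (p c b \<rho> * y b \<tau>)) \<alpha> = \<dots>" .
  qed
  also have "\<dots> = (\<Sum>b\<in>B. \<Sum>c\<in>B. convl (\<lambda>\<rho> \<tau> \<nu>. p b c \<rho> * x c \<tau> * y b \<nu>) \<alpha>)"
    by (rule sum.swap)
  also have "\<dots> = (\<Sum>b\<in>B. conv (\<lambda>\<mu> \<nu>. \<xi> (br (S \<mu>) b) * \<zeta> (hp b f \<nu> \<eta>)) \<alpha>)"
    using assms by (intro sum.cong refl)
      (simp add: ad_equivariant dual_simps dual_conv sum_distrib_right conv_sum conv_mult x_def p_def y_def)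
  finally show ?thesis ..
qed

text \<open>\<open>Lin\<close> alone is not compatible with the action. The deviation
  \<open>G\<close> consists of the derivatives that fall on \<open>S\<close> and of a term from the
  cocycle identity; after cyclic summation two instances of \<open>cyc_tt\<close> cancel it against
  the cross terms of \<open>Quad\<close> with \<open>uop S\<close>.\<close>

lemma Lin_Top:
  assumes "equivariant S" "invariant f" "\<And>\<alpha>. f \<alpha> \<in> SK" "\<xi> \<in> D" "\<eta> \<in> D" "\<zeta> \<in> D"
  shows "Lin (Top S f) \<alpha> \<xi> \<eta> \<zeta> + Quad (uop S) f \<alpha> \<xi> \<eta> \<zeta> + Quad f (uop S) \<alpha> \<xi> \<eta> \<zeta> = ad3 S (Lin f) \<alpha> \<xi> \<eta> \<zeta>"
proof -
  have lf: "linF f" using assms(3) by (simp add: linF_def skew_lin)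
  define s where "s \<mu> \<xi> = vop S \<mu> \<xi> - qop S \<mu> \<xi>" for \<mu> \<xi>
  define M where "M \<alpha> \<xi> \<eta> \<zeta> = (\<Sum>b\<in>B. \<xi> b * \<zeta> (hp b f \<alpha> \<eta>)) - \<zeta> (\<omega> (f \<alpha> \<xi>) \<eta>)" for \<alpha> \<xi> \<eta> \<zeta>
  define G where "G \<alpha> \<xi> \<eta> \<zeta> = conv (\<lambda>\<mu> \<nu>. \<zeta> (tt (s \<mu> \<xi>) (f \<nu>) \<eta>) + \<zeta> (tt (f \<nu> \<xi>) (\<omega> (S \<mu>)) \<eta>)) \<alpha>"
    for \<alpha> \<xi> \<eta> and \<zeta> :: "'g \<Rightarrow> 'k"
  have "(\<Sum>b\<in>B. \<xi> b * \<zeta> (hp b (Top S f) \<alpha> \<eta>)) - \<zeta> (\<omega> (Top S f \<alpha> \<xi>) \<eta>) = ad3 S M \<alpha> \<xi> \<eta> \<zeta> + G \<alpha> \<xi> \<eta> \<zeta>"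
    if "\<xi> \<in> D" "\<eta> \<in> D" "\<zeta> \<in> D" for \<xi> \<eta> \<zeta>
  proof -
    have "(\<Sum>b\<in>B. \<xi> b * \<zeta> (hp b (Top S f) \<alpha> \<eta>))
        = conv (\<lambda>\<mu> \<nu>. \<zeta> (tt (vop S \<mu> \<xi>) (f \<nu>) \<eta>) + (\<Sum>b\<in>B. \<xi> b * \<zeta> (tt (S \<mu>) (hp b f \<nu>) \<eta>))) \<alpha>"
      using that lf by (simp add: hp_Top dual_simps dual_conv distrib_left mult_conv sum.distrib conv_add conv_sum
          vop_def tt_sum_left tt_scale_left linF_D)
    \<comment> \<open>Only \<open>vop S - qop S\<close> occurs in \<open>uop\<close>, so
      \<open>qop S\<close> is split off here.\<close>
    also have "\<dots> = conv (\<lambda>\<mu> \<nu>. \<zeta> (tt (s \<mu> \<xi>) (f \<nu>) \<eta>) + \<zeta> (tt (qop S \<mu> \<xi>) (f \<nu>) \<eta>)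
         + (\<Sum>b\<in>B. \<xi> b * \<zeta> (tt (S \<mu>) (hp b f \<nu>) \<eta>))) \<alpha>"
    proof -
      have "tt (vop S \<mu> \<xi>) (f \<nu>) \<eta> = tt (s \<mu> \<xi>) (f \<nu>) \<eta> + tt (qop S \<mu> \<xi>) (f \<nu>) \<eta>" for \<mu> \<nu>
        unfolding s_def by (subst tt_add_left[symmetric]) (simp_all add: lf linF_D that)
      then show ?thesis using that by (simp add: dual_simps)
    qed
    \<comment> \<open>The part split off becomes, by \<open>sum_ad_hp\<close>, the derivative in the
      direction of \<open>\<xi> \<circ> br (S \<mu>)\<close>. This is the term that
      \<open>ad3\<close> requires in the first argument.\<close>
    also have "\<dots> = conv (\<lambda>\<mu> \<nu>. \<zeta> (tt (s \<mu> \<xi>) (f \<nu>) \<eta>) + (\<Sum>b\<in>B. \<xi> (br (S \<mu>) b) * \<zeta> (hp b f \<nu> \<eta>))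
         + (\<Sum>b\<in>B. \<xi> b * \<zeta> (tt (S \<mu>) (hp b f \<nu>) \<eta>))) \<alpha>"
      unfolding conv_add sum_ad_hp[OF assms(1,2) lf that, symmetric] conv_sum ..
    finally have 1: "(\<Sum>b\<in>B. \<xi> b * \<zeta> (hp b (Top S f) \<alpha> \<eta>)) = \<dots>" .
    have 2: "\<zeta> (\<omega> (Top S f \<alpha> \<xi>) \<eta>) = conv (\<lambda>\<mu> \<nu>. \<zeta> (\<omega> (tt (S \<mu>) (f \<nu>) \<xi>) \<eta>)) \<alpha>"
      using that by (simp add: Top_conv \<omega>_conv dual_conv)
    have 3: "\<zeta> (\<omega> (tt y t \<xi>) \<eta>) = \<zeta> (\<omega> (t (\<xi> \<circ> br y)) \<eta>) + \<zeta> (\<omega> (t \<xi>) (\<eta> \<circ> br y)) + \<zeta> (br y (\<omega> (t \<xi>) \<eta>))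
        - \<zeta> (tt (t \<xi>) (\<omega> y) \<eta>)" for y t
      using that by (simp add: tt_def \<omega>_add \<omega>_cocycle dual_simps algebra_simps del: o_apply)
    have 4: "(\<Sum>b\<in>B. \<xi> b * \<zeta> (tt y (hp b f \<nu>) \<eta>))
        = (\<Sum>b\<in>B. \<xi> b * \<zeta> (hp b f \<nu> (\<eta> \<circ> br y))) + (\<Sum>b\<in>B. \<xi> b * \<zeta> (br y (hp b f \<nu> \<eta>)))" for y \<nu>
      using that by (simp add: tt_def dual_add distrib_left sum.distrib del: o_apply)
    show ?thesis
      unfolding 1 2 ad3_def G_def M_def conv_add[symmetric] conv_diff[symmetric]
      by (rule conv_cong) (simp add: 3 4)
  qed
  then have "Lin (Top S f) \<alpha> \<xi> \<eta> \<zeta> = ad3 S (Lin f) \<alpha> \<xi> \<eta> \<zeta> + cyc (G \<alpha>) \<xi> \<eta> \<zeta>"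
    using assms unfolding Lin_def ad3_cyc M_def[symmetric] cyc_add[symmetric] by (intro cyc_eqI) auto
  moreover have "cyc (G \<alpha>) \<xi> \<eta> \<zeta> + Quad (uop S) f \<alpha> \<xi> \<eta> \<zeta> + Quad f (uop S) \<alpha> \<xi> \<eta> \<zeta> = 0"
  proof -
    have "Quad f (uop S) \<alpha> = cyc (\<lambda>\<xi> \<eta> \<zeta>. - conv (\<lambda>\<mu> \<nu>. \<zeta> (br (f \<nu> \<xi>) (uop S \<mu> \<eta>))) \<alpha>)"
      unfolding Quad_def by (subst conv_commute) (rule refl)
    moreover define W where "W \<mu> \<nu> \<xi> \<eta> \<zeta> = \<zeta> (tt (s \<mu> \<xi>) (f \<nu>) \<eta>) + \<zeta> (tt (f \<nu> \<xi>) (\<omega> (S \<mu>)) \<eta>)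
        - \<zeta> (br (uop S \<mu> \<xi>) (f \<nu> \<eta>)) - \<zeta> (br (f \<nu> \<xi>) (uop S \<mu> \<eta>))" for \<mu> \<nu> \<xi> \<eta> and \<zeta> :: "'g \<Rightarrow> 'k"
    ultimately have "cyc (G \<alpha>) \<xi> \<eta> \<zeta> + Quad (uop S) f \<alpha> \<xi> \<eta> \<zeta> + Quad f (uop S) \<alpha> \<xi> \<eta> \<zeta>
        = cyc (\<lambda>\<xi> \<eta> \<zeta>. conv (\<lambda>\<mu> \<nu>. W \<mu> \<nu> \<xi> \<eta> \<zeta>) \<alpha>) \<xi> \<eta> \<zeta>"
      by (simp add: Quad_def G_def W_def conv_diff cyc_def)
    also have "\<dots> = conv (\<lambda>\<mu> \<nu>. cyc (W \<mu> \<nu>) \<xi> \<eta> \<zeta>) \<alpha>"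
      by (rule cyc_conv)
    also have "\<dots> = 0"
    proof (rule conv_eq_0)
      fix \<mu> \<nu>
      have "cyc (W \<mu> \<nu>) \<xi> \<eta> \<zeta>
        = cyc (\<lambda>\<xi> \<eta> \<zeta>. \<zeta> (tt (s \<mu> \<xi>) (f \<nu>) \<eta>) - \<zeta> (br (s \<mu> \<xi>) (f \<nu> \<eta>)) - \<zeta> (br (f \<nu> \<xi>) (s \<mu> \<eta>))
          + (\<zeta> (tt (f \<nu> \<xi>) (\<omega> (S \<mu>)) \<eta>) - \<zeta> (br (f \<nu> \<xi>) (\<omega> (S \<mu>) \<eta>)) - \<zeta> (br (\<omega> (S \<mu>) \<xi>) (f \<nu> \<eta>)))) \<xi> \<eta> \<zeta>"
        using assms by (intro cyc_eqI) (simp_all add: W_def uop_def s_def br_add_left br_add_right dual_simps)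
      also have "\<dots> = 0"
        unfolding cyc_add using cyc_tt[OF assms(3-6), where s = "s \<mu>"] cyc_tt[OF \<omega>_skew assms(4-6), where s = "f \<nu>"] by simp
      finally show "cyc (W \<mu> \<nu>) \<xi> \<eta> \<zeta> = 0" .
    qed
    finally show ?thesis .
  qed
  ultimately show ?thesis by (simp add: algebra_simps)
qed

text \<open>Second derivatives of \<open>S\<close> are symmetric and drop out of the cyclic sum, the
  terms with \<open>\<omega>\<close> of a first derivative cancel, and \<open>\<omega>\<close> kills
  the \<ll>-valued \<open>qop\<close>. The iterated \<open>\<omega>\<close> terms that remain are
  the action on \<open>\<phi>\<close> by \<open>\<phi>_ad\<close>.\<close>

lemma Lin_uop:
  assumes "\<xi> \<in> D" "\<eta> \<in> D" "\<zeta> \<in> D"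
  shows "Lin (uop S) \<alpha> \<xi> \<eta> \<zeta> = ad3 S Con \<alpha> \<xi> \<eta> \<zeta>"
proof -
  define N where "N \<xi> \<eta> \<zeta> = (\<Sum>b\<in>B. \<Sum>c\<in>B. \<xi> b * (\<eta> c * \<zeta> (pd b (pd c S) \<alpha>)))" for \<xi> \<eta> and \<zeta> :: "'g \<Rightarrow> 'k"
  have N: "N \<xi> \<eta> \<zeta> = N \<eta> \<xi> \<zeta>" for \<xi> \<eta> \<zeta>
    unfolding N_def by (subst sum.swap) (simp add: fpartial_commute[of _ _ S] mult.left_commute)
  have "(\<Sum>b\<in>B. \<xi> b * \<zeta> (hp b (uop S) \<alpha> \<eta>)) - \<zeta> (\<omega> (uop S \<alpha> \<xi>) \<eta>) = N \<xi> \<eta> \<zeta> - N \<xi> \<zeta> \<eta> - \<zeta> (\<omega> (\<omega> (S \<alpha>) \<xi>) \<eta>)"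
    if "\<xi> \<in> D" "\<eta> \<in> D" "\<zeta> \<in> D" for \<xi> \<eta> \<zeta>
  proof -
    have "\<zeta> (hp b (uop S) \<alpha> \<eta>) = (\<Sum>c\<in>B. \<eta> c * \<zeta> (pd b (pd c S) \<alpha>))
        - (\<Sum>c\<in>B. \<zeta> c * \<eta> (pd b (pd c S) \<alpha>)) + \<zeta> (\<omega> (pd b S \<alpha>) \<eta>)" for b
    proof -
      have "hp b (uop S) \<alpha> \<eta> = (\<Sum>c\<in>B. sc (\<eta> c) (pd b (pd c S) \<alpha>))
        - (\<Sum>c\<in>B. sc (\<eta> (pd b (pd c S) \<alpha>)) c) + \<omega> (pd b S \<alpha>) \<eta>"
        using that by (simp add: hp_eq uop_def vop_def qop_def fpartial_def[of sc b] scale_right_distrib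
            scale_right_diff_distrib scale_sum_right dual_scale \<omega>_scale mult.commute del: of_nat_Suc)
      then show ?thesis using that by (simp add: dual_simps mult.commute)
    qed
    moreover have "\<omega> (qop S \<alpha> \<xi>) \<eta> = 0"
      using that by (simp add: qop_def \<omega>_sum \<omega>_scale \<omega>_\<ll> B_\<ll>)
    then have "\<zeta> (\<omega> (uop S \<alpha> \<xi>) \<eta>) = (\<Sum>b\<in>B. \<xi> b * \<zeta> (\<omega> (pd b S \<alpha>) \<eta>)) + \<zeta> (\<omega> (\<omega> (S \<alpha>) \<xi>) \<eta>)"
      using that by (simp add: uop_def \<omega>_add \<omega>_diff vop_def \<omega>_sum \<omega>_scale dual_simps)
    ultimately show ?thesis
      by (simp add: N_def distrib_left right_diff_distrib sum.distrib sum_subtractf sum_distrib_left)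
  qed
  then have "Lin (uop S) \<alpha> \<xi> \<eta> \<zeta> = cyc (\<lambda>\<xi> \<eta> \<zeta>. N \<xi> \<eta> \<zeta> - N \<xi> \<zeta> \<eta> - \<zeta> (\<omega> (\<omega> (S \<alpha>) \<xi>) \<eta>)) \<xi> \<eta> \<zeta>"
    unfolding Lin_def using assms by (intro cyc_eqI) auto
  also have "\<dots> = - cyc (\<lambda>\<xi> \<eta> \<zeta>. \<zeta> (\<omega> (\<omega> (S \<alpha>) \<xi>) \<eta>)) \<xi> \<eta> \<zeta>"
    using N[of \<xi> \<eta> \<zeta>] N[of \<eta> \<zeta> \<xi>] N[of \<zeta> \<xi> \<eta>] by (simp add: cyc_def)
  also have "\<dots> = - conv (\<lambda>\<mu> \<nu>. if \<nu> = {#} then \<zeta> (\<phi> (\<xi> \<circ> br (S \<mu>)) \<eta>) + \<zeta> (\<phi> \<xi> (\<eta> \<circ> br (S \<mu>))) + (\<zeta> \<circ> br (S \<mu>)) (\<phi> \<xi> \<eta>) else 0) \<alpha>"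
    unfolding \<phi>_ad[OF assms] conv_const_right ..
  also have "\<dots> = ad3 S Con \<alpha> \<xi> \<eta> \<zeta>"
    unfolding ad3_def Con_def fconst_def conv_minus[symmetric] by (rule conv_cong) simp
  finally show ?thesis .
qed


section \<open>Skewness and support of the generator\<close>

lemma tt_skew:
  assumes "t \<in> SK"
  shows "(\<lambda>\<xi>. if \<xi> \<in> D then tt y t \<xi> else 0) \<in> SK"
proof (rule skewI)
  fix \<xi> \<eta> assume x: "\<xi> \<in> D" "\<eta> \<in> D"
  have "\<xi> (br y (t \<eta>)) = - \<eta> (t (\<xi> \<circ> br y))"
    using skew_skew[OF assms dual_closed(1)[OF x(1)] x(2)] by simp
  moreover have "\<xi> (t (\<eta> \<circ> br y)) = - \<eta> (br y (t \<xi>))"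
    using skew_skew[OF assms x(1) dual_closed(1)[OF x(2)]] by simp
  ultimately show "\<xi> (if \<eta> \<in> D then tt y t \<eta> else 0) = - \<eta> (if \<xi> \<in> D then tt y t \<xi> else 0)"
    using x by (simp add: tt_def dual_simps del: o_apply)
  show "(if \<xi> + \<eta> \<in> D then tt y t (\<xi> + \<eta>) else 0) = (if \<xi> \<in> D then tt y t \<xi> else 0) + (if \<eta> \<in> D then tt y t \<eta> else 0)"
    using x assms by (simp add: dual_add_closed tt_def skew_add br_add_right add_comp dual_closed)
next
  fix c \<xi> assume "\<xi> \<in> D"
  then show "(if fs c \<xi> \<in> D then tt y t (fs c \<xi>) else 0) = sc c (if \<xi> \<in> D then tt y t \<xi> else 0)"
    using assms by (simp add: tt_def skew_scale br_scale_right fs_comp dual_closed scale_right_distrib)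
qed auto

lemma Top_skew:
  assumes "\<And>\<alpha>. f \<alpha> \<in> SK"
  shows "Top S f \<alpha> \<in> SK"
proof -
  have "Top S f \<alpha> = conv (\<lambda>\<mu> \<nu> \<xi>. if \<xi> \<in> D then tt (S \<mu>) (f \<nu>) \<xi> else 0) \<alpha>"
  proof
    fix \<xi>
    show "Top S f \<alpha> \<xi> = conv (\<lambda>\<mu> \<nu> \<xi>. if \<xi> \<in> D then tt (S \<mu>) (f \<nu>) \<xi> else 0) \<alpha> \<xi>"
      by (cases "\<xi> \<in> D") (simp_all add: conv_apply Top_conv Top_off)
  qed
  then show ?thesis using assms by (simp only: skew_conv_closed tt_skew)
qed

lemma uop_skew: "uop S \<alpha> \<in> SK"
proof (rule skewI)
  have l: "lin (uop S \<alpha>)" using linF_uop by (rule linF_D)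
  show "uop S \<alpha> (\<xi> + \<eta>) = uop S \<alpha> \<xi> + uop S \<alpha> \<eta>" if "\<xi> \<in> D" "\<eta> \<in> D" for \<xi> \<eta>
    using lin_add[OF l that] .
  show "uop S \<alpha> (fs c \<xi>) = sc c (uop S \<alpha> \<xi>)" if "\<xi> \<in> D" for \<xi> c
    using lin_scale[OF l that] .
  show "uop S \<alpha> \<xi> = 0" if "\<xi> \<notin> D" for \<xi> using that by (rule uop_off)
  show "\<xi> (uop S \<alpha> \<eta>) = - \<eta> (uop S \<alpha> \<xi>)" if "\<xi> \<in> D" "\<eta> \<in> D" for \<xi> \<eta>
    using that skew_skew[OF \<omega>_skew that, of "S \<alpha>"]
    by (simp add: uop_def vop_def qop_def dual_simps mult.commute)
qed

definition supp :: "('g multiset \<Rightarrow> 'v::zero) \<Rightarrow> bool" where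
  "supp f \<longleftrightarrow> (\<forall>\<alpha>. \<not> set_mset \<alpha> \<subseteq> B \<longrightarrow> f \<alpha> = 0)"

lemma supp_Top:
  assumes "supp S" "supp f" "linF f"
  shows "supp (Top S f)"
  unfolding supp_def
proof (intro allI impI ext)
  fix \<alpha> \<xi> assume \<alpha>: "\<not> set_mset \<alpha> \<subseteq> B"
  have "tt (S \<mu>) (f \<nu>) \<xi> = 0" if "\<mu> + \<nu> = \<alpha>" "\<xi> \<in> D" for \<mu> \<nu>
  proof -
    have "\<not> set_mset \<mu> \<subseteq> B \<or> \<not> set_mset \<nu> \<subseteq> B" using that \<alpha> by auto
    then have "S \<mu> = 0 \<or> f \<nu> = 0" using assms(1,2) unfolding supp_def by blast
    then show ?thesis using that assms(3) by (auto simp: tt_zero_left linF_D) (simp add: tt_def br_right.zero)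
  qed
  then show "Top S f \<alpha> \<xi> = 0 \<xi>" by (cases "\<xi> \<in> D") (auto simp: Top_off Top_conv intro: conv_eq_0)
qed

lemma supp_uop:
  assumes "supp S"
  shows "supp (uop S)"
  unfolding supp_def
proof (intro allI impI ext)
  fix \<alpha> \<xi> assume "\<not> set_mset \<alpha> \<subseteq> B"
  then have "S \<alpha> = 0" "pd b S \<alpha> = 0" for b using assms by (auto simp: supp_def fpartial_def)
  then show "uop S \<alpha> \<xi> = 0 \<xi>" by (simp add: uop_def vop_def qop_def \<omega>_zero dual_zero)
qed

text \<open>The \<open>n\<close>-th Taylor coefficient in time of the solution of x' = T x + u with
  x(0) = l. The contribution of u lags one power of T behind that of l.\<close>

definition flow :: "('g, 'g) formal \<Rightarrow> ('g, 'k) hom_formal \<Rightarrow> nat \<Rightarrow> ('g, 'k) hom_formal" where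
  "flow S l n = hs (1 / fact n) ((Top S ^^ n) l + (case n of 0 \<Rightarrow> 0 | Suc m \<Rightarrow> (Top S ^^ m) (uop S)))"

lemma flow_0: "flow S l 0 = l"
  by (simp add: flow_def fun_eq_iff hs_apply)

lemma flow_Suc: "hs (of_nat (Suc n)) (flow S l (Suc n)) = Top S (flow S l n) + (if n = 0 then uop S else 0)"
proof -
  have "hs (of_nat (Suc n)) (flow S l (Suc n)) = hs (1 / fact n) ((Top S ^^ Suc n) l + (Top S ^^ n) (uop S))"
    unfolding flow_def by (simp only: ops.scale_scale ops.scale_recip_mult nat.case)
  also have "\<dots> = Top S (flow S l n) + (if n = 0 then uop S else 0)"
    by (cases n) (simp_all only: flow_def ops.T_scale ops.T_add nat.case funpow.simps o_apply id_apply if_True if_False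
        nat.distinct ops.T.zero add_0_right fact_0 div_by_1 ops.scale_one refl)
  finally show ?thesis .
qed

lemma flow_Suc': "flow S l (Suc n) = hs (1 / of_nat (Suc n)) (Top S (flow S l n) + (if n = 0 then uop S else 0))"
proof -
  have "of_nat (Suc n) \<noteq> (0 :: 'k)" by (simp only: of_nat_eq_0_iff)
  then show ?thesis
    unfolding flow_Suc[symmetric] ops.scale_scale by (simp add: fun_eq_iff hs_apply del: of_nat_Suc)
qed

lemma hs_skew: "(\<And>\<alpha>. f \<alpha> \<in> SK) \<Longrightarrow> hs c f \<alpha> \<in> SK"
  unfolding fun_scale_def[of "fun_scale sc"] by (rule skew_scale_closed)

lemma flow_skew:
  assumes "\<And>\<alpha>. l \<alpha> \<in> SK"
  shows "flow S l n \<alpha> \<in> SK"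
proof (induction n arbitrary: \<alpha>)
  case (Suc n)
  have "(Top S (flow S l n) + (if n = 0 then uop S else 0)) \<alpha> \<in> SK" for \<alpha>
    unfolding plus_fun_apply[of _ _ \<alpha>]
    by (intro skew_add_closed Top_skew Suc) (simp add: uop_skew)
  then show ?case unfolding flow_Suc' by (rule hs_skew)
qed (simp add: flow_0 assms)

lemma flow_invariant:
  assumes "\<And>\<alpha>. l \<alpha> \<in> SK" "invariant l" "equivariant S"
  shows "invariant (flow S l n)"
proof (induction n)
  case (Suc n)
  have "linF (flow S l n)" using flow_skew[OF assms(1)] by (simp add: linF_def skew_lin)
  moreover have "invariant 0" by (rule invariantI) (simp add: dz_eq fpartial_def br_right.zero)
  ultimately show ?case
    unfolding flow_Suc' using Suc assms(3)
    by (intro invariant_scale invariant_add invariant_Top) (simp_all only: invariant_uop if_split simp_thms)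
qed (simp add: flow_0 assms)

lemma flow_supp:
  assumes "\<And>\<alpha>. l \<alpha> \<in> SK" "supp l" "supp S"
  shows "supp (flow S l n)"
proof (induction n)
  case (Suc n)
  have "linF (flow S l n)" using flow_skew[OF assms(1)] by (simp add: linF_def skew_lin)
  from supp_Top[OF assms(3) Suc this] supp_uop[OF assms(3)] show ?case
    by (simp add: flow_Suc' supp_def fun_eq_iff hs_apply)
qed (simp add: flow_0 assms)

text \<open>Coefficient \<open>n\<close> contains the power \<open>n - 1\<close> of T applied to
  \<open>uop S\<close>, which need not vanish in degree 0. Hence the bound is one worse than for
  powers of T on \<open>l\<close>.\<close>

lemma flow_vanish:
  assumes "\<And>\<alpha>. l \<alpha> \<in> SK" "S {#} = 0" "Suc (size \<alpha>) < n"
  shows "flow S l n \<alpha> = 0"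
proof -
  obtain m where m: "n = Suc m" "size \<alpha> < m" using assms(3) by (cases n) auto
  have "linF l" using assms(1) by (simp add: linF_def skew_lin)
  then have "(Top S ^^ n) l \<alpha> = 0" "(Top S ^^ m) (uop S) \<alpha> = 0"
    using Top_pow_vanish[where S = S, OF assms(2)] m linF_uop by (simp_all del: funpow.simps)
  then show ?thesis by (simp add: flow_def m fun_eq_iff hs_apply del: funpow.simps)
qed

text \<open>The truncation \<open>N\<close> is free above the degree, since derivatives and products
  of the sum need one \<open>N\<close> that serves several coefficients.\<close>

lemma gauge_act_flow:
  assumes "\<And>\<alpha>. l \<alpha> \<in> SK" "S {#} = 0" "equivariant S" "size \<alpha> < N"
  shows "gauge_act sc br \<omega> B S l \<alpha> \<xi> = (\<Sum>n\<le>N. flow S l n \<alpha> \<xi>)"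
proof -
  have ll: "linF l" using assms(1) by (simp add: linF_def skew_lin)
  have "gauge_act sc br \<omega> B S l \<alpha> \<xi> = (\<Sum>n\<le>Suc (size \<alpha>). sc (1 / fact n) ((Top S ^^ n) l \<alpha> \<xi>))
       + (\<Sum>n\<le>size \<alpha>. sc (1 / fact (Suc n)) ((Top S ^^ n) (uop S) \<alpha> \<xi>))"
    using Top_pow_vanish[where S = S, OF assms(2) ll, of \<alpha> "Suc (size \<alpha>)"]
    by (subst gauge_act_eq[OF assms(1,2) Rop_vop[OF assms(3)]]) (simp del: funpow.simps fact_Suc)
  also have "(\<Sum>n\<le>size \<alpha>. sc (1 / fact (Suc n)) ((Top S ^^ n) (uop S) \<alpha> \<xi>))
      = (\<Sum>n\<le>Suc (size \<alpha>). sc (1 / fact n) ((case n of 0 \<Rightarrow> 0 | Suc m \<Rightarrow> (Top S ^^ m) (uop S)) \<alpha> \<xi>))"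
    unfolding sum.atMost_Suc_shift by (simp del: fact_Suc)
  also have "(\<Sum>n\<le>Suc (size \<alpha>). sc (1 / fact n) ((Top S ^^ n) l \<alpha> \<xi>)) + \<dots> = (\<Sum>n\<le>Suc (size \<alpha>). flow S l n \<alpha> \<xi>)"
    unfolding sum.distrib[symmetric]
    by (rule sum.cong[OF refl]) (simp add: flow_def hs_apply scale_right_distrib)
  also have "\<dots> = (\<Sum>n\<le>N. flow S l n \<alpha> \<xi>)"
  proof (rule sum.mono_neutral_left)
    show "\<forall>i\<in>{..N} - {..Suc (size \<alpha>)}. flow S l i \<alpha> \<xi> = 0"
      using flow_vanish[where S = S and l = l, OF assms(1,2)] by simp
  qed (use assms(4) in auto)
  finally show ?thesis .
qed

lemma Lin_cong:
  assumes "\<And>\<mu> \<xi>. size \<mu> \<le> Suc (size \<alpha>) \<Longrightarrow> f \<mu> \<xi> = g \<mu> \<xi>"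
  shows "Lin f \<alpha> = Lin g \<alpha>"
  by (simp add: Lin_def hp_eq assms)

lemma Quad_cong:
  assumes "\<And>\<mu> \<xi>. size \<mu> \<le> size \<alpha> \<Longrightarrow> f \<mu> \<xi> = g \<mu> \<xi>" "\<And>\<mu> \<xi>. size \<mu> \<le> size \<alpha> \<Longrightarrow> f' \<mu> \<xi> = g' \<mu> \<xi>"
  shows "Quad f f' \<alpha> = Quad g g' \<alpha>"
proof -
  have "conv (\<lambda>\<mu> \<nu>. \<zeta> (br (f \<mu> \<xi>) (f' \<nu> \<eta>))) \<alpha> = conv (\<lambda>\<mu> \<nu>. \<zeta> (br (g \<mu> \<xi>) (g' \<nu> \<eta>))) \<alpha>"
    for \<xi> \<eta> and \<zeta> :: "'g \<Rightarrow> 'k"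
  proof (rule conv_cong)
    fix \<mu> \<nu> assume "\<mu> + \<nu> = \<alpha>"
    with split_size[OF this] show "\<zeta> (br (f \<mu> \<xi>) (f' \<nu> \<eta>)) = \<zeta> (br (g \<mu> \<xi>) (g' \<nu> \<eta>))"
      using assms by simp
  qed
  then show ?thesis by (simp add: Quad_def)
qed

context
  fixes \<xi> \<eta> \<zeta> assumes D3: "\<xi> \<in> D" "\<eta> \<in> D" "\<zeta> \<in> D"
begin

lemma Lin_add: "Lin (f + g) \<alpha> \<xi> \<eta> \<zeta> = Lin f \<alpha> \<xi> \<eta> \<zeta> + Lin g \<alpha> \<xi> \<eta> \<zeta>"
  using D3 by (simp add: Lin_def cyc_def hp_eq scale_right_distrib dual_simps \<omega>_add distrib_left sum.distrib algebra_simps del: of_nat_Suc)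

lemma Lin_scale: "Lin (hs c f) \<alpha> \<xi> \<eta> \<zeta> = c * Lin f \<alpha> \<xi> \<eta> \<zeta>"
  using D3 by (simp add: Lin_def cyc_def hp_eq hs_apply dual_simps \<omega>_scale sum_distrib_left right_diff_distrib distrib_left mult_ac del: of_nat_Suc)

lemma Lin_zero: "Lin 0 \<alpha> \<xi> \<eta> \<zeta> = 0"
  using Lin_scale[of 0 0] by (simp add: fun_scale_def zero_fun_def)

lemma Lin_sum: "Lin (\<Sum>i\<in>I. f i) \<alpha> \<xi> \<eta> \<zeta> = (\<Sum>i\<in>I. Lin (f i) \<alpha> \<xi> \<eta> \<zeta>)"
  by (induction I rule: infinite_finite_induct) (simp_all only: sum.infinite sum.empty sum.insert simp_thms Lin_zero Lin_add)

lemma Quad_add_left: "Quad (f + g) h \<alpha> \<xi> \<eta> \<zeta> = Quad f h \<alpha> \<xi> \<eta> \<zeta> + Quad g h \<alpha> \<xi> \<eta> \<zeta>"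
  using D3 by (simp add: Quad_def cyc_def dual_simps br_add_left conv_add)

lemma Quad_add_right: "Quad h (f + g) \<alpha> \<xi> \<eta> \<zeta> = Quad h f \<alpha> \<xi> \<eta> \<zeta> + Quad h g \<alpha> \<xi> \<eta> \<zeta>"
  using D3 by (simp add: Quad_def cyc_def dual_simps br_add_right conv_add)

lemma Quad_scale_left: "Quad (hs c f) h \<alpha> \<xi> \<eta> \<zeta> = c * Quad f h \<alpha> \<xi> \<eta> \<zeta>"
  using D3 by (simp add: Quad_def cyc_def hs_apply dual_simps br_scale_left mult_conv right_diff_distrib)

lemma Quad_scale_right: "Quad h (hs c f) \<alpha> \<xi> \<eta> \<zeta> = c * Quad h f \<alpha> \<xi> \<eta> \<zeta>"
  using D3 by (simp add: Quad_def cyc_def hs_apply dual_simps br_scale_right mult_conv right_diff_distrib)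

lemma Quad_zero: "Quad 0 h \<alpha> \<xi> \<eta> \<zeta> = 0" "Quad h 0 \<alpha> \<xi> \<eta> \<zeta> = 0"
  using Quad_scale_left[of 0 0] Quad_scale_right[of _ 0 0] by (simp_all add: fun_scale_def zero_fun_def)

lemma Quad_sum_left: "Quad (\<Sum>i\<in>I. f i) h \<alpha> \<xi> \<eta> \<zeta> = (\<Sum>i\<in>I. Quad (f i) h \<alpha> \<xi> \<eta> \<zeta>)"
  by (induction I rule: infinite_finite_induct) (simp_all only: sum.infinite sum.empty sum.insert simp_thms Quad_zero Quad_add_left)

lemma Quad_sum_right: "Quad h (\<Sum>i\<in>I. f i) \<alpha> \<xi> \<eta> \<zeta> = (\<Sum>i\<in>I. Quad h (f i) \<alpha> \<xi> \<eta> \<zeta>)"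
  by (induction I rule: infinite_finite_induct) (simp_all only: sum.infinite sum.empty sum.insert simp_thms Quad_zero Quad_add_right)

end

text \<open>The coefficient of \<open>\<tau>\<^sup>n\<close> in the dynamical equation for \<open>\<Sum>n. \<tau>\<^sup>n (flow S l n)\<close>. By the infinitesimal
  identities these coefficients satisfy a linear recursion, so they vanish as soon as the first one does.\<close>

definition defect :: "('g, 'g) formal \<Rightarrow> ('g, 'k) hom_formal \<Rightarrow> nat \<Rightarrow>
    'g multiset \<Rightarrow> ('g, 'k) trilinear" where
  "defect S l n \<alpha> \<xi> \<eta> \<zeta> = Lin (flow S l n) \<alpha> \<xi> \<eta> \<zeta>
     + (\<Sum>i\<le>n. Quad (flow S l i) (flow S l (n - i)) \<alpha> \<xi> \<eta> \<zeta>) + (if n = 0 then Con \<alpha> \<xi> \<eta> \<zeta> else 0)"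

lemma ad3_add: "ad3 S M \<alpha> \<xi> \<eta> \<zeta> + ad3 S M' \<alpha> \<xi> \<eta> \<zeta> = ad3 S (\<lambda>\<alpha> \<xi> \<eta> \<zeta>. M \<alpha> \<xi> \<eta> \<zeta> + M' \<alpha> \<xi> \<eta> \<zeta>) \<alpha> \<xi> \<eta> \<zeta>"
  unfolding ad3_def conv_add[symmetric] by (rule conv_cong) (simp add: algebra_simps)

lemma ad3_sum: "(\<Sum>i\<in>I. ad3 S (M i) \<alpha> \<xi> \<eta> \<zeta>) = ad3 S (\<lambda>\<alpha> \<xi> \<eta> \<zeta>. \<Sum>i\<in>I. M i \<alpha> \<xi> \<eta> \<zeta>) \<alpha> \<xi> \<eta> \<zeta>"
  unfolding ad3_def conv_sum[symmetric] by (rule conv_cong) (simp add: sum.distrib)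

text \<open>Comparison of coefficients in the statement that the time derivative of the defect is
  its image under \<open>ad3 S\<close>. \<open>Quad_Top\<close>, \<open>Lin_Top\<close> and
  \<open>Lin_uop\<close> handle the parts of degree two, one and zero in the flow.\<close>

lemma defect_Suc:
  assumes l: "\<And>\<alpha>. l \<alpha> \<in> SK" and inv: "invariant l" and S: "equivariant S" and D3: "\<xi> \<in> D" "\<eta> \<in> D" "\<zeta> \<in> D"
  shows "of_nat (Suc n) * defect S l (Suc n) \<alpha> \<xi> \<eta> \<zeta> = ad3 S (defect S l n) \<alpha> \<xi> \<eta> \<zeta>"
proof -
  let ?f = "flow S l"
  let ?u = "if n = 0 then uop S else 0"
  have sk: "?f n \<alpha> \<in> SK" for n \<alpha> using flow_skew[OF l] .
  have lf: "linF (?f n)" for n using sk by (simp add: linF_def skew_lin)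
  note lins = Lin_add[OF D3] Lin_zero[OF D3] Quad_add_left[OF D3] Quad_add_right[OF D3] Quad_zero[OF D3]
  let ?Q = "\<lambda>f g. Quad f g \<alpha> \<xi> \<eta> \<zeta>"
  have 1: "of_nat (Suc n) * Lin (?f (Suc n)) \<alpha> \<xi> \<eta> \<zeta>
      = Lin (Top S (?f n)) \<alpha> \<xi> \<eta> \<zeta> + (if n = 0 then ad3 S Con \<alpha> \<xi> \<eta> \<zeta> else 0)"
    unfolding Lin_scale[OF D3, symmetric] flow_Suc
    by (cases "n = 0") (simp_all only: lins Lin_uop[OF D3] if_True if_False simp_thms)
  have qL: "of_nat (Suc i) * ?Q (?f (Suc i)) g = ?Q (Top S (?f i)) g + (if i = 0 then ?Q (uop S) g else 0)" for i g
    unfolding Quad_scale_left[OF D3, symmetric] flow_Suc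
    by (cases "i = 0") (simp_all only: lins if_True if_False simp_thms)
  have qR: "of_nat (Suc i) * ?Q g (?f (Suc i)) = ?Q g (Top S (?f i)) + (if i = 0 then ?Q g (uop S) else 0)" for i g
    unfolding Quad_scale_right[OF D3, symmetric] flow_Suc
    by (cases "i = 0") (simp_all only: lins if_True if_False simp_thms)
  \<comment> \<open>Product rule in time: \<open>Suc n\<close> splits as
    \<open>i + (Suc n - i)\<close>, and each summand differentiates one of the two factors.\<close>
  have "of_nat (Suc n) * (\<Sum>i\<le>Suc n. ?Q (?f i) (?f (Suc n - i)))
      = (\<Sum>i\<le>Suc n. of_nat i * ?Q (?f i) (?f (Suc n - i)) + of_nat (Suc n - i) * ?Q (?f i) (?f (Suc n - i)))"
    unfolding sum_distrib_left distrib_right[symmetric] of_nat_add[symmetric]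
    by (rule sum.cong) auto
  also have "\<dots> = (\<Sum>i\<le>n. of_nat (Suc i) * ?Q (?f (Suc i)) (?f (n - i)))
      + (\<Sum>i\<le>n. of_nat (Suc (n - i)) * ?Q (?f i) (?f (Suc (n - i))))"
    unfolding sum.distrib
    by (subst sum.atMost_Suc_shift, subst sum.atMost_Suc) (simp add: Suc_diff_le del: of_nat_Suc)
  \<comment> \<open>The translation term enters the derivative of coefficient 0 only, hence once at
    each end of the sum.\<close>
  also have "\<dots> = (\<Sum>i\<le>n. ?Q (Top S (?f i)) (?f (n - i)) + ?Q (?f i) (Top S (?f (n - i))))
      + ((\<Sum>i\<le>n. if i = 0 then ?Q (uop S) (?f (n - i)) else 0) + (\<Sum>i\<le>n. if n - i = 0 then ?Q (?f i) (uop S) else 0))"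
    unfolding qL qR by (simp add: sum.distrib)
  also have "(\<Sum>i\<le>n. if i = 0 then ?Q (uop S) (?f (n - i)) else 0) = ?Q (uop S) (?f n)"
    by (simp add: sum.delta)
  also have "(\<Sum>i\<le>n. if n - i = 0 then ?Q (?f i) (uop S) else 0) = (\<Sum>i\<le>n. if i = n then ?Q (?f i) (uop S) else 0)"
    by (rule sum.cong) auto
  also have "\<dots> = ?Q (?f n) (uop S)" by (simp add: sum.delta)
  also have "(\<Sum>i\<le>n. ?Q (Top S (?f i)) (?f (n - i)) + ?Q (?f i) (Top S (?f (n - i))))
      = ad3 S (\<lambda>\<alpha> \<xi> \<eta> \<zeta>. \<Sum>i\<le>n. Quad (?f i) (?f (n - i)) \<alpha> \<xi> \<eta> \<zeta>) \<alpha> \<xi> \<eta> \<zeta>"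
    unfolding ad3_sum[symmetric] by (rule sum.cong[OF refl]) (rule Quad_Top[OF lf lf D3])
  finally have 2: "of_nat (Suc n) * (\<Sum>i\<le>Suc n. ?Q (?f i) (?f (Suc n - i)))
      = ad3 S (\<lambda>\<alpha> \<xi> \<eta> \<zeta>. \<Sum>i\<le>n. Quad (?f i) (?f (n - i)) \<alpha> \<xi> \<eta> \<zeta>) \<alpha> \<xi> \<eta> \<zeta> + (?Q (uop S) (?f n) + ?Q (?f n) (uop S))" .
  have 3: "(if n = 0 then ad3 S Con \<alpha> \<xi> \<eta> \<zeta> else 0) = ad3 S (\<lambda>\<alpha> \<xi> \<eta> \<zeta>. if n = 0 then Con \<alpha> \<xi> \<eta> \<zeta> else 0) \<alpha> \<xi> \<eta> \<zeta>"
    by (simp add: ad3_def)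
  have "of_nat (Suc n) * defect S l (Suc n) \<alpha> \<xi> \<eta> \<zeta>
      = (Lin (Top S (?f n)) \<alpha> \<xi> \<eta> \<zeta> + ?Q (uop S) (?f n) + ?Q (?f n) (uop S))
       + ad3 S (\<lambda>\<alpha> \<xi> \<eta> \<zeta>. \<Sum>i\<le>n. Quad (?f i) (?f (n - i)) \<alpha> \<xi> \<eta> \<zeta>) \<alpha> \<xi> \<eta> \<zeta>
       + ad3 S (\<lambda>\<alpha> \<xi> \<eta> \<zeta>. if n = 0 then Con \<alpha> \<xi> \<eta> \<zeta> else 0) \<alpha> \<xi> \<eta> \<zeta>"
    unfolding defect_def distrib_left 1 2 3 by (simp add: add_ac)
  also have "Lin (Top S (?f n)) \<alpha> \<xi> \<eta> \<zeta> + ?Q (uop S) (?f n) + ?Q (?f n) (uop S) = ad3 S (Lin (?f n)) \<alpha> \<xi> \<eta> \<zeta>"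
    by (rule Lin_Top[OF S flow_invariant[OF l inv S] sk D3])
  finally show ?thesis unfolding ad3_add defect_def[abs_def] .
qed

lemma defect_zero:
  assumes l: "\<And>\<alpha>. l \<alpha> \<in> SK" and inv: "invariant l" and S: "equivariant S"
    and E: "\<And>\<xi> \<eta> \<zeta> \<alpha>. \<xi> \<in> D \<Longrightarrow> \<eta> \<in> D \<Longrightarrow> \<zeta> \<in> D \<Longrightarrow> Lin l \<alpha> \<xi> \<eta> \<zeta> + Quad l l \<alpha> \<xi> \<eta> \<zeta> + Con \<alpha> \<xi> \<eta> \<zeta> = 0"
  shows "\<xi> \<in> D \<Longrightarrow> \<eta> \<in> D \<Longrightarrow> \<zeta> \<in> D \<Longrightarrow> defect S l n \<alpha> \<xi> \<eta> \<zeta> = 0"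
proof (induction n arbitrary: \<alpha> \<xi> \<eta> \<zeta>)
  case (Suc n)
  have "ad3 S (defect S l n) \<alpha> \<xi> \<eta> \<zeta> = 0"
    unfolding ad3_def using Suc by (intro conv_eq_0) (simp add: dual_closed del: o_apply)
  moreover have "of_nat (Suc n) \<noteq> (0 :: 'k)" by (simp only: of_nat_eq_0_iff)
  ultimately show ?case
    using defect_Suc[OF l inv S Suc.prems, of n \<alpha>] by (simp del: of_nat_Suc)
qed (simp add: defect_def flow_0 E)

text \<open>Since \<open>\<omega>\<close> vanishes on \<open>\<ll>\<close>, the second defining
  equation loses its inhomogeneous term and becomes plain invariance.\<close>

lemma Dynl_iff:
  "l \<in> Dynl sc br \<omega> \<phi> \<ll> B \<longleftrightarrow> (\<forall>\<alpha>. l \<alpha> \<in> SK) \<and> supp l \<and> invariant l \<and>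
    (\<forall>\<xi>\<in>D. \<forall>\<eta>\<in>D. \<forall>\<zeta>\<in>D. \<forall>\<alpha>. Lin l \<alpha> \<xi> \<eta> \<zeta> + Quad l l \<alpha> \<xi> \<eta> \<zeta> + Con \<alpha> \<xi> \<eta> \<zeta> = 0)"
proof -
  have "fprod sc (fconst a) h \<alpha> = sc a (h \<alpha>)" for a h and \<alpha> :: "'g multiset"
  proof -
    have "fprod sc (fconst a) h \<alpha> = conv (\<lambda>\<mu> \<nu>. if \<mu> = {#} then sc a (h \<nu>) else 0) \<alpha>"
      unfolding fprod_conv fconst_def by (rule conv_cong) simp
    then show ?thesis by (simp add: conv_const_left)
  qed
  then have fd: "fdiff sc B (\<lambda>\<mu>. l \<mu> \<eta>) (istar_field \<xi>) \<alpha> = (\<Sum>b\<in>B. sc (\<xi> b) (hp b l \<alpha> \<eta>))" for \<xi> \<eta> \<alpha>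
    by (simp add: fdiff_def istar_field_def hp_def)
  have "cyc (\<lambda>\<xi> \<eta> \<zeta>. \<zeta> (fdiff sc B (\<lambda>\<mu>. l \<mu> \<eta>) (istar_field \<xi>) \<alpha>)
          - \<zeta> (fprod br (\<lambda>\<mu>. l \<mu> \<xi>) (\<lambda>\<mu>. l \<mu> \<eta>) \<alpha>) - \<zeta> (\<omega> (l \<alpha> \<xi>) \<eta>)) \<xi> \<eta> \<zeta>
      = Lin l \<alpha> \<xi> \<eta> \<zeta> + Quad l l \<alpha> \<xi> \<eta> \<zeta>" if "\<xi> \<in> D" "\<eta> \<in> D" "\<zeta> \<in> D" for \<xi> \<eta> \<zeta> \<alpha>
    unfolding Lin_def Quad_def cyc_add[symmetric]
    by (intro cyc_eqI that) (simp add: fd fprod_conv dual_simps dual_conv)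
  then have "(\<forall>\<xi>\<in>D. \<forall>\<eta>\<in>D. \<forall>\<zeta>\<in>D. \<forall>\<alpha>. cyc (\<lambda>\<xi> \<eta> \<zeta>. \<zeta> (fdiff sc B (\<lambda>\<mu>. l \<mu> \<eta>) (istar_field \<xi>) \<alpha>)
          - \<zeta> (fprod br (\<lambda>\<mu>. l \<mu> \<xi>) (\<lambda>\<mu>. l \<mu> \<eta>) \<alpha>) - \<zeta> (\<omega> (l \<alpha> \<xi>) \<eta>)) \<xi> \<eta> \<zeta> = fconst (\<zeta> (\<phi> \<xi> \<eta>)) \<alpha>)
      \<longleftrightarrow> (\<forall>\<xi>\<in>D. \<forall>\<eta>\<in>D. \<forall>\<zeta>\<in>D. \<forall>\<alpha>. Lin l \<alpha> \<xi> \<eta> \<zeta> + Quad l l \<alpha> \<xi> \<eta> \<zeta> + Con \<alpha> \<xi> \<eta> \<zeta> = 0)"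
    by (simp add: Con_def)
  moreover have "(\<forall>z\<in>\<ll>. \<forall>\<xi>\<in>D. \<forall>\<alpha>. dz z (\<lambda>\<mu>. l \<mu> \<xi>) \<alpha> + fconst (\<omega> z \<xi>) \<alpha> + br z (l \<alpha> \<xi>) + l \<alpha> (ad_star br z \<xi>) = 0)
      \<longleftrightarrow> invariant l"
    by (simp add: invariant_def \<omega>_\<ll> fconst_def ad_star_def del: o_apply)
  ultimately show ?thesis
    unfolding Dynl_def formal_maps_def supp_def by auto
qed

lemma gauge_group_iff: "S \<in> gauge_group sc br \<ll> B \<longleftrightarrow> supp S \<and> S {#} = 0 \<and> equivariant S"
  by (auto simp: gauge_group_def formal_maps_def supp_def equivariant_def)

lemma gauge_act_Dynl:
  assumes "l \<in> Dynl sc br \<omega> \<phi> \<ll> B" "S \<in> gauge_group sc br \<ll> B"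
  shows "gauge_act sc br \<omega> B S l \<in> Dynl sc br \<omega> \<phi> \<ll> B"
proof -
  have l: "\<And>\<alpha>. l \<alpha> \<in> SK" "supp l" "invariant l"
    and E: "\<And>\<xi> \<eta> \<zeta> \<alpha>. \<xi> \<in> D \<Longrightarrow> \<eta> \<in> D \<Longrightarrow> \<zeta> \<in> D \<Longrightarrow> Lin l \<alpha> \<xi> \<eta> \<zeta> + Quad l l \<alpha> \<xi> \<eta> \<zeta> + Con \<alpha> \<xi> \<eta> \<zeta> = 0"
    using assms(1) by (auto simp: Dynl_iff)
  have S: "supp S" "S {#} = 0" "equivariant S" using assms(2) by (auto simp: gauge_group_iff)
  let ?g = "gauge_act sc br \<omega> B S l"
  have g: "?g \<mu> = (\<Sum>n\<le>N. flow S l n) \<mu>" if "size \<mu> < N" for \<mu> N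
    using gauge_act_flow[OF l(1) S(2,3) that] by (intro ext) (simp add: sum_apply)
  have sa: "(\<Sum>n\<le>N. flow S l n) \<alpha> = (\<Sum>n\<le>N. flow S l n \<alpha>)" for N \<alpha>
    by (rule sum_apply)
  have "?g \<alpha> \<in> SK" for \<alpha>
    unfolding g[OF lessI] sa by (intro skew_sum_closed flow_skew l)
  moreover have "supp ?g"
    unfolding supp_def
  proof (intro allI impI)
    fix \<alpha> assume "\<not> set_mset \<alpha> \<subseteq> B"
    then show "?g \<alpha> = 0" 
      unfolding g[OF lessI] sa using flow_supp[OF l(1,2) S(1)] by (simp add: supp_def)
  qed
  moreover have "invariant ?g"
  proof (rule invariantI)
    fix z \<xi> and \<alpha> :: "'g multiset" assume z: "z \<in> \<ll>" "\<xi> \<in> D"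
    \<comment> \<open>Differentiation looks one degree above \<open>\<alpha>\<close>, and the
      truncation has to be exact there.\<close>
    define N where "N = Suc (Suc (size \<alpha>))"
    have "(\<Sum>n\<le>N. flow S l n) \<in> {f. invariant f}"
    proof (rule sum_in_closed)
      show "0 \<in> {f. invariant f}" by (auto intro!: invariantI simp: dz_eq fpartial_def br_right.zero)
    qed (use invariant_add flow_invariant[OF l(1,3) S(3)] in blast)+
    then have "invariant (\<Sum>n\<le>N. flow S l n)" by blast
    note i = invariantD[OF this z, of \<alpha>]
    have "dz z (\<lambda>\<mu>. ?g \<mu> \<xi>) \<alpha> = dz z (\<lambda>\<mu>. (\<Sum>n\<le>N. flow S l n) \<mu> \<xi>) \<alpha>"
      unfolding dz_eq
    proof (intro sum.cong refl conv_cong)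
      fix b \<mu> \<nu> assume "\<mu> + \<nu> = \<alpha>"
      then have "size (add_mset b \<nu>) < N" using split_size[of \<mu> \<nu> \<alpha>] by (simp add: N_def)
      from g[OF this] show "sc (coord (br z b) \<mu>) (pd b (\<lambda>\<mu>. ?g \<mu> \<xi>) \<nu>)
          = sc (coord (br z b) \<mu>) (pd b (\<lambda>\<mu>. (\<Sum>n\<le>N. flow S l n) \<mu> \<xi>) \<nu>)"
        by (simp add: fpartial_def)
    qed
    with i g[of \<alpha> N] show "dz z (\<lambda>\<mu>. ?g \<mu> \<xi>) \<alpha> = - br z (?g \<alpha> \<xi>) - ?g \<alpha> (\<xi> \<circ> br z)"
      by (simp add: N_def del: o_apply)
  qed
  moreover have "Lin ?g \<alpha> \<xi> \<eta> \<zeta> + Quad ?g ?g \<alpha> \<xi> \<eta> \<zeta> + Con \<alpha> \<xi> \<eta> \<zeta> = 0" if D3: "\<xi> \<in> D" "\<eta> \<in> D" "\<zeta> \<in> D" for \<xi> \<eta> \<zeta> \<alpha>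
  proof -
    \<comment> \<open>If \<open>i + j > N\<close>, one index exceeds
      \<open>Suc (size \<alpha>)\<close> and its coefficient vanishes up to the degree of
      \<open>\<alpha>\<close>. So the square of pairs can be cut down to the triangle and summed by
      total order in time.\<close>
    define N where "N = 2 * Suc (Suc (size \<alpha>))"
    let ?s = "\<Sum>n\<le>N. flow S l n"
    have gs: "?g \<mu> = ?s \<mu>" if "size \<mu> \<le> Suc (size \<alpha>)" for \<mu>
      by (rule g) (use that in \<open>simp add: N_def\<close>)
    have "Lin ?g \<alpha> \<xi> \<eta> \<zeta> = (\<Sum>n\<le>N. Lin (flow S l n) \<alpha> \<xi> \<eta> \<zeta>)"
    proof -
      have "Lin ?g \<alpha> = Lin ?s \<alpha>" by (rule Lin_cong) (simp only: gs)
      then show ?thesis by (simp only: Lin_sum[OF D3])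
    qed
    moreover have "Quad ?g ?g \<alpha> \<xi> \<eta> \<zeta> = (\<Sum>n\<le>N. \<Sum>i\<le>n. Quad (flow S l i) (flow S l (n - i)) \<alpha> \<xi> \<eta> \<zeta>)"
    proof -
      have z: "Quad (flow S l i) (flow S l j) \<alpha> \<xi> \<eta> \<zeta> = 0" if "i + j > N" for i j
      proof -
        have v: "flow S l k \<mu> \<xi> = 0" if "Suc (size \<alpha>) < k" "size \<mu> \<le> size \<alpha>" for k \<mu> \<xi>
          using flow_vanish[where S = S and l = l, OF l(1) S(2), of \<mu> k] that by simp
        from that have "Suc (size \<alpha>) < i \<or> Suc (size \<alpha>) < j" by (auto simp: N_def)
        then show ?thesis
        proof
          assume "Suc (size \<alpha>) < i"
          then have "Quad (flow S l i) (flow S l j) \<alpha> = Quad 0 (flow S l j) \<alpha>"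
            by (intro Quad_cong) (simp_all add: v)
          then show ?thesis by (simp only: Quad_zero[OF D3])
        next
          assume "Suc (size \<alpha>) < j"
          then have "Quad (flow S l i) (flow S l j) \<alpha> = Quad (flow S l i) 0 \<alpha>"
            by (intro Quad_cong) (simp_all add: v)
          then show ?thesis by (simp only: Quad_zero[OF D3])
        qed
      qed
      have "Quad ?g ?g \<alpha> = Quad ?s ?s \<alpha>" by (rule Quad_cong) (simp_all only: gs le_SucI)
      then have "Quad ?g ?g \<alpha> \<xi> \<eta> \<zeta> = Quad ?s ?s \<alpha> \<xi> \<eta> \<zeta>" by (simp only:)
      also have "\<dots> = (\<Sum>i\<le>N. \<Sum>j\<le>N. Quad (flow S l i) (flow S l j) \<alpha> \<xi> \<eta> \<zeta>)"
        unfolding Quad_sum_left[OF D3] Quad_sum_right[OF D3] by (rule sum.swap)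
      also have "\<dots> = (\<Sum>n\<le>N. \<Sum>i\<le>n. Quad (flow S l i) (flow S l (n - i)) \<alpha> \<xi> \<eta> \<zeta>)"
        by (rule sum_triangle) (rule z)
      finally show ?thesis .
    qed
    moreover have "Con \<alpha> \<xi> \<eta> \<zeta> = (\<Sum>n\<le>N. if n = 0 then Con \<alpha> \<xi> \<eta> \<zeta> else 0)"
      by (simp add: sum.delta)
    ultimately have "Lin ?g \<alpha> \<xi> \<eta> \<zeta> + Quad ?g ?g \<alpha> \<xi> \<eta> \<zeta> + Con \<alpha> \<xi> \<eta> \<zeta> = (\<Sum>n\<le>N. defect S l n \<alpha> \<xi> \<eta> \<zeta>)"
      unfolding defect_def sum.distrib by (simp only:)
    also have "\<dots> = 0"
      using defect_zero[OF l(1,3) S(3) E D3] by simp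
    finally show ?thesis .
  qed
  ultimately show ?thesis by (simp add: Dynl_iff)
qed


section \<open>The homotopy for closed invariant maps\<close>

text \<open>\<open>contract C\<close> is \<open>p \<mapsto> C\<^sub>p (p \<circ> Q)\<close>, the contraction with the Euler field.\<close>

definition contract :: "('g, 'k) hom_formal \<Rightarrow> 'g multiset \<Rightarrow> 'g" where
  "contract C \<alpha> = (\<Sum>b\<in>B. cmul b (\<lambda>\<nu>. C \<nu> (e b)) \<alpha>)"

lemma fpartial_contract:
  assumes "c \<in> B"
  shows "pd c (contract C) \<alpha> = C \<alpha> (e c) + contract (hp c C) \<alpha>"
proof -
  have "sc (of_nat (Suc (count \<alpha> c))) (cmul b (\<lambda>\<nu>. C \<nu> (e b)) (add_mset c \<alpha>))
      = (if b = c then C \<alpha> (e c) else 0) + cmul b (\<lambda>\<nu>. hp c C \<nu> (e b)) \<alpha>" for b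
  proof -
    have "conv (\<lambda>\<mu> \<nu>. sc (of_nat (Suc (count \<mu> c))) (if add_mset c \<mu> = {#b#} then C \<nu> (e b) else 0)) \<alpha>
        = conv (\<lambda>\<mu> \<nu>. if \<mu> = {#} then (if b = c then C \<nu> (e c) else 0) else 0) \<alpha>"
      by (rule conv_cong) auto
    moreover have "conv (\<lambda>\<mu> \<nu>. sc (of_nat (Suc (count \<nu> c))) (if \<mu> = {#b#} then C (add_mset c \<nu>) (e b) else 0)) \<alpha>
        = cmul b (\<lambda>\<nu>. hp c C \<nu> (e b)) \<alpha>"
      by (rule conv_cong) (simp add: hp_eq)
    ultimately show ?thesis by (simp only: sc_Leibniz conv_const_left)
  qed
  then show ?thesis
    using assms by (simp add: fpartial_def contract_def scale_sum_right sum.distrib del: of_nat_Suc)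
qed

text \<open>Multiplication by a coordinate undoes the shift in its derivative and leaves the
  multiplicity as a factor. The multiplicities over \<open>B\<close> add up to the degree because
  \<open>C\<close> lives on multisets over \<open>B\<close>.\<close>

lemma Euler:
  assumes "supp C"
  shows "(\<Sum>b\<in>B. cmul b (\<lambda>\<nu>. hp b C \<nu> \<eta>) \<alpha>) = sc (of_nat (size \<alpha>)) (C \<alpha> \<eta>)"
proof (cases "set_mset \<alpha> \<subseteq> B")
  case True
  have "cmul b (\<lambda>\<nu>. hp b C \<nu> \<eta>) \<alpha> = sc (of_nat (count \<alpha> b)) (C \<alpha> \<eta>)" for b
    unfolding conv_single by (auto simp: hp_eq not_in_iff Suc_diff_1[OF count_greater_zero_iff[THEN iffD2]] simp del: of_nat_Suc)
  then have "(\<Sum>b\<in>B. cmul b (\<lambda>\<nu>. hp b C \<nu> \<eta>) \<alpha>) = sc (of_nat (\<Sum>b\<in>B. count \<alpha> b)) (C \<alpha> \<eta>)"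
    by (simp add: scale_sum_left)
  also have "(\<Sum>b\<in>B. count \<alpha> b) = size \<alpha>"
    unfolding size_multiset_overloaded_eq using True
    by (intro sum.mono_neutral_right) (auto simp: not_in_iff)
  finally show ?thesis .
next
  case False
  then have "C \<alpha> = 0" using assms by (simp add: supp_def)
  moreover have "cmul b (\<lambda>\<nu>. hp b C \<nu> \<eta>) \<alpha> = 0" for b
    unfolding conv_single using \<open>C \<alpha> = 0\<close> by (auto simp: hp_eq)
  ultimately show ?thesis by simp
qed

text \<open>\<open>br z\<close> preserves \<open>\<mm>\<close>, so this functional still vanishes on
  \<open>\<mm>\<close> and is a combination of the dual basis vectors.\<close>

lemma e_br_expand:
  assumes "z \<in> \<ll>"
  shows "e b \<circ> br z = (\<Sum>c\<in>B. fs (e b (br z c)) (e c))"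
proof -
  have "e b \<circ> br z = (e b \<circ> br z) \<circ> Q"
  proof
    fix x
    have "e b (br z (P x)) = 0" using assms by (simp add: e_\<mm> br_\<mm> P_\<mm>)
    then show "(e b \<circ> br z) x = (e b \<circ> br z \<circ> Q) x"
      by (simp add: P_def br_right.diff dual_diff[OF e_dual])
  qed
  also have "\<dots> = (\<Sum>c\<in>B. fs ((e b \<circ> br z) c) (e c))"
    by (rule dual_Q_expand) (simp add: dual_closed)
  finally show ?thesis by simp
qed

text \<open>The Euler field is invariant. Concretely, differentiating the coordinate in
  \<open>contract\<close> and letting \<open>z\<close> act on the argument \<open>e b\<close>
  produce the same double sum of \<open>M\<close>, with opposite signs.\<close>

lemma equivariant_contract:
  assumes "invariant C" "linF C"
  shows "equivariant (contract C)"
  unfolding equivariant_def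
proof (intro ballI allI)
  fix z \<alpha> assume z: "z \<in> \<ll>"
  define M where "M b c = cmul b (\<lambda>\<nu>. sc (e b (br z c)) (C \<nu> (e c))) \<alpha>" for b c
  have zb: "br z c \<in> \<ll>" if "c \<in> B" for c using z that by (simp add: br_\<ll> B_\<ll>)
  have 1: "conv (\<lambda>\<mu> \<nu>. sc (coord (br z c) \<mu>) (C \<nu> (e c))) \<alpha> = (\<Sum>b\<in>B. M b c)" if "c \<in> B" for c
  proof -
    have "sc (coord (br z c) \<mu>) x = (\<Sum>b\<in>B. if \<mu> = {#b#} then sc (e b (br z c)) x else 0)" for \<mu> x
      unfolding feval_eq[OF zb[OF that]] scale_sum_left by (rule sum.cong) auto
    then show ?thesis by (simp add: M_def conv_sum)
  qed
  have 2: "(\<Sum>c\<in>B. conv (\<lambda>\<mu> \<nu>. sc (coord (br z c) \<mu>) (contract (hp c C) \<nu>)) \<alpha>)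
      = (\<Sum>b\<in>B. cmul b (\<lambda>\<nu>. dz z (\<lambda>\<rho>. C \<rho> (e b)) \<nu>) \<alpha>)"
  proof -
    have "(\<Sum>c\<in>B. conv (\<lambda>\<mu> \<nu>. sc (coord (br z c) \<mu>) (contract (hp c C) \<nu>)) \<alpha>)
       = (\<Sum>c\<in>B. \<Sum>b\<in>B. convr (\<lambda>\<mu> \<rho> \<tau>. if \<rho> = {#b#} then sc (coord (br z c) \<mu>) (hp c C \<tau> (e b)) else 0) \<alpha>)"
    proof -
      have "sc x (if P then y else 0) = (if P then sc x y else 0)" for x y P by simp
      then show ?thesis by (simp only: contract_def scale_sum_right sc_conv conv_sum)
    qed
    also have "\<dots> = (\<Sum>c\<in>B. \<Sum>b\<in>B. convr (\<lambda>\<mu> \<rho> \<tau>. if \<mu> = {#b#} then sc (coord (br z c) \<rho>) (hp c C \<tau> (e b)) else 0) \<alpha>)"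
      by (intro sum.cong refl) (rule conv_left_commute)
    also have "\<dots> = (\<Sum>b\<in>B. \<Sum>c\<in>B. cmul b (\<lambda>\<nu>. conv (\<lambda>\<rho> \<tau>. sc (coord (br z c) \<rho>) (hp c C \<tau> (e b))) \<nu>) \<alpha>)"
      by (subst sum.swap) (intro sum.cong refl conv_cong, simp)
    also have "\<dots> = (\<Sum>b\<in>B. cmul b (\<lambda>\<nu>. dz z (\<lambda>\<rho>. C \<rho> (e b)) \<nu>) \<alpha>)"
      unfolding conv_sum[symmetric] by (intro sum.cong refl conv_cong) (simp add: dz_eq hp_def)
    finally show ?thesis .
  qed
  have 3: "cmul b (\<lambda>\<nu>. dz z (\<lambda>\<rho>. C \<rho> (e b)) \<nu>) \<alpha>
      = - br z (cmul b (\<lambda>\<nu>. C \<nu> (e b)) \<alpha>) - (\<Sum>c\<in>B. M b c)" for b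
  proof -
    have "C \<nu> (e b \<circ> br z) = (\<Sum>c\<in>B. sc (e b (br z c)) (C \<nu> (e c)))" for \<nu>
      unfolding e_br_expand[OF z] using assms(2) by (simp add: lin_sum linF_D lin_scale dual_closed)
    then show ?thesis
      unfolding br_conv_right M_def conv_sum[symmetric] conv_minus[symmetric] conv_diff[symmetric]
      using invariantD[OF assms(1) z e_dual]
      by (intro conv_cong) (simp add: br_right.zero)
  qed
  have "dz z (contract C) \<alpha> = (\<Sum>c\<in>B. conv (\<lambda>\<mu> \<nu>. sc (coord (br z c) \<mu>) (C \<nu> (e c))) \<alpha>)
      + (\<Sum>c\<in>B. conv (\<lambda>\<mu> \<nu>. sc (coord (br z c) \<mu>) (contract (hp c C) \<nu>)) \<alpha>)"
    by (simp add: dz_eq fpartial_contract scale_right_distrib conv_add sum.distrib)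
  also have "\<dots> = (\<Sum>c\<in>B. \<Sum>b\<in>B. M b c) + (- br z (contract C \<alpha>) - (\<Sum>b\<in>B. \<Sum>c\<in>B. M b c))"
    unfolding 2 3 by (simp add: 1 contract_def sum_subtractf sum_negf br_right.sum)
  also have "(\<Sum>c\<in>B. \<Sum>b\<in>B. M b c) = (\<Sum>b\<in>B. \<Sum>c\<in>B. M b c)" by (rule sum.swap)
  finally show "dz z (contract C) \<alpha> = - br z (contract C \<alpha>)" by simp
qed

text \<open>
  Relative to \<open>\<gg> = \<ll> \<oplus> \<mm>\<close>, the mixed component of \<open>C\<close> is a closed \<open>\<mm>\<close>-valued 1-form and the component in
  \<open>\<wedge>\<^sup>2\<ll>\<close> is a closed 2-form on \<open>\<ll>\<^sup>*\<close>. The Euler homotopy on \<open>k\<close>-forms with coefficients of degree \<open>n\<close> has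
  the weight \<open>1 / (n + k)\<close>, hence the two weights below.
\<close>

lemma homotopy:
  assumes sk: "\<And>\<alpha>. C \<alpha> \<in> SK" and su: "supp C" and inv: "invariant C"
    and deg: "\<And>\<alpha>. size \<alpha> \<noteq> n \<Longrightarrow> C \<alpha> = 0"
    and closed: "\<And>\<xi> \<eta> \<zeta> \<alpha>. \<xi> \<in> D \<Longrightarrow> \<eta> \<in> D \<Longrightarrow> \<zeta> \<in> D \<Longrightarrow>
        cyc (\<lambda>\<xi> \<eta> \<zeta>. \<Sum>b\<in>B. \<xi> b * \<zeta> (hp b C \<alpha> \<eta>)) \<xi> \<eta> \<zeta> = 0"
    and red0: "\<And>\<alpha> \<xi>. \<xi> \<in> D \<Longrightarrow> P (C \<alpha> (\<xi> \<circ> P)) = 0"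
  obtains G where "supp G" "equivariant G" "\<And>\<alpha>. size \<alpha> \<noteq> Suc n \<Longrightarrow> G \<alpha> = 0"
    "\<And>\<alpha> \<xi>. \<xi> \<in> D \<Longrightarrow> vop G \<alpha> \<xi> - qop G \<alpha> \<xi> = C \<alpha> \<xi>"
proof
  have lC: "linF C" using sk by (simp add: linF_def skew_lin)
  define G where "G \<alpha> = sc (1 / of_nat (n + 1)) (P (contract C \<alpha>)) + sc (1 / of_nat (n + 2)) (Q (contract C \<alpha>))" for \<alpha>
  have c0: "contract C \<alpha> = 0" if "\<not> set_mset \<alpha> \<subseteq> B \<or> size \<alpha> \<noteq> Suc n" for \<alpha>
  proof -
    have "C (\<alpha> - {#b#}) = 0" if b: "b \<in> B" "b \<in># \<alpha>" for b
    proof (cases "size \<alpha> = Suc n")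
      case True
      then have "\<not> set_mset \<alpha> \<subseteq> B" using \<open>_ \<or> _\<close> by simp
      moreover have "set_mset \<alpha> = insert b (set_mset (\<alpha> - {#b#}))"
        using b by (metis insert_DiffM set_mset_add_mset_insert)
      ultimately show ?thesis using su b by (simp add: supp_def)
    next
      case False
      have "Suc (size (\<alpha> - {#b#})) = size \<alpha>" using b by (metis insert_DiffM size_add_mset)
      then have "size (\<alpha> - {#b#}) \<noteq> n" using False by linarith
      then show ?thesis by (rule deg)
    qed
    then show ?thesis unfolding contract_def conv_single by (intro sum.neutral) auto
  qed
  show "supp G" unfolding supp_def G_def using c0 by (simp add: P.zero Q.zero)
  show "G \<alpha> = 0" if "size \<alpha> \<noteq> Suc n" for \<alpha>
    unfolding G_def using c0 that by (simp add: P.zero Q.zero)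
  have Ge: "dz z (\<lambda>\<alpha>. sc (1 / of_nat (n + 1)) (P (contract C \<alpha>)) + sc (1 / of_nat (n + 2)) (Q (contract C \<alpha>))) \<alpha>
      = sc (1 / of_nat (n + 1)) (P (dz z (contract C) \<alpha>)) + sc (1 / of_nat (n + 2)) (Q (dz z (contract C) \<alpha>))" for z \<alpha>
    by (rule dz_map[where h = "\<lambda>x. sc (1 / of_nat (n + 1)) (P x) + sc (1 / of_nat (n + 2)) (Q x)"])
      (simp_all add: P_add Q_add P_scale Q_scale scale_right_distrib algebra_simps del: of_nat_Suc of_nat_add)
  show "equivariant G"
    unfolding equivariant_def G_def[abs_def] Ge
    using equivariantD[OF equivariant_contract[OF inv lC]]
    by (simp add: P.minus Q.minus P_br Q_br br_add_right br_scale_right del: of_nat_Suc of_nat_add)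
  fix \<alpha> \<xi> assume \<xi>: "\<xi> \<in> D"
  show "vop G \<alpha> \<xi> - qop G \<alpha> \<xi> = C \<alpha> \<xi>"
  proof (cases "size \<alpha> = n")
    case False
    then have "pd b G \<alpha> = 0" for b
      unfolding G_def fpartial_def using c0 by (simp add: P.zero Q.zero)
    then show ?thesis using deg[OF False] \<xi> by (simp add: vop_def qop_def dual_zero)
  next
    case True
    define K where "K \<xi> \<zeta> = \<zeta> (C \<alpha> \<xi>)" for \<xi> and \<zeta> :: "'g \<Rightarrow> 'k"
    define Y where "Y \<xi> \<zeta> = (\<Sum>c\<in>B. \<xi> c * \<zeta> (contract (hp c C) \<alpha>))" for \<xi> \<zeta> :: "'g \<Rightarrow> 'k"
    define H where "H \<xi> \<zeta> = (\<Sum>c\<in>B. \<xi> c * \<zeta> (pd c G \<alpha>))" for \<xi> \<zeta> :: "'g \<Rightarrow> 'k"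
    \<comment> \<open>Cartan's formula for a closed form: closedness at
      \<open>(\<xi>, e b, \<zeta>)\<close>, multiplied by the coordinate of \<open>b\<close> and
      summed, leaves the Euler derivative, which is \<open>n\<close> in degree
      \<open>n\<close>.\<close>
    have Y: "Y \<xi> \<zeta> - Y \<zeta> \<xi> = of_nat n * K \<xi> \<zeta>" if d: "\<xi> \<in> D" "\<zeta> \<in> D" for \<xi> \<zeta>
    proof -
      define N where "N \<xi> \<eta> \<zeta> \<nu> = (\<Sum>c\<in>B. \<xi> c * \<zeta> (hp c C \<nu> \<eta>))" for \<xi> \<eta> \<nu> and \<zeta> :: "'g \<Rightarrow> 'k"
      have Y_N: "Y \<xi> \<zeta> = (\<Sum>b\<in>B. cmul b (\<lambda>\<nu>. N \<xi> (e b) \<zeta> \<nu>) \<alpha>)" if "\<zeta> \<in> D" for \<xi> \<zeta>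
      proof -
        have "Y \<xi> \<zeta> = (\<Sum>c\<in>B. \<Sum>b\<in>B. cmul b (\<lambda>\<nu>. \<xi> c * \<zeta> (hp c C \<nu> (e b))) \<alpha>)"
          unfolding Y_def contract_def dual_sum[OF that] dual_conv[OF that] sum_distrib_left mult_conv
          by (intro sum.cong refl conv_cong) (simp add: dual_zero that)
        also have "\<dots> = (\<Sum>b\<in>B. \<Sum>c\<in>B. cmul b (\<lambda>\<nu>. \<xi> c * \<zeta> (hp c C \<nu> (e b))) \<alpha>)"
          by (rule sum.swap)
        also have "\<dots> = (\<Sum>b\<in>B. cmul b (\<lambda>\<nu>. N \<xi> (e b) \<zeta> \<nu>) \<alpha>)"
          unfolding conv_sum[symmetric] N_def by (intro sum.cong refl conv_cong) simp
        finally show ?thesis .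
      qed
      have "N \<xi> (e b) \<zeta> \<nu> - N \<zeta> (e b) \<xi> \<nu> = \<zeta> (hp b C \<nu> \<xi>)" if "b \<in> B" for b \<nu>
      proof -
        have "(\<Sum>c\<in>B. e b c * \<xi> (hp c C \<nu> \<zeta>)) = (\<Sum>c\<in>B. if c = b then \<xi> (hp b C \<nu> \<zeta>) else 0)"
          by (rule sum.cong) (use that in \<open>auto simp: e_B\<close>)
        then have "N (e b) \<zeta> \<xi> \<nu> = \<xi> (hp b C \<nu> \<zeta>)" unfolding N_def using that by simp
        moreover have "N \<zeta> \<xi> (e b) \<nu> = - N \<zeta> (e b) \<xi> \<nu>"
          unfolding N_def sum_negf[symmetric] skew_skew[OF hp_skew[OF sk] e_dual d(1)] by simp
        moreover have "\<xi> (hp b C \<nu> \<zeta>) = - \<zeta> (hp b C \<nu> \<xi>)"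
          by (rule skew_skew[OF hp_skew[OF sk] d])
        ultimately show ?thesis
          using closed[OF d(1) e_dual[of b] d(2), of \<nu>] unfolding cyc_def N_def[symmetric] by (simp add: algebra_simps)
      qed
      then have "Y \<xi> \<zeta> - Y \<zeta> \<xi> = (\<Sum>b\<in>B. cmul b (\<lambda>\<nu>. \<zeta> (hp b C \<nu> \<xi>)) \<alpha>)"
        unfolding Y_N[OF d(1)] Y_N[OF d(2)] sum_subtractf[symmetric] conv_diff[symmetric]
        by (intro sum.cong refl conv_cong) simp
      also have "\<dots> = \<zeta> (\<Sum>b\<in>B. cmul b (\<lambda>\<nu>. hp b C \<nu> \<xi>) \<alpha>)"
        unfolding dual_sum[OF d(2)] dual_conv[OF d(2)] by (intro sum.cong refl conv_cong) (simp add: dual_zero d)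
      finally show ?thesis using d by (simp add: Euler[OF su] dual_scale True K_def)
    qed
    \<comment> \<open>Derivatives exist only in the directions of \<open>B\<close>, so the first
      argument enters through its restriction to \<open>\<ll>\<close>.\<close>
    have YP: "Y (\<xi> \<circ> P) \<zeta> = 0" "Y (\<xi> \<circ> Q) \<zeta> = Y \<xi> \<zeta>" if "\<xi> \<in> D" for \<xi> \<zeta>
      unfolding Y_def using that by (simp_all add: P_\<ll> Q_id B_\<ll> dual_zero)
    have H: "H \<xi> \<zeta> = K (\<xi> \<circ> Q) (\<zeta> \<circ> P) + 1 / of_nat (n + 2) * (K (\<xi> \<circ> Q) (\<zeta> \<circ> Q) + Y (\<xi> \<circ> Q) (\<zeta> \<circ> Q))"
      if d: "\<xi> \<in> D" "\<zeta> \<in> D" for \<xi> \<zeta>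
    proof -
      have dx: "\<xi> \<circ> Q \<in> D" "\<zeta> \<circ> P \<in> D" "\<zeta> \<circ> Q \<in> D" using d by (simp_all add: comp_P_Q_dual)
      have K_Q: "(\<Sum>c\<in>B. \<xi> c * \<zeta>' (C \<alpha> (e c))) = K (\<xi> \<circ> Q) \<zeta>'" if "\<zeta>' \<in> D" for \<zeta>'
        unfolding K_def dual_Q_expand[OF d(1)] using sk that by (simp add: skew_sum dual_closed skew_scale dual_simps)
      have "pd c G \<alpha> = sc (1 / of_nat (n + 1)) (P (pd c (contract C) \<alpha>))
          + sc (1 / of_nat (n + 2)) (Q (pd c (contract C) \<alpha>))" for c
        by (simp add: fpartial_def G_def P_scale Q_scale scale_right_distrib mult.commute del: of_nat_Suc of_nat_add)
      then have "H \<xi> \<zeta> = (\<Sum>c\<in>B. 1 / of_nat (n + 1) * (\<xi> c * (\<zeta> \<circ> P) (C \<alpha> (e c)) + \<xi> c * (\<zeta> \<circ> P) (contract (hp c C) \<alpha>))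
          + 1 / of_nat (n + 2) * (\<xi> c * (\<zeta> \<circ> Q) (C \<alpha> (e c)) + \<xi> c * (\<zeta> \<circ> Q) (contract (hp c C) \<alpha>)))"
        unfolding H_def using d by (intro sum.cong refl)
          (simp add: fpartial_contract P_add Q_add dual_simps distrib_left mult.left_commute del: of_nat_Suc of_nat_add)
      also have "\<dots> = 1 / of_nat (n + 1) * (K (\<xi> \<circ> Q) (\<zeta> \<circ> P) + Y \<xi> (\<zeta> \<circ> P))
          + 1 / of_nat (n + 2) * (K (\<xi> \<circ> Q) (\<zeta> \<circ> Q) + Y \<xi> (\<zeta> \<circ> Q))"
        unfolding sum.distrib sum_distrib_left[symmetric] K_Q[OF dx(2)] K_Q[OF dx(3)] Y_def[symmetric] ..
      \<comment> \<open>With \<open>\<zeta> \<circ> P\<close> in first place \<open>Y\<close>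
        vanishes, so Cartan's formula gives \<open>n\<close> copies of \<open>K\<close>. With the
        copy already present there are \<open>n + 1\<close>, which the weight normalises.\<close>
      also have "Y \<xi> (\<zeta> \<circ> P) = of_nat n * K (\<xi> \<circ> Q) (\<zeta> \<circ> P)"
        using Y[OF dx(1,2)] YP d by simp
      also have "Y \<xi> (\<zeta> \<circ> Q) = Y (\<xi> \<circ> Q) (\<zeta> \<circ> Q)" using YP d by simp
      also have "1 / of_nat (n + 1) * (K (\<xi> \<circ> Q) (\<zeta> \<circ> P) + of_nat n * K (\<xi> \<circ> Q) (\<zeta> \<circ> P)) = K (\<xi> \<circ> Q) (\<zeta> \<circ> P)"
      proof -
        have "K (\<xi> \<circ> Q) (\<zeta> \<circ> P) + of_nat n * K (\<xi> \<circ> Q) (\<zeta> \<circ> P) = of_nat (n + 1) * K (\<xi> \<circ> Q) (\<zeta> \<circ> P)"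
          by (simp add: algebra_simps)
        moreover have "of_nat (n + 1) \<noteq> (0 :: 'k)" by (simp only: of_nat_eq_0_iff)
        ultimately show ?thesis by (simp del: of_nat_add)
      qed
      finally show ?thesis .
    qed
    have Ks: "K \<xi> \<zeta> = - K \<zeta> \<xi>" if "\<xi> \<in> D" "\<zeta> \<in> D" for \<xi> \<zeta>
      unfolding K_def by (rule skew_skew[OF sk that(2,1)])
    show ?thesis
    proof (rule dual_separates)
      fix \<zeta> assume \<zeta>: "\<zeta> \<in> D"
      let ?i = "1 / of_nat (n + 2) :: 'k"
      have d: "\<xi> \<circ> Q \<in> D" "\<zeta> \<circ> P \<in> D" "\<zeta> \<circ> Q \<in> D" "\<xi> \<circ> P \<in> D" using \<xi> \<zeta> by (simp_all add: comp_P_Q_dual)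
      have "\<zeta> (vop G \<alpha> \<xi> - qop G \<alpha> \<xi>) = H \<xi> \<zeta> - H \<zeta> \<xi>"
        using \<xi> \<zeta> by (simp add: vop_def qop_def dual_simps H_def mult.commute)
      \<comment> \<open>On the \<ll>-\<ll> component antisymmetrisation gives \<open>2 K\<close>
        from the skew form and \<open>n K\<close> from \<open>Y\<close>, which explains the weight
        \<open>1 / (n + 2)\<close>.\<close>
      also have "\<dots> = K (\<xi> \<circ> Q) (\<zeta> \<circ> P) + K (\<xi> \<circ> P) (\<zeta> \<circ> Q)
          + ?i * (2 * K (\<xi> \<circ> Q) (\<zeta> \<circ> Q) + of_nat n * K (\<xi> \<circ> Q) (\<zeta> \<circ> Q))"
        unfolding H[OF \<xi> \<zeta>] H[OF \<zeta> \<xi>] Y[OF d(1,3), symmetric] Ks[OF d(3,1)] Ks[OF d(3,4)]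
        by (simp add: algebra_simps)
      also have "2 * K (\<xi> \<circ> Q) (\<zeta> \<circ> Q) + of_nat n * K (\<xi> \<circ> Q) (\<zeta> \<circ> Q) = of_nat (n + 2) * K (\<xi> \<circ> Q) (\<zeta> \<circ> Q)"
        by (simp add: algebra_simps)
      also have "?i * \<dots> = K (\<xi> \<circ> Q) (\<zeta> \<circ> Q)"
      proof -
        have "of_nat (n + 2) \<noteq> (0 :: 'k)" by (simp only: of_nat_eq_0_iff)
        then show ?thesis by (simp del: of_nat_add)
      qed
      \<comment> \<open>Of the four components of \<open>C\<close> the \<mm>-\<mm> one is absent by
        \<open>red0\<close>; the other three are on the left.\<close>
      also have "K (\<xi> \<circ> Q) (\<zeta> \<circ> P) + K (\<xi> \<circ> P) (\<zeta> \<circ> Q) + K (\<xi> \<circ> Q) (\<zeta> \<circ> Q) = \<zeta> (C \<alpha> \<xi>)"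
      proof -
        have PQ: "P x + Q x = x" for x by (simp add: P_def)
        have "(\<xi> \<circ> P) + (\<xi> \<circ> Q) = \<xi>"
          by (intro ext) (simp only: plus_fun_apply o_apply dual_add[OF \<xi>, symmetric] PQ)
        with skew_add[OF sk d(4,1), of \<alpha>] have "C \<alpha> \<xi> = C \<alpha> (\<xi> \<circ> P) + C \<alpha> (\<xi> \<circ> Q)"
          by (simp only:)
        then have "\<zeta> (C \<alpha> \<xi>) = \<zeta> (C \<alpha> (\<xi> \<circ> P)) + \<zeta> (C \<alpha> (\<xi> \<circ> Q))"
          by (simp only: dual_add[OF \<zeta>])
        moreover have z: "\<zeta> x = \<zeta> (P x) + \<zeta> (Q x)" for x
          by (simp only: dual_add[OF \<zeta>, symmetric] PQ)
        note z[of "C \<alpha> (\<xi> \<circ> P)"] z[of "C \<alpha> (\<xi> \<circ> Q)"]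
        moreover have "\<zeta> (P (C \<alpha> (\<xi> \<circ> P))) = 0" by (simp only: red0[OF \<xi>] dual_zero[OF \<zeta>])
        ultimately show ?thesis
          unfolding K_def o_apply[of \<zeta>] by (simp only: add_0_left add_ac)
      qed
      finally show "\<zeta> (vop G \<alpha> \<xi> - qop G \<alpha> \<xi>) = \<zeta> (C \<alpha> \<xi>)" .
    qed
  qed
qed


section \<open>Gauge orbits\<close>

abbreviation act :: "('g, 'g) formal \<Rightarrow> ('g, 'k) hom_formal \<Rightarrow> ('g, 'k) hom_formal" where
  "act \<equiv> gauge_act sc br \<omega> B"

abbreviation dyn where "dyn \<equiv> Dynl sc br \<omega> \<phi> \<ll> B"
abbreviation gg where "gg \<equiv> gauge_group sc br \<ll> B"

text \<open>As \<open>S\<close> vanishes at 0, a coefficient of \<open>Top S f\<close> involves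
  \<open>f\<close> only in strictly smaller degree.\<close>

lemma Top_cong:
  assumes "\<And>\<mu>. size \<mu> \<le> size \<alpha> \<Longrightarrow> S' \<mu> = S \<mu>" "S {#} = 0" "linF f" "linF f'"
    and "\<And>\<mu>. size \<mu> < size \<alpha> \<Longrightarrow> f' \<mu> = f \<mu>"
  shows "Top S' f' \<alpha> = Top S f \<alpha>"
proof
  fix \<xi>
  show "Top S' f' \<alpha> \<xi> = Top S f \<alpha> \<xi>"
  proof (cases "\<xi> \<in> D")
    case True
    have "tt (S' \<mu>) (f' \<nu>) \<xi> = tt (S \<mu>) (f \<nu>) \<xi>" if "\<mu> + \<nu> = \<alpha>" for \<mu> \<nu>
    proof (cases "\<mu> = {#}")
      case True
      then show ?thesis using assms(1)[of "{#}"] assms(2-4) \<open>\<xi> \<in> D\<close> by (simp add: tt_zero_left linF_D)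
    next
      case False
      then have "size \<nu> < size \<alpha>" using split_size[OF that] by (cases \<mu>) auto
      then show ?thesis using assms(1)[of \<mu>] assms(5) split_size[OF that] by simp
    qed
    then show ?thesis unfolding Top_conv[OF True] by (rule conv_cong)
  qed (simp add: Top_off)
qed

text \<open>Agreement below degree \<open>n\<close> extends to degree \<open>n\<close> as soon as T
  has been applied at least once; this is what the disjunction records.\<close>

lemma Top_pow_cong:
  assumes "\<And>\<mu>. size \<mu> \<le> n \<Longrightarrow> S' \<mu> = S \<mu>" "S {#} = 0" "linF f" "linF f'"
    and "\<And>\<mu>. size \<mu> < n \<Longrightarrow> f' \<mu> = f \<mu>" "size \<alpha> < n \<or> size \<alpha> \<le> n \<and> 0 < k"
  shows "(Top S' ^^ k) f' \<alpha> = (Top S ^^ k) f \<alpha>"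
  using assms(6)
proof (induction k arbitrary: \<alpha>)
  case (Suc k)
  show ?case
    unfolding funpow.simps o_apply
    by (rule Top_cong) (use Suc assms linF_pow(3) in auto)
qed (simp add: assms)

lemma uop_perturb:
  assumes "\<And>\<mu>. S' \<mu> = S \<mu> + G \<mu>" "G \<alpha> = 0"
  shows "uop S' \<alpha> \<xi> = uop S \<alpha> \<xi> + (vop G \<alpha> \<xi> - qop G \<alpha> \<xi>)"
proof (cases "\<xi> \<in> D")
  case True
  have "pd b S' \<alpha> = pd b S \<alpha> + pd b G \<alpha>" for b
    by (simp add: fpartial_def assms(1) scale_right_distrib)
  then show ?thesis
    using True assms by (simp add: uop_def vop_def qop_def scale_right_distrib scale_left_distrib sum.distrib dual_simps)
qed (simp add: uop_off vop_def qop_def)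

text \<open>A change of \<Sigma> starting in degree \<open>n + 1\<close> reaches degree
  \<open>n\<close> only through a derivative to which T has not been applied: the term
  \<open>k = 0\<close> of the series in \<open>uop\<close>, whose coefficient is 1.\<close>

lemma gauge_act_perturb:
  assumes l: "\<And>\<alpha>. l \<alpha> \<in> SK" and S: "S {#} = 0" "equivariant S" "S' {#} = 0" "equivariant S'"
    and G: "\<And>\<mu>. S' \<mu> = S \<mu> + G \<mu>" "\<And>\<mu>. size \<mu> \<le> n \<Longrightarrow> G \<mu> = 0" and n: "size \<alpha> \<le> n"
  shows "act S' l \<alpha> \<xi> = act S l \<alpha> \<xi> + (vop G \<alpha> \<xi> - qop G \<alpha> \<xi>)"
proof -
  have ll: "linF l" using l by (simp add: linF_def skew_lin)
  have SS: "S' \<mu> = S \<mu>" if "size \<mu> \<le> n" for \<mu> using G that by simp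
  have u: "uop S' \<mu> = uop S \<mu>" if "size \<mu> < n" for \<mu>
  proof
    fix \<xi>
    have "pd b G \<mu> = 0" for b using G(2)[of "add_mset b \<mu>"] that by (simp add: fpartial_def)
    then have "vop G \<mu> \<xi> = 0" "qop G \<mu> \<xi> = 0" by (simp_all add: vop_def qop_def dual_zero)
    then show "uop S' \<mu> \<xi> = uop S \<mu> \<xi>"
      using uop_perturb[where G = G and \<alpha> = \<mu>, OF G(1) G(2)] that by simp
  qed
  have "(Top S' ^^ k) l \<alpha> = (Top S ^^ k) l \<alpha>" for k
  proof (cases k)
    case (Suc j)
    show ?thesis
      by (rule Top_pow_cong[where n = n and S = S and S' = S' and f = l and f' = l, OF SS S(1) ll ll]) (use n Suc in auto)
  qed simp
  then have 1: "(\<Sum>k\<le>size \<alpha>. sc (1 / fact k) ((Top S' ^^ k) l \<alpha> \<xi>)) = (\<Sum>k\<le>size \<alpha>. sc (1 / fact k) ((Top S ^^ k) l \<alpha> \<xi>))"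
    by simp
  have "(Top S' ^^ k) (uop S') \<alpha> = (Top S ^^ k) (uop S) \<alpha>" if "0 < k" for k
    by (rule Top_pow_cong[where n = n and S = S and S' = S' and f = "uop S" and f' = "uop S'", OF SS S(1) linF_uop linF_uop u]) (use n that in auto)
  then have 2: "(\<Sum>k<size \<alpha>. sc (1 / fact (Suc (Suc k))) ((Top S' ^^ Suc k) (uop S') \<alpha> \<xi>))
      = (\<Sum>k<size \<alpha>. sc (1 / fact (Suc (Suc k))) ((Top S ^^ Suc k) (uop S) \<alpha> \<xi>))"
    by (simp del: funpow.simps fact_Suc)
  show ?thesis
    unfolding gauge_act_eq[OF l S(1) Rop_vop[OF S(2)]] gauge_act_eq[OF l S(3) Rop_vop[OF S(4)]]
      1 sum.atMost_shift[of _ "size \<alpha>"] 2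
    using uop_perturb[where G = G and \<alpha> = \<alpha>, OF G(1) G(2)[OF n]] by (simp add: algebra_simps)
qed

text \<open>The component of \<open>l\<^sub>0\<close> in \<open>\<wedge>\<^sup>2\<mm>\<close>.\<close>

definition red_part :: "('g, 'k) hom_formal \<Rightarrow> ('g \<Rightarrow> 'k) \<Rightarrow> 'g" where
  "red_part l \<xi> = (if \<xi> \<in> D then P (l {#} (\<xi> \<circ> P)) else 0)"

lemma gauge_act_0:
  assumes "\<And>\<alpha>. l \<alpha> \<in> SK" "S \<in> gg"
  shows "act S l {#} \<xi> = l {#} \<xi> + (vop S {#} \<xi> - qop S {#} \<xi>)"
proof -
  have "S {#} = 0" "equivariant S" using assms(2) by (auto simp: gauge_group_iff)
  then show ?thesis
    by (simp add: gauge_act_eq[OF assms(1) _ Rop_vop] uop_def \<omega>_zero)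
qed

text \<open>\<open>\<xi> \<circ> P\<close> vanishes on \<open>B\<close>, which kills
  \<open>vop\<close>, and \<open>qop\<close> takes values in \<open>\<ll>\<close>, which
  \<open>P\<close> kills.\<close>

lemma red_part_gauge:
  assumes "\<And>\<alpha>. l \<alpha> \<in> SK" "S \<in> gg"
  shows "red_part (act S l) = red_part l"
proof
  fix \<xi>
  show "red_part (act S l) \<xi> = red_part l \<xi>"
  proof (cases "\<xi> \<in> D")
    case True
    then have "P (vop S {#} (\<xi> \<circ> P)) = 0" "P (qop S {#} (\<xi> \<circ> P)) = 0"
      by (simp_all add: vop_def qop_def comp_P_Q_dual P.sum P_scale P_\<ll> B_\<ll> dual_zero P.zero)
    with True show ?thesis
      by (simp add: red_part_def gauge_act_0[OF assms] P_add P.diff del: o_apply)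
  qed (simp add: red_part_def)
qed

lemma dynD:
  assumes "l \<in> dyn"
  shows "l \<alpha> \<in> SK" "supp l" "invariant l"
    "\<xi> \<in> D \<Longrightarrow> \<eta> \<in> D \<Longrightarrow> \<zeta> \<in> D \<Longrightarrow> Lin l \<alpha> \<xi> \<eta> \<zeta> + Quad l l \<alpha> \<xi> \<eta> \<zeta> + Con \<alpha> \<xi> \<eta> \<zeta> = 0"
  using assms by (auto simp: Dynl_iff)

text \<open>The coadjoint field is linear in p, so the degree lost by differentiating is restored by
  multiplying. Equivariance and invariance can therefore be checked degree by degree.\<close>

lemma dz_homogeneous:
  assumes "\<And>\<mu>. size \<mu> = size \<alpha> \<Longrightarrow> f \<mu> = g \<mu>" "z \<in> \<ll>"
  shows "dz z f \<alpha> = dz z g \<alpha>"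
  unfolding dz_eq
proof (intro sum.cong refl conv_cong)
  fix b \<mu> \<nu> assume b: "b \<in> B" and s: "\<mu> + \<nu> = \<alpha>"
  show "sc (coord (br z b) \<mu>) (pd b f \<nu>) = sc (coord (br z b) \<mu>) (pd b g \<nu>)"
  proof (cases "size \<mu> = 1")
    case True
    then have "size (add_mset b \<nu>) = size \<alpha>" using split_size[OF s] by simp
    from assms(1)[OF this] show ?thesis by (simp add: fpartial_def)
  next
    case False
    then have "coord (br z b) \<mu> = 0"
      using assms(2) b by (auto simp: feval_eq br_\<ll> B_\<ll> intro!: sum.neutral)
    then show ?thesis by simp
  qed
qed

lemma dz_zero: "dz z (\<lambda>\<mu>. 0) \<alpha> = 0"
  by (simp add: dz_eq fpartial_def)

lemma dz_diff: "dz z (\<lambda>\<mu>. f \<mu> - g \<mu>) \<alpha> = dz z f \<alpha> - dz z g \<alpha>"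
  by (simp add: dz_eq fpartial_def scale_right_diff_distrib conv_diff sum_subtractf)

lemma equivariant_add: "equivariant S \<Longrightarrow> equivariant G \<Longrightarrow> equivariant (\<lambda>\<mu>. S \<mu> + G \<mu>)"
  by (simp add: equivariant_def dz_eq fpartial_def scale_right_distrib conv_add sum.distrib br_add_right)

text \<open>If two dynamical \<open>\<ell>\<close>-matrices agree below degree \<open>n\<close>, their difference in degree \<open>n\<close> is closed and invariant,
  so the homotopy provides a gauge transformation of degree \<open>n + 1\<close> that removes it.\<close>

lemma gauge_step:
  assumes l: "l \<in> dyn" and l': "l' \<in> dyn" and r: "red_part l = red_part l'" and S: "S \<in> gg"
    and eq: "\<And>\<alpha>. size \<alpha> < n \<Longrightarrow> act S l \<alpha> = l' \<alpha>"
  shows "\<exists>S'\<in>gg. (\<forall>\<alpha>. size \<alpha> \<le> n \<longrightarrow> S' \<alpha> = S \<alpha>) \<and> (\<forall>\<alpha>. size \<alpha> \<le> n \<longrightarrow> act S' l \<alpha> = l' \<alpha>)"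
proof -
  let ?l = "act S l"
  have d: "?l \<in> dyn" using gauge_act_Dynl[OF l S] .
  note L = dynD[OF d] and L' = dynD[OF l']
  define C where "C \<alpha> = (if size \<alpha> = n then fun_scale sc (-1) (?l \<alpha>) + l' \<alpha> else 0)" for \<alpha>
  have C_eq: "C \<alpha> \<xi> = (if size \<alpha> = n then l' \<alpha> \<xi> - ?l \<alpha> \<xi> else 0)" for \<alpha> \<xi>
    by (simp add: C_def fun_scale_def)
  have C_sk: "C \<alpha> \<in> SK" for \<alpha>
    unfolding C_def using L(1) L'(1) by (simp only: skew_add_closed skew_scale_closed zero_skew split: if_split) simp
  have C_supp: "supp C"
    unfolding supp_def using L(2) L'(2) by (auto simp: supp_def fun_eq_iff C_eq)
  have C_inv: "invariant C"
  proof (rule invariantI)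
    fix z \<xi> \<alpha> assume z: "z \<in> \<ll>" "\<xi> \<in> D"
    show "dz z (\<lambda>\<mu>. C \<mu> \<xi>) \<alpha> = - br z (C \<alpha> \<xi>) - C \<alpha> (\<xi> \<circ> br z)"
    proof (cases "size \<alpha> = n")
      case True
      then have "dz z (\<lambda>\<mu>. C \<mu> \<xi>) \<alpha> = dz z (\<lambda>\<mu>. l' \<mu> \<xi> - ?l \<mu> \<xi>) \<alpha>"
        by (intro dz_homogeneous z) (simp add: C_eq)
      then show ?thesis
        using True by (simp add: dz_diff invariantD[OF L(3) z] invariantD[OF L'(3) z] C_eq br_right.diff del: o_apply)
    next
      case False
      then have "dz z (\<lambda>\<mu>. C \<mu> \<xi>) \<alpha> = dz z (\<lambda>\<mu>. 0) \<alpha>"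
        by (intro dz_homogeneous z) (simp add: C_eq)
      then show ?thesis using False by (simp add: dz_zero C_eq br_right.zero)
    qed
  qed
  have closed: "cyc (\<lambda>\<xi> \<eta> \<zeta>. \<Sum>b\<in>B. \<xi> b * \<zeta> (hp b C \<alpha> \<eta>)) \<xi> \<eta> \<zeta> = 0"
    if D3: "\<xi> \<in> D" "\<eta> \<in> D" "\<zeta> \<in> D" for \<xi> \<eta> \<zeta> \<alpha>
  proof (cases "Suc (size \<alpha>) = n")
    case True
    \<comment> \<open>In degree \<open>n - 1\<close> and below the two maps agree, so the difference
      of their equations retains only the derivatives, which see degree \<open>n\<close>.\<close>
    have "Quad ?l ?l \<alpha> = Quad l' l' \<alpha>" by (rule Quad_cong) (use eq True in auto)
    with L(4)[OF D3, of \<alpha>] have "Lin ?l \<alpha> \<xi> \<eta> \<zeta> + Quad l' l' \<alpha> \<xi> \<eta> \<zeta> + Con \<alpha> \<xi> \<eta> \<zeta> = 0"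
      by (simp only:)
    with L'(4)[OF D3, of \<alpha>] have lin0: "Lin l' \<alpha> \<xi> \<eta> \<zeta> - Lin ?l \<alpha> \<xi> \<eta> \<zeta> = 0"
      by (metis add_right_cancel cancel_comm_monoid_add_class.diff_cancel)
    have "hp b C \<alpha> \<eta> = hp b l' \<alpha> \<eta> - hp b ?l \<alpha> \<eta>" for b \<eta>
      using True by (simp add: hp_eq C_eq scale_right_diff_distrib)
    then have s: "(\<Sum>b\<in>B. \<xi> b * \<zeta> (hp b C \<alpha> \<eta>)) = (\<Sum>b\<in>B. \<xi> b * \<zeta> (hp b l' \<alpha> \<eta>)) - (\<Sum>b\<in>B. \<xi> b * \<zeta> (hp b ?l \<alpha> \<eta>))"
      if "\<zeta> \<in> D" for \<xi> \<eta> \<zeta>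
      using that by (simp add: dual_diff right_diff_distrib sum_subtractf)
    have "?l \<alpha> = l' \<alpha>" using eq True by simp
    with lin0 show ?thesis
      unfolding cyc_def s[OF D3(1)] s[OF D3(2)] s[OF D3(3)] by (simp add: Lin_def cyc_def algebra_simps)
  next
    case False
    then have "hp b C \<alpha> \<eta> = 0" for b \<eta> by (simp add: hp_eq C_eq)
    then show ?thesis using D3 by (simp add: cyc_def dual_zero)
  qed
  have red0: "P (C \<alpha> (\<xi> \<circ> P)) = 0" if \<xi>: "\<xi> \<in> D" for \<alpha> \<xi>
  proof (cases \<alpha>)
    case empty
    \<comment> \<open>In degree 0 closedness gives no information; here the equality of the
      invariants enters.\<close>
    have "P (?l {#} (\<xi> \<circ> P)) = P (l' {#} (\<xi> \<circ> P))"
      using fun_cong[OF r, of \<xi>] fun_cong[OF red_part_gauge[where l = l, OF dynD(1)[OF l] S], where x = \<xi>] \<xi> by (simp add: red_part_def)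
    then show ?thesis by (simp add: empty C_eq P.diff P.zero)
  next
    case (add b \<alpha>')
    show ?thesis
    proof (cases "b \<in> B")
      case True
      show ?thesis
      proof (rule dual_separates)
        fix \<zeta> assume \<zeta>: "\<zeta> \<in> D"
        have "(\<Sum>c\<in>B. e b c * (\<zeta> \<circ> P) (hp c C \<alpha>' (\<xi> \<circ> P))) = (\<Sum>c\<in>B. if c = b then (\<zeta> \<circ> P) (hp b C \<alpha>' (\<xi> \<circ> P)) else 0)"
          by (rule sum.cong) (use True in \<open>auto simp: e_B\<close>)
        also have "\<dots> = (\<zeta> \<circ> P) (hp b C \<alpha>' (\<xi> \<circ> P))" using True by simp
        \<comment> \<open>In the closedness at
          \<open>(e b, \<xi> \<circ> P, \<zeta> \<circ> P)\<close> two cyclic terms drop out because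
          their directions vanish on \<open>B\<close>. So the \<mm>-\<mm> component has zero
          derivative and no coefficient of positive degree.\<close>
        finally have "(\<zeta> \<circ> P) (hp b C \<alpha>' (\<xi> \<circ> P)) = 0"
          using closed[OF e_dual[of b] comp_P_Q_dual(1)[OF \<xi>] comp_P_Q_dual(1)[OF \<zeta>], of \<alpha>']
          by (simp add: cyc_def P_\<ll> B_\<ll> dual_zero \<xi> \<zeta>)
        moreover have "of_nat (Suc (count \<alpha>' b)) \<noteq> (0 :: 'k)" by (simp only: of_nat_eq_0_iff)
        ultimately show "\<zeta> (P (C \<alpha> (\<xi> \<circ> P))) = \<zeta> 0"
          using \<zeta> by (simp add: hp_eq add P_scale dual_simps del: of_nat_Suc)
      qed
    next
      case False
      then have "C \<alpha> = 0" using C_supp by (simp add: supp_def add)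
      then show ?thesis by (simp add: P.zero)
    qed
  qed
  have deg: "C \<alpha> = 0" if "size \<alpha> \<noteq> n" for \<alpha> using that by (simp add: C_def)
  obtain G where G: "supp G" "equivariant G" "\<And>\<alpha>. size \<alpha> \<noteq> Suc n \<Longrightarrow> G \<alpha> = 0"
    "\<And>\<alpha> \<xi>. \<xi> \<in> D \<Longrightarrow> vop G \<alpha> \<xi> - qop G \<alpha> \<xi> = C \<alpha> \<xi>"
    using homotopy[where C = C and n = n, OF C_sk C_supp C_inv deg closed red0] by blast
  define S' where "S' \<mu> = S \<mu> + G \<mu>" for \<mu>
  have S0: "supp S" "S {#} = 0" "equivariant S" using S by (auto simp: gauge_group_iff)
  have S'0: "supp S'" "S' {#} = 0" "equivariant S'"
    using S0 G unfolding S'_def[abs_def] by (auto simp: supp_def intro: equivariant_add)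
  have "act S' l \<alpha> = l' \<alpha>" if n: "size \<alpha> \<le> n" for \<alpha>
  proof
    fix \<xi>
    show "act S' l \<alpha> \<xi> = l' \<alpha> \<xi>"
    proof (cases "\<xi> \<in> D")
      case True
      have "act S' l \<alpha> \<xi> = ?l \<alpha> \<xi> + C \<alpha> \<xi>"
        using gauge_act_perturb[where S' = S' and S = S and G = G and n = n, OF dynD(1)[OF l] S0(2,3) S'0(2,3) S'_def G(3) n] G(4)[OF True]
        by simp
      then show ?thesis using n eq[of \<alpha>] by (auto simp: C_eq)
    next
      case False
      then show ?thesis using skew_off[OF L'(1)] by (simp add: gauge_act_def)
    qed
  qed
  moreover have "S' \<in> gg" using S'0 by (simp add: gauge_group_iff)
  moreover have "S' \<alpha> = S \<alpha>" if "size \<alpha> \<le> n" for \<alpha> using G(3) that by (simp add: S'_def)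
  ultimately show ?thesis by blast
qed

lemma zero_gauge: "(\<lambda>\<alpha>. 0) \<in> gg"
  by (simp add: gauge_group_iff supp_def equivariant_def dz_zero br_right.zero)

lemma gauge_transitive:
  assumes l: "l \<in> dyn" and l': "l' \<in> dyn" and r: "red_part l = red_part l'"
  shows "\<exists>S\<in>gg. act S l = l'"
proof -
  define ok where "ok n S \<longleftrightarrow> S \<in> gg \<and> (\<forall>\<alpha>. size \<alpha> < n \<longrightarrow> act S l \<alpha> = l' \<alpha>)" for n S
  have "\<exists>s. \<forall>n. ok n (s n) \<and> (\<forall>\<alpha>. size \<alpha> \<le> n \<longrightarrow> s (Suc n) \<alpha> = s n \<alpha>)"
  proof (rule dependent_nat_choice)
    show "\<exists>S. ok 0 S" using zero_gauge by (auto simp: ok_def)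
    show "\<exists>S'. ok (Suc n) S' \<and> (\<forall>\<alpha>. size \<alpha> \<le> n \<longrightarrow> S' \<alpha> = S \<alpha>)" if "ok n S" for S n
      using gauge_step[OF l l' r, of S n] that by (auto simp: ok_def less_Suc_eq_le)
  qed
  then obtain s where s: "\<And>n. s n \<in> gg" "\<And>n \<alpha>. size \<alpha> < n \<Longrightarrow> act (s n) l \<alpha> = l' \<alpha>"
    and step: "\<And>n \<alpha>. size \<alpha> \<le> n \<Longrightarrow> s (Suc n) \<alpha> = s n \<alpha>"
    unfolding ok_def by blast
  \<comment> \<open>From index \<open>size \<alpha>\<close> on, the coefficient at
    \<open>\<alpha>\<close> no longer changes, so this is the coefficientwise limit.\<close>
  define S where "S \<alpha> = s (size \<alpha>) \<alpha>" for \<alpha>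
  have S_eq: "S \<alpha> = s n \<alpha>" if "size \<alpha> \<le> n" for \<alpha> n
    using that by (induction n rule: dec_induct) (simp_all add: S_def step)
  have s0: "supp (s n)" "s n {#} = 0" "equivariant (s n)" for n using s(1)[of n] by (auto simp: gauge_group_iff)
  have S0: "supp S" "S {#} = 0" using s0 by (auto simp: supp_def S_def)
  have S1: "equivariant S"
    unfolding equivariant_def
  proof (intro ballI allI)
    fix z \<alpha> assume z: "z \<in> \<ll>"
    have "dz z S \<alpha> = dz z (s (size \<alpha>)) \<alpha>"
      by (rule dz_homogeneous[OF _ z]) (simp add: S_def)
    then show "dz z S \<alpha> = - br z (S \<alpha>)" using equivariantD[OF s0(3) z] by (simp add: S_def)
  qed
  have "act S l \<alpha> \<xi> = l' \<alpha> \<xi>" for \<alpha> \<xi>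
  proof -
    \<comment> \<open>One degree above \<open>\<alpha>\<close>: the action contains a derivative, so
      \<open>G\<close> also has to vanish at \<open>add_mset b \<alpha>\<close>.\<close>
    let ?n = "Suc (size \<alpha>)"
    define G where "G \<mu> = S \<mu> - s ?n \<mu>" for \<mu>
    have G0: "G \<mu> = 0" if "size \<mu> \<le> ?n" for \<mu> using S_eq[OF that] by (simp add: G_def)
    have "act S l \<alpha> \<xi> = act (s ?n) l \<alpha> \<xi> + (vop G \<alpha> \<xi> - qop G \<alpha> \<xi>)"
      by (rule gauge_act_perturb[where n = ?n, OF dynD(1)[OF l] s0(2,3) S0(2) S1 _ G0]) (simp_all add: G_def)
    moreover have "pd b G \<alpha> = 0" for b using G0[of "add_mset b \<alpha>"] by (simp add: fpartial_def)
    then have "vop G \<alpha> \<xi> = 0" "qop G \<alpha> \<xi> = 0" by (simp_all add: vop_def qop_def dual_zero)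
    ultimately show ?thesis using s(2)[of \<alpha> ?n] by simp
  qed
  then have "act S l = l'" by (intro ext)
  moreover have "S \<in> gg" using S0 S1 by (simp add: gauge_group_iff)
  ultimately show ?thesis by blast
qed


section \<open>Reduced representatives\<close>

lemma annihilator_\<ll>:
  assumes "\<xi> \<in> annihilator sc \<ll>"
  shows "\<xi> \<in> D" "\<And>x. x \<in> \<ll> \<Longrightarrow> \<xi> x = 0" "\<xi> \<circ> P = \<xi>"
proof -
  show d: "\<xi> \<in> D" using assms by (simp add: annihilator_def)
  show z: "\<xi> x = 0" if "x \<in> \<ll>" for x using assms that by (simp add: annihilator_def)
  show "\<xi> \<circ> P = \<xi>" using z[OF Q_\<ll>] by (simp add: fun_eq_iff P_def dual_diff[OF d])
qed

text \<open>The coadjoint field vanishes at p = 0, so the derivative term of the invariance equation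
  is absent there.\<close>

lemma dynl_0_invariant:
  assumes "l \<in> dyn" "z \<in> \<ll>" "\<xi> \<in> D"
  shows "br z (l {#} \<xi>) = - l {#} (\<xi> \<circ> br z)"
proof -
  have "dz z (\<lambda>\<mu>. l \<mu> \<xi>) {#} = 0"
    using assms(2) by (simp add: dz_eq feval_eq br_\<ll> B_\<ll>)
  then have "- br z (l {#} \<xi>) = l {#} (\<xi> \<circ> br z)"
    using invariantD[OF dynD(3)[OF assms(1)] assms(2,3), of "{#}"] by (simp add: algebra_simps del: o_apply)
  then show ?thesis by (metis minus_minus)
qed

lemma red_part_skew:
  assumes "l \<in> dyn"
  shows "red_part l \<in> SK"
proof (rule skewI)
  note sk = dynD(1)[OF assms, of "{#}"]
  show "red_part l (\<xi> + \<eta>) = red_part l \<xi> + red_part l \<eta>" if "\<xi> \<in> D" "\<eta> \<in> D" for \<xi> \<eta>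
    using that sk by (simp add: red_part_def dual_add_closed add_comp skew_add comp_P_Q_dual P_add)
  show "red_part l (fs c \<xi>) = sc c (red_part l \<xi>)" if "\<xi> \<in> D" for c \<xi>
    using that sk by (simp add: red_part_def dual_closed fs_comp skew_scale comp_P_Q_dual P_scale)
  show "\<xi> (red_part l \<eta>) = - \<eta> (red_part l \<xi>)" if "\<xi> \<in> D" "\<eta> \<in> D" for \<xi> \<eta>
    using that skew_skew[OF sk comp_P_Q_dual(1)[OF that(1)] comp_P_Q_dual(1)[OF that(2)]] by (simp add: red_part_def)
qed (simp add: red_part_def)

lemma red_part_invariant:
  assumes "l \<in> dyn" "z \<in> \<ll>" "\<xi> \<in> D"
  shows "br z (red_part l \<xi>) = - red_part l (\<xi> \<circ> br z)"
proof -
  have "(\<xi> \<circ> br z) \<circ> P = (\<xi> \<circ> P) \<circ> br z" using assms(2) by (simp add: fun_eq_iff P_br)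
  then show ?thesis
    using assms dynl_0_invariant[OF assms(1,2) comp_P_Q_dual(1)[OF assms(3)]]
    by (simp add: red_part_def dual_closed P.minus flip: P_br del: o_apply)
qed

lemma red_part_wedge2:
  assumes "l \<in> dyn"
  shows "maps_into_wedge2 sc \<ll> \<mm> (red_part l)"
proof -
  have "\<xi> \<circ> P = 0" if "\<xi> \<in> annihilator sc \<mm>" for \<xi>
    using that P_\<mm> by (auto simp: annihilator_def fun_eq_iff)
  then show ?thesis
    using dynD(1)[OF assms, of "{#}"] P_\<mm> sub_\<mm>
    by (auto simp: maps_into_wedge2_def red_part_def skew_zero[of "l {#}"] P.zero subspace_0 simp del: o_apply)
qed

text \<open>\<open>\<xi> \<circ> Q\<close> annihilates \<open>\<mm>\<close> and contributes nothing;
  \<open>\<xi> \<circ> P\<close> annihilates \<open>\<ll>\<close>, so its image already lies in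
  \<open>\<mm>\<close> and is fixed by \<open>P\<close>.\<close>

lemma wedge2_red_part:
  assumes "l {#} \<in> SK" "maps_into_wedge2 sc \<ll> \<mm> (l {#})"
  shows "l {#} = red_part l"
proof
  fix \<xi>
  show "l {#} \<xi> = red_part l \<xi>"
  proof (cases "\<xi> \<in> D")
    case True
    have a: "\<xi> \<circ> Q \<in> annihilator sc \<mm>" "\<xi> \<circ> P \<in> annihilator sc \<ll>"
      using True by (auto simp: annihilator_def comp_P_Q_dual Q_\<mm> P_\<ll> dual_zero)
    have "P x + Q x = x" for x by (simp add: P_def)
    then have "(\<xi> \<circ> P) + (\<xi> \<circ> Q) = \<xi>"
      by (intro ext) (simp only: plus_fun_apply o_apply dual_add[OF True, symmetric])
    with skew_add[OF assms(1) comp_P_Q_dual[OF True]] have "l {#} \<xi> = l {#} (\<xi> \<circ> P) + l {#} (\<xi> \<circ> Q)"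
      by (simp only:)
    moreover have "l {#} (\<xi> \<circ> Q) = 0" "l {#} (\<xi> \<circ> P) \<in> \<mm>"
      using assms(2) a unfolding maps_into_wedge2_def by blast+
    ultimately show ?thesis
      using True by (simp add: red_part_def P_id del: o_apply)
  next
    case False
    then show ?thesis using assms(1) by (simp add: red_part_def skew_off)
  qed
qed

text \<open>At p = 0, with arguments vanishing on \<open>\<ll>\<close>, the derivatives disappear.
  On such arguments l_0 = t + q with q valued in \<open>\<ll>\<close>: \<open>\<omega>\<close> does
  not see q, brackets of two q values are killed, and the mixed brackets cancel in the cyclic
  sum.\<close>

lemma red_part_twist_form:
  assumes l: "l \<in> dyn" and x: "\<xi> \<in> annihilator sc \<ll>" "\<eta> \<in> annihilator sc \<ll>" "\<zeta> \<in> annihilator sc \<ll>"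
  shows "twist_form br \<omega> \<phi> (red_part l) \<xi> \<eta> \<zeta> = 0"
proof -
  define A where "A = annihilator sc \<ll>"
  define t where "t = red_part l"
  define q where "q \<xi> = Q (l {#} \<xi>)" for \<xi>
  define f where "f a b c = (c :: 'g \<Rightarrow> 'k) (br (q a) (t b))" for a b c
  have A: "a \<in> D" "b \<in> B \<Longrightarrow> a b = 0" "y \<in> \<ll> \<Longrightarrow> a y = 0" "a \<circ> P = a" if "a \<in> A" for a b y
    using annihilator_\<ll>[of a] that B_\<ll> by (auto simp: A_def)
  have lt: "l {#} a = t a + q a" if "a \<in> A" for a
    using A[OF that] by (simp add: t_def q_def red_part_def P_def del: o_apply)
  have q: "q a \<in> \<ll>" for a by (simp add: q_def Q_\<ll>)
  \<comment> \<open>Invariance of \<open>t\<close> under \<open>q a\<close>, followed by skewness.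
    This symmetry is what cancels the mixed brackets.\<close>
  have f: "f a b c = f a c b" if "b \<in> A" "c \<in> A" for a b c
    using skew_skew[OF red_part_skew[OF l] A(1)[OF that(2)] dual_closed(1)[OF A(1)[OF that(1)]]]
      red_part_invariant[OF l q A(1)[OF that(1)]] A(1)[OF that(2)]
    by (simp add: f_def t_def dual_minus)
  have sz: "(\<Sum>b\<in>B. a b * h b) = 0" if "a \<in> A" for a h
    by (rule sum.neutral) (simp add: A(2)[OF that])
  have "\<zeta> (\<phi> \<xi> \<eta>) = Lin l {#} \<xi> \<eta> \<zeta> + Quad l l {#} \<xi> \<eta> \<zeta>"
    using dynD(4)[OF l, of \<xi> \<eta> \<zeta> "{#}"] x A(1) by (simp add: A_def Con_def fconst_def)
  also have "\<dots> = - cyc (\<lambda>\<xi> \<eta> \<zeta>. \<zeta> (\<omega> (l {#} \<xi>) \<eta>) + \<zeta> (br (l {#} \<xi>) (l {#} \<eta>))) \<xi> \<eta> \<zeta>"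
    using x sz unfolding A_def by (simp add: Lin_def Quad_def cyc_def)
  finally have 1: "\<zeta> (\<phi> \<xi> \<eta>) = \<dots>" .
  have 2: "\<omega> (l {#} a) b = \<omega> (t a) b" if "a \<in> A" for a b
    using lt[OF that] by (simp add: \<omega>_add \<omega>_\<ll>[OF q])
  have 3: "c (br (l {#} a) (l {#} b)) = c (br (t a) (t b)) + f a b c - f b a c" if "a \<in> A" "b \<in> A" "c \<in> A" for a b c
    using lt[OF that(1)] lt[OF that(2)] A(1)[OF that(3)] A(3)[OF that(3) br_\<ll>[OF q q]] br_anti[of "t a" "q b"]
    by (simp add: f_def br_add_left br_add_right dual_simps)
  have "\<xi> \<in> A" "\<eta> \<in> A" "\<zeta> \<in> A" using x by (simp_all add: A_def)
  then show ?thesis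
    unfolding twist_form_def 1 t_def[symmetric]
    using f[of \<eta> \<zeta> \<xi>] f[of \<zeta> \<xi> \<eta>] f[of \<xi> \<eta> \<zeta>]
    by (simp add: cyc_def 2 3 A(1) dual_add)
qed

lemma red_part_reduced_moduli:
  assumes "l \<in> dyn"
  shows "red_part l \<in> reduced_moduli sc br \<omega> \<phi> \<ll> \<mm>"
  using assms red_part_skew red_part_wedge2 red_part_twist_form
  by (simp add: reduced_moduli_def invariant_wedge2_def ad_star_def red_part_invariant del: o_apply)

text \<open>The difference between the invariant and l_0 is constant in p, hence trivially closed,
  and has no \<mm>-\<mm> component. The homotopy in degree 0 gives a linear \<Sigma> that removes
  it.\<close>

lemma exists_reduced_representative:
  assumes l: "l \<in> dyn"
  shows "\<exists>S\<in>gg. maps_into_wedge2 sc \<ll> \<mm> (act S l {#})"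
proof -
  define C where "C \<alpha> = (if \<alpha> = {#} then fun_scale sc (-1) (l {#}) + red_part l else 0)" for \<alpha> :: "'g multiset"
  have C_eq: "C \<alpha> \<xi> = (if \<alpha> = {#} then red_part l \<xi> - l {#} \<xi> else 0)" for \<alpha> \<xi>
    by (simp add: C_def fun_scale_def)
  have C_sk: "C \<alpha> \<in> SK" for \<alpha>
    unfolding C_def using dynD(1)[OF l, of "{#}"] red_part_skew[OF l]
    by (simp only: skew_add_closed skew_scale_closed zero_skew split: if_split) simp
  have hp0: "hp b C \<alpha> \<eta> = 0" for b \<alpha> \<eta> by (simp add: hp_eq C_eq)
  have C_inv: "invariant C"
  proof (rule invariantI)
    fix z \<xi> \<alpha> assume z: "z \<in> \<ll>" "\<xi> \<in> D"
    have "dz z (\<lambda>\<mu>. C \<mu> \<xi>) \<alpha> = 0" using hp0 by (simp add: dz_eq hp_def)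
    then show "dz z (\<lambda>\<mu>. C \<mu> \<xi>) \<alpha> = - br z (C \<alpha> \<xi>) - C \<alpha> (\<xi> \<circ> br z)"
      using z by (simp add: C_eq br_right.zero br_right.diff dynl_0_invariant[OF l] red_part_invariant[OF l] del: o_apply)
  qed
  have C_supp: "supp C" by (simp add: supp_def fun_eq_iff C_eq)
  have deg: "C \<alpha> = 0" if "size \<alpha> \<noteq> 0" for \<alpha> using that by (auto simp: C_def)
  have closed: "cyc (\<lambda>\<xi> \<eta> \<zeta>. \<Sum>b\<in>B. \<xi> b * \<zeta> (hp b C \<alpha> \<eta>)) \<xi> \<eta> \<zeta> = 0"
    if "\<xi> \<in> D" "\<eta> \<in> D" "\<zeta> \<in> D" for \<xi> \<eta> \<zeta> \<alpha>
    using that by (simp add: cyc_def hp0 dual_zero)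
  have red0: "P (C \<alpha> (\<xi> \<circ> P)) = 0" if "\<xi> \<in> D" for \<alpha> \<xi>
  proof -
    have "(\<xi> \<circ> P) \<circ> P = \<xi> \<circ> P" by (simp add: fun_eq_iff P_id P_\<mm>)
    then show ?thesis
      using that by (simp add: C_eq red_part_def comp_P_Q_dual P.diff P.zero P_id P_\<mm> del: o_apply)
  qed
  obtain G where G: "supp G" "equivariant G" "\<And>\<alpha>. size \<alpha> \<noteq> Suc 0 \<Longrightarrow> G \<alpha> = 0"
    "\<And>\<alpha> \<xi>. \<xi> \<in> D \<Longrightarrow> vop G \<alpha> \<xi> - qop G \<alpha> \<xi> = C \<alpha> \<xi>"
    using homotopy[where C = C and n = 0, OF C_sk C_supp C_inv deg closed red0] by blast
  have g: "G \<in> gg" using G by (simp add: gauge_group_iff)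
  have "act G l {#} \<xi> = red_part l \<xi>" for \<xi>
  proof (cases "\<xi> \<in> D")
    case True
    then show ?thesis using gauge_act_0[where l = l and \<xi> = \<xi>, OF dynD(1)[OF l] g] G(4)[OF True] by (simp add: C_eq)
  qed (simp add: gauge_act_def red_part_def)
  then have "act G l {#} = red_part l" by (intro ext)
  with red_part_wedge2[OF l] have "maps_into_wedge2 sc \<ll> \<mm> (act G l {#})" by (simp only:)
  then show ?thesis using g by (rule bexI)
qed

end

theorem corollary4p8:
  fixes sc :: "'k::{real_normed_field, banach} \<Rightarrow> 'g::ab_group_add \<Rightarrow> 'g"
    and br :: "'g \<Rightarrow> 'g \<Rightarrow> 'g"
    and \<omega> :: "'g \<Rightarrow> ('g \<Rightarrow> 'k) \<Rightarrow> 'g"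
    and \<phi> :: "('g \<Rightarrow> 'k) \<Rightarrow> ('g \<Rightarrow> 'k) \<Rightarrow> 'g"
    and \<ll> \<mm> B :: "'g set"
  assumes "lie_quasi_bialgebra sc br \<omega> \<phi>"
    and "reductive_decomposition sc br \<ll> \<mm>"
    and "\<forall>z\<in>\<ll>. \<omega> z = 0"
    and "\<not> module.dependent sc B" and "module.span sc B = \<ll>"
  shows "\<exists>F. F \<in> moduli_space sc br \<omega> \<phi> \<ll> B \<rightarrow> reduced_moduli sc br \<omega> \<phi> \<ll> \<mm> \<and>
             inj_on F (moduli_space sc br \<omega> \<phi> \<ll> B) \<and>
             (\<forall>C \<in> moduli_space sc br \<omega> \<phi> \<ll> B.
                (\<exists>l\<in>C. maps_into_wedge2 sc \<ll> \<mm> (l {#})) \<and>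
                (\<forall>l\<in>C. maps_into_wedge2 sc \<ll> \<mm> (l {#}) \<longrightarrow> F C = l {#}))"
proof -
  have "vector_space sc"
    using assms(1) by (auto simp: lie_quasi_bialgebra_def lie_algebra_on_def)
  then interpret reductive_lqb sc br \<omega> \<phi> \<ll> \<mm> B
    using assms by (simp add: reductive_lqb_def reductive_lqb_axioms_def)
  define orbit where "orbit l = {act S l | S. S \<in> gg}" for l
  \<comment> \<open>The invariant is constant on orbits, so the chosen element does not matter;
    defining \<open>F\<close> by the invariant avoids choosing a reduced representative.\<close>
  define F where "F C = red_part (SOME l. l \<in> C)" for C
  have orbit: "l' \<in> dyn" "red_part l' = red_part l" if m: "l \<in> dyn" "l' \<in> orbit l" for l l'
  proof -
    obtain S where S: "S \<in> gg" "l' = act S l" using m(2) unfolding orbit_def by blast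
    show "l' \<in> dyn" unfolding S(2) by (rule gauge_act_Dynl[OF m(1) S(1)])
    show "red_part l' = red_part l"
      unfolding S(2) by (rule red_part_gauge[where l = l, OF dynD(1)[OF m(1)] S(1)])
  qed
  have act_orbit: "act S l \<in> orbit l" if "S \<in> gg" for S l
    using that unfolding orbit_def by blast
  have F: "F (orbit l) = red_part l" if "l \<in> dyn" for l
  proof -
    have "\<exists>l'. l' \<in> orbit l" using act_orbit[OF zero_gauge] by blast
    then have "(SOME l'. l' \<in> orbit l) \<in> orbit l" by (rule someI_ex)
    then show ?thesis unfolding F_def by (rule orbit(2)[OF that])
  qed
  \<comment> \<open>Each element of the first orbit is again dynamical with the common invariant, so
    transitivity reaches it directly from \<open>l'\<close>.\<close>
  have sub: "orbit l \<subseteq> orbit l'" if l: "l \<in> dyn" "l' \<in> dyn" "red_part l = red_part l'" for l l'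
  proof
    fix m assume m: "m \<in> orbit l"
    have "red_part l' = red_part m" using orbit(2)[OF l(1) m] l(3) by simp
    from gauge_transitive[OF l(2) orbit(1)[OF l(1) m] this] obtain S where "S \<in> gg" "act S l' = m" by blast
    then show "m \<in> orbit l'" using act_orbit by blast
  qed
  have M: "moduli_space sc br \<omega> \<phi> \<ll> B = orbit ` dyn" by (simp add: moduli_space_def orbit_def)
  show ?thesis
  proof (intro exI[of _ F] conjI)
    show "F \<in> moduli_space sc br \<omega> \<phi> \<ll> B \<rightarrow> reduced_moduli sc br \<omega> \<phi> \<ll> \<mm>"
      unfolding M by (auto simp: F red_part_reduced_moduli)
    show "inj_on F (moduli_space sc br \<omega> \<phi> \<ll> B)"
      unfolding M
    proof (rule inj_onI)
      fix C C' assume "C \<in> orbit ` dyn" "C' \<in> orbit ` dyn" and FF: "F C = F C'"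
      then obtain l l' where l: "l \<in> dyn" "l' \<in> dyn" and C: "C = orbit l" "C' = orbit l'" by blast
      have r: "red_part l = red_part l'" using FF unfolding C F[OF l(1)] F[OF l(2)] .
      show "C = C'" unfolding C
        by (rule subset_antisym[OF sub[OF l r] sub[OF l(2,1) r[symmetric]]])
    qed
    show "\<forall>C\<in>moduli_space sc br \<omega> \<phi> \<ll> B. (\<exists>l\<in>C. maps_into_wedge2 sc \<ll> \<mm> (l {#})) \<and>
        (\<forall>l\<in>C. maps_into_wedge2 sc \<ll> \<mm> (l {#}) \<longrightarrow> F C = l {#})"
    proof
      fix C assume "C \<in> moduli_space sc br \<omega> \<phi> \<ll> B"
      then obtain l where l: "l \<in> dyn" and C: "C = orbit l" unfolding M by blast
      have "F C = l' {#}" if m: "l' \<in> C" "maps_into_wedge2 sc \<ll> \<mm> (l' {#})" for l'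
      proof -
        have l': "l' \<in> dyn" "red_part l' = red_part l" using orbit[OF l] m(1) unfolding C by blast+
        show ?thesis
          unfolding C F[OF l] l'(2)[symmetric] by (rule wedge2_red_part[where l = l', OF dynD(1)[OF l'(1)] m(2), symmetric])
      qed
      moreover obtain S where "S \<in> gg" "maps_into_wedge2 sc \<ll> \<mm> (act S l {#})"
        using exists_reduced_representative[OF l] by blast
      ultimately show "(\<exists>l\<in>C. maps_into_wedge2 sc \<ll> \<mm> (l {#})) \<and>
          (\<forall>l\<in>C. maps_into_wedge2 sc \<ll> \<mm> (l {#}) \<longrightarrow> F C = l {#})"
        using act_orbit[of S l] unfolding C by blast
    qed
  qed
qed

end
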